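(* Let $\Sigma$ be a Riemann surface, let $\varphi:\Sigma\to S^6\subset\mathbb{R}^7$ be a conformal harmonic immersion and let $F:\Sigma\to\mathbb{R}^7$ be such that $dF=\varphi\times *d\varphi$. If $F$ is pseudo-umbilical with non-parallel mean curvature vector field, then $\varphi$ belongs to one of the following classes of harmonic maps: (1) $\varphi$ is full and superminimal in $S^4=S^6\cap W$, for some $5$-dimensional vector subspace $W$ of $\mathbb{R}^7$; (2) $\varphi$ has finite isotropy order $r=3$ and is full in $S^4=S^6\cap W$, for some $5$-dimensional vector subspace $W$ of $\mathbb{R}^7$; (3) $\varphi$ is superconformal in $S^3=S^6\cap W$, for some $4$-plane $W$ admitting a $\times$-compatible decomposition. Conversely, if $\varphi$ is a superconformal harmonic map in $S^3=S^6\cap W$, for some $4$-plane $W$ admitting a $\times$-compatible decomposition, then $F$ is pseudo-umbilical with non-parallel mean curvature vector field.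
   Context: $\times$ is the $7$-dimensional cross product on $\mathbb{R}^7$: the bilinear antisymmetric product with $\mathbf{e}_i\times\mathbf{e}_j=\mathbf{e}_k$ for $(i,j,k)$ equal to, or a cyclic permutation of, one of $(1,2,3),(1,4,5),(1,7,6),(2,4,6),(2,5,7),(3,4,7),(3,6,5)$. $S^6$ is the unit sphere of $\mathbb{R}^7$. For subspaces $A,B$, $A\times B$ is the span of all products $\mathbf{a}\times\mathbf{b}$. For a $4$-dimensional subspace $W\subset\mathbb{R}^7$, an orthogonal direct sum decomposition $W=W_1\oplus W_2$ with $\dim W_1=\dim W_2=2$ is $\times$-compatible if $W_1\times W_1\perp W_2\times W_2$. With a local conformal coordinate $z=x+iy$, $dF=\varphi\times *d\varphi$ means $F_x=\varphi\times\varphi_y$, $F_y=-\varphi\times\varphi_x$ ($F$ exists if $\Sigma$ is simply connected, and is unique up to an additive constant; it is a conformal immersion). $\mathbf{I}_F$, $\mathbf{I\!I}_F$ are the first and second fundamental forms, $\mathbf{h}_F=\frac12\mathrm{tr}\,\mathbf{I}_F^{-1}\mathbf{I\!I}_F$ is the mean curvature vector; it is parallel if its covariant derivative in the normal bundle $TF^\perp$ vanishes identically. $F$ is pseudo-umbilical if $\mathbf{I\!I}_F\cdot\mathbf{h}_F=\lambda\,\mathbf{I}_F$ for some smooth function $\lambda$ on $\Sigma$. Harmonic sequence: a harmonic map $\varphi:\Sigma\to S^n\subset\mathbb{R}^{n+1}$ is identified with the line subbundle $\varphi_0=\varphi$ it spans in $\Sigma\times\mathbb{C}^{n+1}$ (a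 harmonic map into $\mathbb{C}P^n$). For $j\ge0$, $\varphi_{j+1}$ is the image bundle (extended across isolated singularities) of $A'_{\varphi_j}(v)=P^{\perp_h}_{\varphi_j}(\partial v/\partial z)$, where $v$ is a section of $\varphi_j$ and $P^{\perp_h}_{\varphi_j}$ is the Hermitian projection onto the orthogonal bundle of $\varphi_j$; $\varphi_{-j}=\overline{\varphi_j}$. The isotropy order of $\varphi$ is $r>0$ if $\varphi\perp_h\varphi_i$ for $0<i\le r$ but $\varphi\not\perp_h\varphi_{r+1}$, where $\perp_h$ is orthogonality for the standard Hermitian product. $\varphi$ is superminimal (or isotropic) if $\varphi_j=\{0\}$ for some $j>0$ (so it has infinite isotropy order). A harmonic map into a sphere $S^m=S^6\cap W$ ($\dim W=m+1$) is superconformal in $S^m$ if its isotropy order is $r=m$; it is full in $S^m=S^6\cap W$ if its image lies in $W$ and in no proper linear subspace of $W$. *)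

theory Defs
  imports "HOL-Analysis.Analysis"
begin

section \<open>The seven-dimensional cross product\<close>

text \<open>The type \<open>7\<close> consists of the residues modulo 7, so the index \<open>7\<close> denotes the same
  coordinate as \<open>0\<close>.\<close>

definition cross7_triples :: "(7 \<times> 7 \<times> 7) list" where
  "cross7_triples = [(1,2,3), (1,4,5), (1,7,6), (2,4,6), (2,5,7), (3,4,7), (3,6,5)]"

definition cross7 :: "real^7 \<Rightarrow> real^7 \<Rightarrow> real^7" where
  "cross7 x y = (\<Sum>(i,j,k)\<leftarrow>cross7_triples.
      (x $ i * y $ j - x $ j * y $ i) *\<^sub>R axis k 1
    + (x $ j * y $ k - x $ k * y $ j) *\<^sub>R axis i 1
    + (x $ k * y $ i - x $ i * y $ k) *\<^sub>R axis j 1)"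

lemma cross7_antisym: "cross7 x y = - cross7 y x"
  unfolding cross7_def uminus_sum_list_map comp_def
  by (intro arg_cong[where f = sum_list] map_cong refl)
    (auto simp: algebra_simps)

lemma bilinear_cross7: "bilinear cross7"
proof -
  have add: "cross7 (x + y) z = cross7 x z + cross7 y z" for x y z
    unfolding cross7_def sum_list_addf[symmetric]
    by (intro arg_cong[where f = sum_list] map_cong refl) (auto simp: algebra_simps)
  have scale: "cross7 (c *\<^sub>R x) z = c *\<^sub>R cross7 x z" for c x z
  proof -
    have *: "c *\<^sub>R sum_list (map f xs) = sum_list (map (\<lambda>t. c *\<^sub>R f t) xs)"
      for f :: "7 \<times> 7 \<times> 7 \<Rightarrow> real^7" and xs
      by (induction xs) (simp_all add: scaleR_add_right)
    show ?thesis
      unfolding cross7_def *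
      by (intro arg_cong[where f = sum_list] map_cong refl) (auto simp: algebra_simps)
  qed
  have "linear (\<lambda>x. cross7 x z)" for z
    by (rule linearI) (simp_all add: add scale)
  moreover from this have "linear (\<lambda>z. cross7 x z)" for x
    by (subst cross7_antisym) (rule linear_compose_neg)
  ultimately show ?thesis
    by (simp add: bilinear_def)
qed

lemma cross7_axis:
  assumes "(i,j,k) \<in> set cross7_triples"
  shows "cross7 (axis i 1) (axis j 1) = axis k 1"
    and "cross7 (axis j 1) (axis k 1) = axis i 1"
    and "cross7 (axis k 1) (axis i 1) = axis j 1"
proof -
  have nth: "axis a (1::real) $ b = (if a = b then 1 else 0)" for a b :: 7
    by (simp add: axis_def)
  have "list_all (\<lambda>(i,j,k). cross7 (axis i 1) (axis j 1) = axis k 1 \<and>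
      cross7 (axis j 1) (axis k 1) = axis i 1 \<and> cross7 (axis k 1) (axis i 1) = axis j 1)
      cross7_triples"
    by (simp add: cross7_def cross7_triples_def nth)
  with assms show "cross7 (axis i 1) (axis j 1) = axis k 1"
    and "cross7 (axis j 1) (axis k 1) = axis i 1"
    and "cross7 (axis k 1) (axis i 1) = axis j 1"
    unfolding list_all_iff by blast+
qed

definition cross_span :: "(real^7) set \<Rightarrow> (real^7) set \<Rightarrow> (real^7) set" where
  "cross_span A B = span {cross7 a b | a b. a \<in> A \<and> b \<in> B}"

definition cross_compatible :: "(real^7) set \<Rightarrow> (real^7) set \<Rightarrow> (real^7) set \<Rightarrow> bool" where
  "cross_compatible W W1 W2 \<longleftrightarrow>
     subspace W1 \<and> subspace W2 \<and> dim W1 = 2 \<and> dim W2 = 2 \<and>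
     (\<forall>a\<in>W1. \<forall>b\<in>W2. orthogonal a b) \<and> W = {a + b | a b. a \<in> W1 \<and> b \<in> W2} \<and>
     (\<forall>u\<in>cross_span W1 W1. \<forall>v\<in>cross_span W2 W2. orthogonal u v)"

definition admits_cross_compatible :: "(real^7) set \<Rightarrow> bool" where
  "admits_cross_compatible W \<longleftrightarrow> (\<exists>W1 W2. cross_compatible W W1 W2)"

section \<open>Calculus on open subsets of the complex plane\<close>

text \<open>The derivative of \<open>f\<close> at \<open>w\<close> in the real direction \<open>a\<close>; thus \<open>pd 1 f\<close> and \<open>pd \<i> f\<close>
  are the partial derivatives of \<open>f\<close> with respect to \<open>x\<close> and \<open>y\<close>, where \<open>z = x + \<i> y\<close>.\<close>

definition pd :: "complex \<Rightarrow> (complex \<Rightarrow> 'b::real_normed_vector) \<Rightarrow> complex \<Rightarrow> 'b" where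
  "pd a f w = frechet_derivative f (at w) a"

primrec Ck_on :: "nat \<Rightarrow> complex set \<Rightarrow> (complex \<Rightarrow> 'b::real_normed_vector) \<Rightarrow> bool" where
  "Ck_on 0 D f \<longleftrightarrow> continuous_on D f"
| "Ck_on (Suc k) D f \<longleftrightarrow>
     (\<forall>w\<in>D. f differentiable (at w)) \<and> Ck_on k D (pd 1 f) \<and> Ck_on k D (pd \<i> f)"

text \<open>Meaningful for open \<open>D\<close> only.\<close>

definition smooth_on :: "complex set \<Rightarrow> (complex \<Rightarrow> 'b::real_normed_vector) \<Rightarrow> bool" where
  "smooth_on D f \<longleftrightarrow> (\<forall>k. Ck_on k D f)"

definition dz :: "(complex \<Rightarrow> complex^'n) \<Rightarrow> complex \<Rightarrow> complex^'n" where
  "dz v w = (1/2) *s (pd 1 v w - \<i> *s pd \<i> v w)"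

section \<open>Riemann surfaces\<close>

type_synonym 'a atlas = "('a set \<times> ('a \<Rightarrow> complex)) set"

text \<open>Second countability is not required: it is automatic by Rado's theorem.\<close>

definition riemann_surface :: "'a topology \<Rightarrow> 'a atlas \<Rightarrow> bool" where
  "riemann_surface X A \<longleftrightarrow>
     topspace X \<noteq> {} \<and> connected_space X \<and> Hausdorff_space X \<and>
     (\<Union>(U,z)\<in>A. U) = topspace X \<and>
     (\<forall>(U,z)\<in>A. openin X U \<and> open (z ` U) \<and>
        homeomorphic_map (subtopology X U) (top_of_set (z ` U)) z) \<and>
     (\<forall>(U,z)\<in>A. \<forall>(V,w)\<in>A. (w \<circ> inv_into U z) holomorphic_on z ` (U \<inter> V))"

text \<open>Every notion below is stated in all charts of the given atlas; each of them is invariant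
  under holomorphic changes of coordinate, so no generality is lost by not passing to the
  maximal atlas.\<close>

definition in_chart :: "'a set \<Rightarrow> ('a \<Rightarrow> complex) \<Rightarrow> ('a \<Rightarrow> 'b) \<Rightarrow> complex \<Rightarrow> 'b" where
  "in_chart U z f = f \<circ> inv_into U z"

definition smooth_map :: "'a atlas \<Rightarrow> ('a \<Rightarrow> 'b::real_normed_vector) \<Rightarrow> bool" where
  "smooth_map A f \<longleftrightarrow> (\<forall>(U,z)\<in>A. smooth_on (z ` U) (in_chart U z f))"

definition conformal_immersion :: "'a atlas \<Rightarrow> ('a \<Rightarrow> 'b::real_inner) \<Rightarrow> bool" where
  "conformal_immersion A f \<longleftrightarrow> smooth_map A f \<and>
     (\<forall>(U,z)\<in>A. \<forall>w\<in>z ` U. let g = in_chart U z f in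
        pd 1 g w \<noteq> 0 \<and> pd 1 g w \<bullet> pd 1 g w = pd \<i> g w \<bullet> pd \<i> g w \<and> pd 1 g w \<bullet> pd \<i> g w = 0)"

text \<open>Up to a positive conformal factor, the tension field of a map into the unit sphere is the
  component of its coordinate Laplacian tangent to the sphere.\<close>

definition harmonic_into_sphere :: "'a topology \<Rightarrow> 'a atlas \<Rightarrow> ('a \<Rightarrow> 'b::real_inner) \<Rightarrow> bool" where
  "harmonic_into_sphere X A f \<longleftrightarrow> smooth_map A f \<and> f ` topspace X \<subseteq> sphere 0 1 \<and>
     (\<forall>(U,z)\<in>A. \<forall>w\<in>z ` U.
        let g = in_chart U z f; L = pd 1 (pd 1 g) w + pd \<i> (pd \<i> g) w
        in L - (L \<bullet> g w) *\<^sub>R g w = 0)"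

text \<open>\<open>dF = \<phi> \<times> *d\<phi>\<close>\<close>

definition is_cross_primitive :: "'a atlas \<Rightarrow> ('a \<Rightarrow> real^7) \<Rightarrow> ('a \<Rightarrow> real^7) \<Rightarrow> bool" where
  "is_cross_primitive A \<phi> F \<longleftrightarrow> smooth_map A F \<and>
     (\<forall>(U,z)\<in>A. \<forall>w\<in>z ` U. let f = in_chart U z F; g = in_chart U z \<phi> in
        pd 1 f w = cross7 (g w) (pd \<i> g w) \<and> pd \<i> f w = - cross7 (g w) (pd 1 g w))"

section \<open>Submanifold geometry of an immersed surface\<close>

text \<open>In the following definitions \<open>f\<close> is an immersion of an open subset of the plane, \<open>w\<close> a
  point of that subset, and \<open>a\<close>, \<open>b\<close> are tangent vectors of the plane.\<close>

definition orth_proj :: "'b::euclidean_space set \<Rightarrow> 'b \<Rightarrow> 'b" where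
  "orth_proj S v = (THE u. u \<in> S \<and> (\<forall>s\<in>S. orthogonal (v - u) s))"

definition normal_part :: "(complex \<Rightarrow> 'b::euclidean_space) \<Rightarrow> complex \<Rightarrow> 'b \<Rightarrow> 'b" where
  "normal_part f w v = v - orth_proj (span {pd 1 f w, pd \<i> f w}) v"

definition fff :: "(complex \<Rightarrow> 'b::euclidean_space) \<Rightarrow> complex \<Rightarrow> complex \<Rightarrow> complex \<Rightarrow> real" where
  "fff f w a b = pd a f w \<bullet> pd b f w"

definition sff :: "(complex \<Rightarrow> 'b::euclidean_space) \<Rightarrow> complex \<Rightarrow> complex \<Rightarrow> complex \<Rightarrow> 'b" where
  "sff f w a b = normal_part f w (pd a (pd b f) w)"

text \<open>Half the trace of the inverse of the first fundamental form times the second one, with the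
  2 by 2 inverse written out by Cramer's rule.\<close>

definition mean_curvature :: "(complex \<Rightarrow> 'b::euclidean_space) \<Rightarrow> complex \<Rightarrow> 'b" where
  "mean_curvature f w =
     (1 / (2 * (fff f w 1 1 * fff f w \<i> \<i> - (fff f w 1 \<i>)\<^sup>2))) *\<^sub>R
       (fff f w \<i> \<i> *\<^sub>R sff f w 1 1 - (2 * fff f w 1 \<i>) *\<^sub>R sff f w 1 \<i> + fff f w 1 1 *\<^sub>R sff f w \<i> \<i>)"

definition parallel_mean_curvature :: "'a atlas \<Rightarrow> ('a \<Rightarrow> 'b::euclidean_space) \<Rightarrow> bool" where
  "parallel_mean_curvature A F \<longleftrightarrow>
     (\<forall>(U,z)\<in>A. \<forall>w\<in>z ` U. \<forall>a. let f = in_chart U z F in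
        normal_part f w (pd a (mean_curvature f) w) = 0)"

definition pseudo_umbilical :: "'a atlas \<Rightarrow> ('a \<Rightarrow> 'b::euclidean_space) \<Rightarrow> bool" where
  "pseudo_umbilical A F \<longleftrightarrow>
     (\<exists>l :: 'a \<Rightarrow> real. smooth_map A l \<and>
       (\<forall>(U,z)\<in>A. \<forall>p\<in>U. \<forall>a b. let f = in_chart U z F; w = z p in
          sff f w a b \<bullet> mean_curvature f w = l p * fff f w a b))"

section \<open>Harmonic sequences\<close>

text \<open>A family of complex subspaces of \<open>\<complex>\<^sup>n\<close> indexed by the points of the surface represents a
  subbundle of the trivial bundle.\<close>

definition hinner :: "complex^'n \<Rightarrow> complex^'n \<Rightarrow> complex" where
  "hinner u v = (\<Sum>i\<in>UNIV. u $ i * cnj (v $ i))"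

definition herm_perp_part :: "(complex^'n) set \<Rightarrow> complex^'n \<Rightarrow> complex^'n" where
  "herm_perp_part B v = (THE u. (\<forall>b\<in>B. hinner u b = 0) \<and> v - u \<in> B)"

definition line_of :: "real^'n \<Rightarrow> (complex^'n) set" where
  "line_of x = vec.span {\<chi> i. complex_of_real (x $ i)}"

definition smooth_subbundle :: "'a atlas \<Rightarrow> nat \<Rightarrow> ('a \<Rightarrow> (complex^'n) set) \<Rightarrow> bool" where
  "smooth_subbundle A k B \<longleftrightarrow>
     (\<forall>(U,z)\<in>A. \<forall>p\<in>U. \<exists>D s. open D \<and> z p \<in> D \<and> D \<subseteq> z ` U \<and>
        (\<forall>i<k. smooth_on D (s i)) \<and>
        (\<forall>w\<in>D. inj_on (\<lambda>i. s i w) {..<k} \<and> vec.independent ((\<lambda>i. s i w) ` {..<k}) \<and>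
           in_chart U z B w = vec.span ((\<lambda>i. s i w) ` {..<k})))"

definition local_section ::
  "'a set \<Rightarrow> ('a \<Rightarrow> complex) \<Rightarrow> ('a \<Rightarrow> (complex^'n) set) \<Rightarrow> complex set \<Rightarrow> (complex \<Rightarrow> complex^'n) \<Rightarrow> bool"
  where
  "local_section U z B D v \<longleftrightarrow>
     open D \<and> D \<subseteq> z ` U \<and> smooth_on D v \<and> (\<forall>w\<in>D. v w \<in> in_chart U z B w)"

text \<open>The image at \<open>p\<close> of \<open>A'\<^sub>B(v) = P\<^sub>B\<^sup>\<bottom>(\<partial>v/\<partial>z)\<close>.\<close>

definition A'_image ::
  "'a set \<Rightarrow> ('a \<Rightarrow> complex) \<Rightarrow> ('a \<Rightarrow> (complex^'n) set) \<Rightarrow> 'a \<Rightarrow> (complex^'n) set" where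
  "A'_image U z B p =
     {herm_perp_part (B p) (dz v (z p)) | v D. z p \<in> D \<and> local_section U z B D v}"

text \<open>\<open>C\<close> is the image bundle of \<open>A'\<^sub>B\<close> extended across isolated singularities: a smooth
  subbundle that agrees with the pointwise image off a set without accumulation points.
  The rank of \<open>C\<close> is 0 if \<open>A'\<^sub>B\<close> vanishes identically.\<close>

definition image_bundle ::
  "'a topology \<Rightarrow> 'a atlas \<Rightarrow> ('a \<Rightarrow> (complex^'n) set) \<Rightarrow> ('a \<Rightarrow> (complex^'n) set) \<Rightarrow> bool" where
  "image_bundle X A B C \<longleftrightarrow>
     (\<exists>k. smooth_subbundle A k C) \<and>
     (\<exists>Z \<subseteq> topspace X. X derived_set_of Z = {} \<and>
        (\<forall>(U,z)\<in>A. \<forall>p\<in>U - Z. C p = A'_image U z B p))"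

definition harmonic_sequence ::
  "'a topology \<Rightarrow> 'a atlas \<Rightarrow> ('a \<Rightarrow> real^'n) \<Rightarrow> (nat \<Rightarrow> 'a \<Rightarrow> (complex^'n) set) \<Rightarrow> bool" where
  "harmonic_sequence X A \<phi> \<Phi> \<longleftrightarrow>
     (\<forall>p\<in>topspace X. \<Phi> 0 p = line_of (\<phi> p)) \<and> (\<forall>j. image_bundle X A (\<Phi> j) (\<Phi> (Suc j)))"

definition bundle_perp ::
  "'a topology \<Rightarrow> ('a \<Rightarrow> (complex^'n) set) \<Rightarrow> ('a \<Rightarrow> (complex^'n) set) \<Rightarrow> bool" where
  "bundle_perp X B C \<longleftrightarrow> (\<forall>p\<in>topspace X. \<forall>u\<in>B p. \<forall>v\<in>C p. hinner u v = 0)"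

text \<open>Over the surface the harmonic sequence of a harmonic map exists and is unique, so that
  quantifying it existentially amounts to speaking about ``the'' harmonic sequence.\<close>

definition isotropy_order :: "'a topology \<Rightarrow> 'a atlas \<Rightarrow> ('a \<Rightarrow> real^'n) \<Rightarrow> nat \<Rightarrow> bool" where
  "isotropy_order X A \<phi> r \<longleftrightarrow> r > 0 \<and>
     (\<exists>\<Phi>. harmonic_sequence X A \<phi> \<Phi> \<and>
        (\<forall>i. 0 < i \<and> i \<le> r \<longrightarrow> bundle_perp X (\<Phi> 0) (\<Phi> i)) \<and>
        \<not> bundle_perp X (\<Phi> 0) (\<Phi> (r + 1)))"

definition superminimal :: "'a topology \<Rightarrow> 'a atlas \<Rightarrow> ('a \<Rightarrow> real^'n) \<Rightarrow> bool" where
  "superminimal X A \<phi> \<longleftrightarrow>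
     (\<exists>\<Phi>. harmonic_sequence X A \<phi> \<Phi> \<and> (\<exists>j>0. \<forall>p\<in>topspace X. \<Phi> j p = {0}))"

text \<open>In the next two definitions the sphere is \<open>sphere 0 1 \<inter> W\<close>, of dimension \<open>dim W - 1\<close>.\<close>

definition full_in :: "'a topology \<Rightarrow> ('a \<Rightarrow> real^'n) \<Rightarrow> (real^'n) set \<Rightarrow> bool" where
  "full_in X \<phi> W \<longleftrightarrow> subspace W \<and> \<phi> ` topspace X \<subseteq> sphere 0 1 \<inter> W \<and>
     (\<forall>V. subspace V \<and> V \<subset> W \<longrightarrow> \<not> \<phi> ` topspace X \<subseteq> V)"

definition superconformal_in :: "'a topology \<Rightarrow> 'a atlas \<Rightarrow> ('a \<Rightarrow> real^'n) \<Rightarrow> (real^'n) set \<Rightarrow> bool" where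
  "superconformal_in X A \<phi> W \<longleftrightarrow> subspace W \<and> \<phi> ` topspace X \<subseteq> sphere 0 1 \<inter> W \<and>
     (\<exists>m. dim W = m + 1 \<and> isotropy_order X A \<phi> m)"

end

theory Submission
  imports Defs "HOL-Complex_Analysis.Complex_Analysis"
begin

no_notation fps_nth (infixl \<open>$\<close> 75)

text \<open>
  Write \<open>a = \<phi>\<^sub>z\<close>, let \<open>\<xi>\<close> be the normal component of \<open>\<phi>\<^sub>z\<^sub>z\<close>, \<open>H = a \<times> \<^bold>a\<close> with \<open>\<^bold>a\<close> the conjugate
  of \<open>a\<close>, and let dots be complex bilinear. Then \<open>F\<^sub>z = \<i> \<phi> \<times> a\<close>, the mean curvature vector of \<open>F\<close> is a
  multiple of \<open>H\<close>, and \<open>F\<close> is pseudo-umbilical iff \<open>(\<phi> \<times> \<xi>) \<bullet> H = 0\<close>; in that case the normal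
  derivative of the mean curvature vector is a multiple of \<open>\<xi> \<times> \<^bold>a\<close>.

  Differentiating the pseudo-umbilicity condition shows that, wherever \<open>\<xi>\<close> and its conjugate are
  linearly independent, the cubic form \<open>\<phi> \<bullet> (x \<times> (y \<times> z))\<close> vanishes on the complex span of
  \<open>a\<close>, \<open>\<xi>\<close> and their conjugates, so that this space is invariant under \<open>\<phi> \<times> _\<close>. Differentiating
  the consequences of the invariance once more gives \<open>\<xi> \<times> \<^bold>a = 0\<close> there. Hence if the mean
  curvature vector is not parallel, the holomorphic quartic differential \<open>Q = \<xi> \<bullet> \<xi>\<close> is not
  identically zero, and \<open>\<xi>\<close> is a complex multiple of a real vector. The orthogonal projection onto the
  span of \<open>\<phi>\<close>, its tangent plane and \<open>\<xi>\<close> then has zero derivative off the isolated zeros of \<open>Q\<close>,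
  and \<open>\<phi>\<close> lies in a great 3-sphere: of the three classes in the statement only the third one
  occurs. The \<open>\<times>\<close>-compatible decompositions of a 4-plane exist iff the coassociative 4-form vanishes
  on it, which for that plane is pseudo-umbilicity again.
\<close>

section \<open>Complex bilinear algebra\<close>

text \<open>Working with bilinear rather than Hermitian products lets both Wirtinger derivatives
  obey the plain Leibniz rule, with conjugation exchanging them. The obstacle is that
  pseudo-umbilicity is one scalar equation, which by itself says nothing about the second normal
  directions. It becomes strong because the cubic form is alternating on the complement of the
  position vector: on four vectors it has only four independent values, and these are the equation,
  its antiholomorphic derivative and the two conjugates. Dimension 7 then leaves a complement of
  real dimension at most two, small enough for invariance to be forced. A second difficulty is that
  harmonic sequences are only specified up to existence of subbundles. In one direction a sequence
  must be exhibited that stays smooth across the zeros of the quartic differential; in the other an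
  arbitrary sequence is given, and only the constancy of the rank of a subbundle controls it at
  exceptional points.\<close>

definition bdot :: "complex^'n \<Rightarrow> complex^'n \<Rightarrow> complex" (infixl \<open>\<odot>\<close> 70) where
  "u \<odot> v = (\<Sum>i\<in>UNIV. u $ i * v $ i)"

definition vcnj :: "complex^'n \<Rightarrow> complex^'n" where
  "vcnj u = (\<chi> i. cnj (u $ i))"

definition cvec :: "real^'n \<Rightarrow> complex^'n" where
  "cvec x = (\<chi> i. complex_of_real (x $ i))"

definition ccross :: "complex^7 \<Rightarrow> complex^7 \<Rightarrow> complex^7" (infixl \<open>\<otimes>\<close> 75) where
  "x \<otimes> y = (\<Sum>(i,j,k)\<leftarrow>cross7_triples.
      (x $ i * y $ j - x $ j * y $ i) *s axis k 1
    + (x $ j * y $ k - x $ k * y $ j) *s axis i 1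
    + (x $ k * y $ i - x $ i * y $ k) *s axis j 1)"

lemma UNIV_7: "(UNIV :: 7 set) = {1, 2, 3, 4, 5, 6, 7}"
proof -
  have "card {1, 2, 3, 4, 5, 6, 7 :: 7} = card (UNIV :: 7 set)"
    by simp
  then show ?thesis
    by (metis card_subset_eq finite subset_UNIV)
qed

lemma sum_7: "sum f (UNIV :: 7 set) = f 1 + f 2 + f 3 + f 4 + f 5 + f 6 + f 7"
  unfolding UNIV_7 by (simp add: ac_simps)

lemma forall_7: "(\<forall>i::7. P i) \<longleftrightarrow> P 1 \<and> P 2 \<and> P 3 \<and> P 4 \<and> P 5 \<and> P 6 \<and> P 7"
proof -
  have "(\<forall>i::7. P i) \<longleftrightarrow> (\<forall>i\<in>{1, 2, 3, 4, 5, 6, 7 :: 7}. P i)"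
    unfolding UNIV_7[symmetric] by simp
  then show ?thesis by simp
qed

lemma axis_nth_eq: "axis a (1::'b::zero_neq_one) $ b = (if a = b then 1 else 0)"
  by (simp add: axis_def)

lemma ccross_nth:
  "(x \<otimes> y) $ 1 = x$2 * y$3 - x$3 * y$2 + (x$4 * y$5 - x$5 * y$4) + (x$7 * y$6 - x$6 * y$7)"
  "(x \<otimes> y) $ 2 = x$3 * y$1 - x$1 * y$3 + (x$4 * y$6 - x$6 * y$4) + (x$5 * y$7 - x$7 * y$5)"
  "(x \<otimes> y) $ 3 = x$1 * y$2 - x$2 * y$1 + (x$4 * y$7 - x$7 * y$4) + (x$6 * y$5 - x$5 * y$6)"
  "(x \<otimes> y) $ 4 = x$5 * y$1 - x$1 * y$5 + (x$6 * y$2 - x$2 * y$6) + (x$7 * y$3 - x$3 * y$7)"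
  "(x \<otimes> y) $ 5 = x$1 * y$4 - x$4 * y$1 + (x$7 * y$2 - x$2 * y$7) + (x$3 * y$6 - x$6 * y$3)"
  "(x \<otimes> y) $ 6 = x$1 * y$7 - x$7 * y$1 + (x$2 * y$4 - x$4 * y$2) + (x$5 * y$3 - x$3 * y$5)"
  "(x \<otimes> y) $ 7 = x$6 * y$1 - x$1 * y$6 + (x$2 * y$5 - x$5 * y$2) + (x$3 * y$4 - x$4 * y$3)"
  by (simp_all add: ccross_def cross7_triples_def axis_nth_eq)

lemma bdot_commute: "u \<odot> v = v \<odot> u"
  by (simp add: bdot_def mult.commute)

lemma bdot_simps [simp]:
  "(u + v) \<odot> w = u \<odot> w + v \<odot> w" "w \<odot> (u + v) = w \<odot> u + w \<odot> v"
  "(u - v) \<odot> w = u \<odot> w - v \<odot> w" "w \<odot> (u - v) = w \<odot> u - w \<odot> v"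
  "(- u) \<odot> w = - (u \<odot> w)" "w \<odot> (- u) = - (w \<odot> u)"
  "(c *s u) \<odot> w = c * (u \<odot> w)" "w \<odot> (c *s u) = c * (w \<odot> u)"
  "0 \<odot> w = 0" "w \<odot> 0 = 0"
  by (simp_all add: bdot_def algebra_simps sum.distrib sum_subtractf sum_negf sum_distrib_left)

lemma vcnj_simps [simp]:
  "vcnj (u + v) = vcnj u + vcnj v" "vcnj (u - v) = vcnj u - vcnj v" "vcnj (- u) = - vcnj u"
  "vcnj (c *s u) = cnj c *s vcnj u" "vcnj 0 = 0" "vcnj (vcnj u) = u"
  "vcnj (cvec x) = cvec x"
  by (simp_all add: vcnj_def cvec_def vec_eq_iff)

lemma bdot_vcnj: "vcnj u \<odot> vcnj v = cnj (u \<odot> v)"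
  by (simp add: bdot_def vcnj_def)

lemma bdot_vcnj_left: "vcnj u \<odot> v = cnj (u \<odot> vcnj v)"
  using bdot_vcnj[of u "vcnj v"] by simp

lemma hinner_eq_bdot: "hinner u v = u \<odot> vcnj v"
  by (simp add: hinner_def bdot_def vcnj_def)

lemma bdot_vcnj_self: "u \<odot> vcnj u = of_real (\<Sum>i\<in>UNIV. (cmod (u $ i))\<^sup>2)"
  by (simp only: bdot_def vcnj_def of_real_sum complex_norm_square vec_lambda_beta)

lemma bdot_vcnj_self_eq_0_iff [simp]: "u \<odot> vcnj u = 0 \<longleftrightarrow> u = 0"
  by (auto simp: bdot_vcnj_self sum_nonneg_eq_0_iff vec_eq_iff simp flip: of_real_sum of_real_power)

lemma bdot_vcnj_self_real: "u \<odot> vcnj u \<in> \<real>" "0 \<le> Re (u \<odot> vcnj u)" "cnj (u \<odot> vcnj u) = u \<odot> vcnj u"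
  by (auto simp: bdot_vcnj_self sum_nonneg)

lemma cvec_simps [simp]:
  "cvec (x + y) = cvec x + cvec y" "cvec (x - y) = cvec x - cvec y" "cvec (- x) = - cvec x"
  "cvec (r *\<^sub>R x) = of_real r *s cvec x" "cvec 0 = 0" "cvec x = cvec y \<longleftrightarrow> x = y"
  by (simp_all add: cvec_def vec_eq_iff)

lemma cvec_eq_0_iff [simp]: "cvec x = 0 \<longleftrightarrow> x = 0"
  by (metis cvec_simps(5) cvec_simps(6))

lemma bdot_cvec [simp]: "cvec x \<odot> cvec y = of_real (x \<bullet> y)"
  by (simp add: bdot_def cvec_def inner_vec_def)

lemma cvec_split:
  obtains r i where "x = cvec r + \<i> *s cvec i" "vcnj x = cvec r - \<i> *s cvec i"
    "cvec r = (1/2) *s (x + vcnj x)" "cvec i = (-\<i>/2) *s (x - vcnj x)"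
proof
  show "x = cvec (\<chi> k. Re (x $ k)) + \<i> *s cvec (\<chi> k. Im (x $ k))"
    "vcnj x = cvec (\<chi> k. Re (x $ k)) - \<i> *s cvec (\<chi> k. Im (x $ k))"
    "cvec (\<chi> k. Re (x $ k)) = (1/2) *s (x + vcnj x)"
    "cvec (\<chi> k. Im (x $ k)) = (-\<i>/2) *s (x - vcnj x)"
    by (auto simp: vec_eq_iff cvec_def vcnj_def complex_eq_iff)
qed

lemma ccross_cvec [simp]: "cvec x \<otimes> cvec y = cvec (cross7 x y)"
proof -
  have *: "cvec (sum_list xs) = sum_list (map cvec xs)" for xs :: "(real^7) list"
    by (induction xs) auto
  have "cvec (axis i 1) = axis i 1" for i :: 7
    by (simp add: cvec_def axis_def vec_eq_iff)
  then have "cvec (cross7 x y) = cvec x \<otimes> cvec y"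
    by (simp add: cross7_def ccross_def cross7_triples_def) (simp add: cvec_def)
  then show ?thesis ..
qed

lemma ccross_simps [simp]:
  "(u + v) \<otimes> w = u \<otimes> w + v \<otimes> w" "w \<otimes> (u + v) = w \<otimes> u + w \<otimes> v"
  "(u - v) \<otimes> w = u \<otimes> w - v \<otimes> w" "w \<otimes> (u - v) = w \<otimes> u - w \<otimes> v"
  "(- u) \<otimes> w = - (u \<otimes> w)" "w \<otimes> (- u) = - (w \<otimes> u)"
  "(c *s u) \<otimes> w = c *s (u \<otimes> w)" "w \<otimes> (c *s u) = c *s (w \<otimes> u)"
  "0 \<otimes> w = 0" "w \<otimes> 0 = 0" "u \<otimes> u = 0"
  by (simp_all add: vec_eq_iff forall_7 ccross_nth algebra_simps)

lemma ccross_antisym: "u \<otimes> v = - (v \<otimes> u)"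
  by (simp add: vec_eq_iff forall_7 ccross_nth algebra_simps)

lemma vcnj_ccross [simp]: "vcnj (u \<otimes> v) = vcnj u \<otimes> vcnj v"
  by (simp add: vec_eq_iff forall_7 ccross_nth vcnj_def)

lemma triple_cyclic: "(u \<otimes> v) \<odot> w = (v \<otimes> w) \<odot> u"
  by (simp add: bdot_def sum_7 ccross_nth algebra_simps)

text \<open>Polarization in \<open>u\<close> and \<open>v\<close> of the double product rule
  \<open>ccross_same\<close>. Together with \<open>triple_cyclic\<close> it carries all later
  information about the multiplication table, beyond bilinearity, skew-symmetry and reality.\<close>

lemma ccross_ccross:
  "u \<otimes> (v \<otimes> w) + v \<otimes> (u \<otimes> w) = (u \<odot> w) *s v + (v \<odot> w) *s u - (2 * (u \<odot> v)) *s w"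
  by (simp add: vec_eq_iff forall_7 bdot_def sum_7 ccross_nth) (simp add: algebra_simps power2_eq_square)

section \<open>Wirtinger calculus\<close>

lemma pd_eq: "(f has_derivative f') (at w) \<Longrightarrow> pd a f w = f' a"
  unfolding pd_def by (metis frechet_derivative_at)

lemma pd_has_derivative: "f differentiable (at w) \<Longrightarrow> (f has_derivative (\<lambda>a. pd a f w)) (at w)"
  unfolding pd_def by (simp flip: frechet_derivative_works)

lemma pd_transform:
  assumes "open D" "w \<in> D" "\<And>v. v \<in> D \<Longrightarrow> f v = g v" "f differentiable (at w)"
  shows "g differentiable (at w)" "pd a g w = pd a f w"
proof -
  have "(g has_derivative (\<lambda>a. pd a f w)) (at w)"
    using has_derivative_transform_within_open[OF pd_has_derivative[OF assms(4)] assms(1,2)] assms(3)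
    by blast
  then show "g differentiable (at w)" "pd a g w = pd a f w"
    by (auto simp: pd_eq differentiable_def)
qed

section \<open>Closure properties of differentiable and smooth maps\<close>

lemma Ck_on_cong:
  assumes "open D" "\<And>v. v \<in> D \<Longrightarrow> f v = g v" "Ck_on k D f"
  shows "Ck_on k D g"
  using assms(2,3)
proof (induction k arbitrary: f g)
  case 0
  then show ?case by (auto cong: continuous_on_cong)
next
  case (Suc k)
  have d: "f differentiable (at w)" if "w \<in> D" for w
    using Suc.prems that by auto
  have "Ck_on k D (pd a g)" if "Ck_on k D (pd a f)" for a
    by (rule Suc.IH[OF _ that]) (use pd_transform(2)[OF assms(1) _ Suc.prems(1) d] in simp)
  then show ?case
    using Suc.prems pd_transform(1)[OF assms(1) _ Suc.prems(1) d] by simp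
qed

lemma Ck_on_Suc_imp: "Ck_on (Suc k) D f \<Longrightarrow> Ck_on k D f"
proof (induction k arbitrary: f)
  case 0
  then show ?case
    by (simp add: continuous_at_imp_continuous_on differentiable_imp_continuous_within)
next
  case (Suc k)
  then show ?case by (meson Ck_on.simps(2))
qed

lemma Ck_on_subset: "Ck_on k D f \<Longrightarrow> D' \<subseteq> D \<Longrightarrow> Ck_on k D' f"
  by (induction k arbitrary: f) (auto intro: continuous_on_subset)

lemma Ck_on_bounded_linear:
  assumes "open D" "bounded_linear L" "Ck_on k D f"
  shows "Ck_on k D (\<lambda>w. L (f w))"
  using assms(3)
proof (induction k arbitrary: f)
  case 0
  then show ?case by (simp add: bounded_linear.continuous_on[OF assms(2)])
next
  case (Suc k)
  have D: "((\<lambda>w. L (f w)) has_derivative (\<lambda>a. L (pd a f w))) (at w)" if "w \<in> D" for w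
    using Suc.prems that by (auto intro!: bounded_linear.has_derivative[OF assms(2)] pd_has_derivative)
  have "Ck_on k D (pd a (\<lambda>w. L (f w)))" if "Ck_on k D (pd a f)" for a
    by (rule Ck_on_cong[OF assms(1) _ Suc.IH[OF that]]) (use pd_eq[OF D] in simp)
  then show ?case
    using Suc.prems D by (auto simp: differentiable_def)
qed

lemma Ck_on_add:
  assumes "open D" "Ck_on k D f" "Ck_on k D g"
  shows "Ck_on k D (\<lambda>w. f w + g w)"
  using assms(2,3)
proof (induction k arbitrary: f g)
  case 0
  then show ?case by (simp add: continuous_on_add)
next
  case (Suc k)
  have D: "((\<lambda>w. f w + g w) has_derivative (\<lambda>a. pd a f w + pd a g w)) (at w)" if "w \<in> D" for w
    using Suc.prems that by (auto intro!: has_derivative_add pd_has_derivative)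
  have "Ck_on k D (pd a (\<lambda>w. f w + g w))" if "Ck_on k D (pd a f)" "Ck_on k D (pd a g)" for a
    by (rule Ck_on_cong[OF assms(1) _ Suc.IH[OF that]]) (use pd_eq[OF D] in simp)
  then show ?case
    using Suc.prems D by (auto simp: differentiable_def)
qed

lemma Ck_on_bilinear:
  assumes "open D" "bounded_bilinear B" "Ck_on k D f" "Ck_on k D g"
  shows "Ck_on k D (\<lambda>w. B (f w) (g w))"
  using assms(3,4)
proof (induction k arbitrary: f g)
  case 0
  then show ?case by (simp add: bounded_bilinear.continuous_on[OF assms(2)])
next
  case (Suc k)
  have D: "((\<lambda>w. B (f w) (g w)) has_derivative (\<lambda>a. B (f w) (pd a g w) + B (pd a f w) (g w))) (at w)"
    if "w \<in> D" for w
    using Suc.prems that by (auto intro!: bounded_bilinear.FDERIV[OF assms(2)] pd_has_derivative)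
  have "Ck_on k D (pd a (\<lambda>w. B (f w) (g w)))" if "Ck_on k D (pd a f)" "Ck_on k D (pd a g)" for a
    by (rule Ck_on_cong[OF assms(1) _ Ck_on_add[OF assms(1) Suc.IH[OF _ that(2)] Suc.IH[OF that(1)]]])
      (use pd_eq[OF D] Ck_on_Suc_imp Suc.prems in simp_all)
  then show ?case
    using Suc.prems D by (auto simp: differentiable_def)
qed

lemma Ck_on_inverse:
  fixes f :: "complex \<Rightarrow> 'b::real_normed_field"
  assumes "open D" "Ck_on k D f" "\<And>w. w \<in> D \<Longrightarrow> f w \<noteq> 0"
  shows "Ck_on k D (\<lambda>w. inverse (f w))"
  using assms(2)
proof (induction k)
  case 0
  then show ?case using assms(3) by (simp add: continuous_on_inverse)
next
  case (Suc k)
  have D: "((\<lambda>w. inverse (f w)) has_derivative (\<lambda>a. - (inverse (f w) * pd a f w * inverse (f w)))) (at w)"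
    if "w \<in> D" for w
    using Suc.prems that assms(3) by (auto intro!: Deriv.has_derivative_inverse pd_has_derivative)
  have i: "Ck_on k D (\<lambda>w. inverse (f w))"
    using Suc Ck_on_Suc_imp by blast
  have "Ck_on k D (pd a (\<lambda>w. inverse (f w)))" if "Ck_on k D (pd a f)" for a
    by (rule Ck_on_cong[OF assms(1) _ Ck_on_bounded_linear[OF assms(1) bounded_linear_minus[OF bounded_linear_ident]
        Ck_on_bilinear[OF assms(1) bounded_bilinear_mult
          Ck_on_bilinear[OF assms(1) bounded_bilinear_mult i that] i]]])
      (use pd_eq[OF D] in simp)
  then show ?case
    using Suc.prems D by (auto simp: differentiable_def)
qed

lemma Ck_on_const: "Ck_on k D (\<lambda>_. c)"
proof (induction k arbitrary: c)
  case (Suc k)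
  have "pd a (\<lambda>_. c) = (\<lambda>_. 0)" for a
    by (simp add: pd_def fun_eq_iff)
  with Suc show ?case by simp
qed simp

lemma smooth_on_subset: "smooth_on D f \<Longrightarrow> D' \<subseteq> D \<Longrightarrow> smooth_on D' f"
  unfolding smooth_on_def using Ck_on_subset by blast

lemma smooth_on_const: "smooth_on D (\<lambda>_. c)"
  by (simp add: smooth_on_def Ck_on_const)

lemma smooth_on_bounded_linear: "open D \<Longrightarrow> bounded_linear L \<Longrightarrow> smooth_on D f \<Longrightarrow> smooth_on D (\<lambda>w. L (f w))"
  unfolding smooth_on_def using Ck_on_bounded_linear by blast

lemma smooth_on_add: "open D \<Longrightarrow> smooth_on D f \<Longrightarrow> smooth_on D g \<Longrightarrow> smooth_on D (\<lambda>w. f w + g w)"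
  unfolding smooth_on_def using Ck_on_add by blast

lemma smooth_on_bilinear:
  "open D \<Longrightarrow> bounded_bilinear B \<Longrightarrow> smooth_on D f \<Longrightarrow> smooth_on D g \<Longrightarrow> smooth_on D (\<lambda>w. B (f w) (g w))"
  unfolding smooth_on_def using Ck_on_bilinear by blast

lemma smooth_on_inverse:
  fixes f :: "complex \<Rightarrow> 'b::real_normed_field"
  shows "open D \<Longrightarrow> smooth_on D f \<Longrightarrow> (\<And>w. w \<in> D \<Longrightarrow> f w \<noteq> 0) \<Longrightarrow> smooth_on D (\<lambda>w. inverse (f w))"
  unfolding smooth_on_def using Ck_on_inverse by blast

lemma smooth_on_pd: "smooth_on D f \<Longrightarrow> smooth_on D (pd 1 f)" "smooth_on D f \<Longrightarrow> smooth_on D (pd \<i> f)"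
  unfolding smooth_on_def by (metis Ck_on.simps(2))+

lemma smooth_on_differentiable: "smooth_on D f \<Longrightarrow> w \<in> D \<Longrightarrow> f differentiable (at w)"
  unfolding smooth_on_def by (metis Ck_on.simps(2))

lemma smooth_on_continuous: "smooth_on D f \<Longrightarrow> continuous_on D f"
  unfolding smooth_on_def by (metis Ck_on.simps(1))

lemma pd_pd_commute_real:
  fixes f :: "complex \<Rightarrow> real"
  assumes D: "open D" "w \<in> D" and f: "Ck_on 2 D f"
  shows "pd \<i> (pd 1 f) w = pd 1 (pd \<i> f) w"
proof (rule ccontr)
  define p where "p = pd \<i> (pd 1 f)"
  define q where "q = pd 1 (pd \<i> f)"
  assume "\<not> ?thesis"
  then have "0 < \<bar>p w - q w\<bar> / 2" (is "0 < ?e") by (simp add: p_def q_def)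
  have f': "\<And>v. v \<in> D \<Longrightarrow> f differentiable (at v)" "\<And>v. v \<in> D \<Longrightarrow> pd 1 f differentiable (at v)"
    "\<And>v. v \<in> D \<Longrightarrow> pd \<i> f differentiable (at v)" "continuous_on D p" "continuous_on D q"
    using f by (auto simp: numeral_2_eq_2 p_def q_def)
  have "continuous (at w) p" "continuous (at w) q"
    using f'(4,5) D by (auto simp: continuous_on_eq_continuous_at)
  then obtain d1 d2 where d: "d1 > 0" "\<And>v. dist v w < d1 \<Longrightarrow> dist (p v) (p w) < ?e"
     "d2 > 0" "\<And>v. dist v w < d2 \<Longrightarrow> dist (q v) (q w) < ?e"
    using \<open>0 < ?e\<close> unfolding continuous_at_eps_delta by metis
  obtain d3 where d3: "d3 > 0" "ball w d3 \<subseteq> D" using D open_contains_ball by blast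
  \<comment> \<open>Points of the square of side \<open>t\<close> are at distance at most
    \<open>2 * t\<close> from \<open>w\<close>, hence strictly less than \<open>3 * t\<close>, which
    stays below all three radii.\<close>
  define t where "t = min d1 (min d2 d3) / 3"
  have t: "t > 0" "3 * t \<le> d1" "3 * t \<le> d2" "3 * t \<le> d3" using d d3 by (auto simp: t_def)
  have near: "dist (w + (of_real x + \<i> * of_real y)) w < 3 * t" if "0 \<le> x" "x \<le> t" "0 \<le> y" "y \<le> t" for x y
  proof -
    have "dist (w + (of_real x + \<i> * of_real y)) w \<le> cmod (of_real x) + cmod (\<i> * of_real y)"
      using norm_triangle_ineq[of "of_real x" "\<i> * of_real y"] by (simp add: dist_norm)
    also have "\<dots> < 3 * t" using that t(1) by (simp add: norm_mult)
    finally show ?thesis .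
  qed
  have inD: "w + (of_real x + \<i> * of_real y) \<in> D" if "0 \<le> x" "x \<le> t" "0 \<le> y" "y \<le> t" for x y
    using near[OF that] t(4) d3(2) by (auto simp: dist_commute)
  have dx: "((\<lambda>x. h (w + (of_real x + \<i> * of_real y))) has_real_derivative pd 1 h (w + (of_real x + \<i> * of_real y))) (at x)"
    if "h differentiable (at (w + (of_real x + \<i> * of_real y)))" for h :: "complex \<Rightarrow> real" and x y
  proof -
    have "((\<lambda>x. h (w + (of_real x + \<i> * of_real y))) has_derivative
        (\<lambda>s. pd (of_real s) h (w + (of_real x + \<i> * of_real y)))) (at x)"
      by (rule has_derivative_compose[where g = h and f = "\<lambda>x. w + (of_real x + \<i> * of_real y)",
            OF _ pd_has_derivative[OF that]]) (auto intro!: derivative_eq_intros)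
    moreover have "pd (of_real s) h v = pd 1 h v * s" if "h differentiable (at v)" for s v
      using linear_frechet_derivative[OF that] linear_scale[of "frechet_derivative h (at v)" s 1]
      by (simp add: pd_def scaleR_conv_of_real)
    ultimately show ?thesis
      unfolding has_field_derivative_def using that by simp
  qed
  have dy: "((\<lambda>y. h (w + (of_real x + \<i> * of_real y))) has_real_derivative pd \<i> h (w + (of_real x + \<i> * of_real y))) (at y)"
    if "h differentiable (at (w + (of_real x + \<i> * of_real y)))" for h :: "complex \<Rightarrow> real" and x y
  proof -
    have "((\<lambda>y. h (w + (of_real x + \<i> * of_real y))) has_derivative
        (\<lambda>s. pd (\<i> * of_real s) h (w + (of_real x + \<i> * of_real y)))) (at y)"
      by (rule has_derivative_compose[where g = h and f = "\<lambda>y. w + (of_real x + \<i> * of_real y)",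
            OF _ pd_has_derivative[OF that]]) (auto intro!: derivative_eq_intros)
    moreover have "pd (\<i> * of_real s) h v = pd \<i> h v * s" if "h differentiable (at v)" for s v
      using linear_frechet_derivative[OF that] linear_scale[of "frechet_derivative h (at v)" s \<i>]
      by (simp add: pd_def scaleR_conv_of_real mult.commute)
    ultimately show ?thesis
      unfolding has_field_derivative_def using that by simp
  qed
  let ?P = "\<lambda>x y. w + (of_real x + \<i> * of_real y)"
  \<comment> \<open>Grouping the four terms by columns or by rows gives the two orders of
    differentiation.\<close>
  define \<Delta> where "\<Delta> = f (?P t t) - f (?P t 0) - f (?P 0 t) + f (?P 0 0)"
  obtain x where x: "0 < x" "x < t" "\<Delta> = t * (pd 1 f (?P x t) - pd 1 f (?P x 0))"
  proof -
    have "\<exists>z>0. z < t \<and> (f (?P t t) - f (?P t 0)) - (f (?P 0 t) - f (?P 0 0))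
        = (t - 0) * (pd 1 f (?P z t) - pd 1 f (?P z 0))"
      using t(1) by (intro MVT2) (auto intro!: DERIV_diff dx dx[where y = 0, simplified] f' inD inD[where y = 0, simplified])
    then show ?thesis using that by (auto simp: \<Delta>_def algebra_simps)
  qed
  obtain y where y: "0 < y" "y < t" "\<Delta> = t * (t * p (?P x y))"
  proof -
    have "\<exists>z>0. z < t \<and> pd 1 f (?P x t) - pd 1 f (?P x 0) = (t - 0) * p (?P x z)"
      unfolding p_def using t(1) x by (intro MVT2) (auto intro!: dy f' inD inD[where x = 0, simplified])
    then show ?thesis using that x by auto
  qed
  obtain y' where y': "0 < y'" "y' < t" "\<Delta> = t * (pd \<i> f (?P t y') - pd \<i> f (?P 0 y'))"
  proof -
    have "\<exists>z>0. z < t \<and> (f (?P t t) - f (?P 0 t)) - (f (?P t 0) - f (?P 0 0))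
        = (t - 0) * (pd \<i> f (?P t z) - pd \<i> f (?P 0 z))"
      using t(1) by (intro MVT2) (auto intro!: DERIV_diff dy dy[where x = 0, simplified] f' inD inD[where x = 0, simplified])
    then show ?thesis using that by (auto simp: \<Delta>_def algebra_simps)
  qed
  obtain x' where x': "0 < x'" "x' < t" "\<Delta> = t * (t * q (?P x' y'))"
  proof -
    have "\<exists>z>0. z < t \<and> pd \<i> f (?P t y') - pd \<i> f (?P 0 y') = (t - 0) * q (?P z y')"
      unfolding q_def using t(1) y' by (intro MVT2) (auto intro!: dx f' inD inD[where y = 0, simplified])
    then show ?thesis using that y' by auto
  qed
  have "p (?P x y) = q (?P x' y')" using y(3) x'(3) t(1) by simp
  moreover have "dist (p (?P x y)) (p w) < ?e" "dist (q (?P x' y')) (q w) < ?e"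
    using d(2,4) near[of x y] near[of x' y'] t x y x' y' by (smt (verit))+
  ultimately show False by (simp add: dist_real_def abs_if split: if_splits)
qed

lemma scaleR_complex_vec: "r *\<^sub>R (v :: complex^'n) = of_real r *s v"
  by (simp add: vec_eq_iff) (simp add: scaleR_conv_of_real)

lemma bounded_linear_vcnj: "bounded_linear (vcnj :: complex^'n \<Rightarrow> _)"
  by (intro linear_conv_bounded_linear[THEN iffD1] linearI) (simp_all add: scaleR_complex_vec)

lemma bounded_linear_cvec: "bounded_linear (cvec :: real^'n \<Rightarrow> _)"
  by (intro linear_conv_bounded_linear[THEN iffD1] linearI) (simp_all add: scaleR_complex_vec)

lemma bounded_linear_cscale: "bounded_linear (\<lambda>v :: complex^'n. c *s v)"
  by (intro linear_conv_bounded_linear[THEN iffD1] linearI)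
    (simp_all add: scaleR_complex_vec vector_add_ldistrib vector_smult_assoc mult.commute)

lemma bounded_bilinear_cscale: "bounded_bilinear ((*s) :: complex \<Rightarrow> complex^'n \<Rightarrow> _)"
  by (intro bilinear_conv_bounded_bilinear[THEN iffD1])
    (auto simp: bilinear_def scaleR_complex_vec vector_add_ldistrib vector_sadd_rdistrib
      vector_smult_assoc mult.commute scaleR_conv_of_real intro!: linearI)

lemma bounded_bilinear_bdot: "bounded_bilinear ((\<odot>) :: complex^'n \<Rightarrow> _)"
  by (intro bilinear_conv_bounded_bilinear[THEN iffD1])
    (auto simp: bilinear_def scaleR_complex_vec scaleR_conv_of_real intro!: linearI)

lemma bounded_bilinear_ccross: "bounded_bilinear ((\<otimes>))"
  by (intro bilinear_conv_bounded_bilinear[THEN iffD1])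
    (auto simp: bilinear_def scaleR_complex_vec intro!: linearI)

text \<open>Both Wirtinger derivatives at once: \<open>p\<close> is the derivative in z and
  \<open>q\<close> the one in the conjugate of z. Carrying the pair makes conjugation a swap and
  makes holomorphy the condition \<open>q = 0\<close>; \<open>sder\<close> is the scalar
  version.\<close>

definition wder :: "(complex \<Rightarrow> complex^'n) \<Rightarrow> complex \<Rightarrow> complex^'n \<Rightarrow> complex^'n \<Rightarrow> bool" where
  "wder f w p q \<longleftrightarrow> (f has_derivative (\<lambda>h. h *s p + cnj h *s q)) (at w)"

definition sder :: "(complex \<Rightarrow> complex) \<Rightarrow> complex \<Rightarrow> complex \<Rightarrow> complex \<Rightarrow> bool" where
  "sder f w p q \<longleftrightarrow> (f has_derivative (\<lambda>h. h * p + cnj h * q)) (at w)"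

definition dzb :: "(complex \<Rightarrow> complex^'n) \<Rightarrow> complex \<Rightarrow> complex^'n" where
  "dzb v w = (1/2) *s (pd 1 v w + \<i> *s pd \<i> v w)"

definition sdz :: "(complex \<Rightarrow> complex) \<Rightarrow> complex \<Rightarrow> complex" where
  "sdz f w = (1/2) * (pd 1 f w - \<i> * pd \<i> f w)"

definition sdzb :: "(complex \<Rightarrow> complex) \<Rightarrow> complex \<Rightarrow> complex" where
  "sdzb f w = (1/2) * (pd 1 f w + \<i> * pd \<i> f w)"

lemma pd_Re_Im:
  assumes "f differentiable (at w)"
  shows "pd a f w = Re a *\<^sub>R pd 1 f w + Im a *\<^sub>R pd \<i> f w"
proof -
  interpret linear "frechet_derivative f (at w)"
    by (rule linear_frechet_derivative[OF assms])
  have "frechet_derivative f (at w) (Re a *\<^sub>R 1 + Im a *\<^sub>R \<i>)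
      = Re a *\<^sub>R frechet_derivative f (at w) 1 + Im a *\<^sub>R frechet_derivative f (at w) \<i>"
    by (simp only: add scale)
  moreover have "Re a *\<^sub>R 1 + Im a *\<^sub>R \<i> = a"
    by (simp add: complex_eq_iff)
  ultimately show ?thesis
    by (simp add: pd_def)
qed

lemma of_real_Re_Im: "complex_of_real (Re a) = (a + cnj a) / 2" "complex_of_real (Im a) = - \<i> * (a - cnj a) / 2"
  by (simp_all add: complex_eq_iff)

lemma wder_dz: "f differentiable (at w) \<Longrightarrow> wder f w (dz f w) (dzb f w)"
proof -
  assume f: "f differentiable (at w)"
  have "pd a f w = a *s dz f w + cnj a *s dzb f w" for a
    unfolding pd_Re_Im[OF f, of a] dz_def dzb_def scaleR_complex_vec of_real_Re_Im
    by (simp add: vec_eq_iff algebra_simps add_divide_distrib diff_divide_distrib)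
  then show ?thesis
    using pd_has_derivative[OF f] by (simp add: wder_def)
qed

lemma sder_sdz: "f differentiable (at w) \<Longrightarrow> sder f w (sdz f w) (sdzb f w)"
proof -
  assume f: "f differentiable (at w)"
  have "pd a f w = a * sdz f w + cnj a * sdzb f w" for a
    unfolding pd_Re_Im[OF f, of a] sdz_def sdzb_def scaleR_conv_of_real of_real_Re_Im
    by (simp add: algebra_simps add_divide_distrib diff_divide_distrib)
  then show ?thesis
    using pd_has_derivative[OF f] by (simp add: sder_def)
qed

lemma wder_imp_dz:
  assumes "wder f w p q"
  shows "dz f w = p" "dzb f w = q" "f differentiable (at w)"
proof -
  have *: "pd 1 f w = p + q" "pd \<i> f w = \<i> *s p + (- \<i>) *s q"
    using assms unfolding wder_def by (simp_all add: pd_eq)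
  show "dz f w = p" "dzb f w = q"
    unfolding dz_def dzb_def * by (simp_all add: vec_eq_iff algebra_simps add_divide_distrib)
  show "f differentiable (at w)"
    using assms by (auto simp: wder_def differentiable_def)
qed

lemma sder_imp_sdz:
  assumes "sder f w p q"
  shows "sdz f w = p" "sdzb f w = q" "f differentiable (at w)"
proof -
  have *: "pd 1 f w = p + q" "pd \<i> f w = \<i> * p + (- \<i>) * q"
    using assms unfolding sder_def by (simp_all add: pd_eq)
  show "sdz f w = p" "sdzb f w = q"
    unfolding sdz_def sdzb_def * by (simp_all add: algebra_simps add_divide_distrib)
  show "f differentiable (at w)"
    using assms by (auto simp: sder_def differentiable_def)
qed

lemma wder_add: "wder f w p q \<Longrightarrow> wder g w p' q' \<Longrightarrow> wder (\<lambda>w. f w + g w) w (p + p') (q + q')"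
  unfolding wder_def by (rule has_derivative_eq_rhs, rule has_derivative_add, assumption+)
    (simp add: vec_eq_iff fun_eq_iff algebra_simps)

lemma wder_diff: "wder f w p q \<Longrightarrow> wder g w p' q' \<Longrightarrow> wder (\<lambda>w. f w - g w) w (p - p') (q - q')"
  unfolding wder_def by (rule has_derivative_eq_rhs, rule has_derivative_diff, assumption+)
    (simp add: vec_eq_iff fun_eq_iff algebra_simps)

lemma wder_vcnj: "wder f w p q \<Longrightarrow> wder (\<lambda>w. vcnj (f w)) w (vcnj q) (vcnj p)"
  unfolding wder_def
  by (rule has_derivative_eq_rhs, rule bounded_linear.has_derivative[OF bounded_linear_vcnj], assumption)
    (simp add: fun_eq_iff)

lemma wder_cscale: "sder f w p q \<Longrightarrow> wder g w p' q' \<Longrightarrow>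
    wder (\<lambda>w. f w *s g w) w (p *s g w + f w *s p') (q *s g w + f w *s q')"
  unfolding wder_def sder_def
  by (rule has_derivative_eq_rhs, rule bounded_bilinear.FDERIV[OF bounded_bilinear_cscale], assumption+)
    (simp add: vec_eq_iff fun_eq_iff algebra_simps)

lemma wder_ccross: "wder f w p q \<Longrightarrow> wder g w p' q' \<Longrightarrow>
    wder (\<lambda>w. f w \<otimes> g w) w (p \<otimes> g w + f w \<otimes> p') (q \<otimes> g w + f w \<otimes> q')"
  unfolding wder_def sder_def
  by (rule has_derivative_eq_rhs, rule bounded_bilinear.FDERIV[OF bounded_bilinear_ccross], assumption+)
    (simp add: fun_eq_iff vector_add_ldistrib)

lemma sder_bdot: "wder f w p q \<Longrightarrow> wder g w p' q' \<Longrightarrow>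
    sder (\<lambda>w. f w \<odot> g w) w (p \<odot> g w + f w \<odot> p') (q \<odot> g w + f w \<odot> q')"
  unfolding wder_def sder_def
  by (rule has_derivative_eq_rhs, rule bounded_bilinear.FDERIV[OF bounded_bilinear_bdot], assumption+)
    (simp add: fun_eq_iff algebra_simps)

lemma sder_mult: "sder f w p q \<Longrightarrow> sder g w p' q' \<Longrightarrow>
    sder (\<lambda>w. f w * g w) w (p * g w + f w * p') (q * g w + f w * q')"
  unfolding sder_def
  by (rule has_derivative_eq_rhs, rule has_derivative_mult, assumption+)
    (simp add: fun_eq_iff algebra_simps)

lemma sder_inverse: "sder f w p q \<Longrightarrow> f w \<noteq> 0 \<Longrightarrow>
    sder (\<lambda>w. inverse (f w)) w (- p / (f w)\<^sup>2) (- q / (f w)\<^sup>2)"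
  unfolding sder_def
  by (rule has_derivative_eq_rhs, rule Deriv.has_derivative_inverse, assumption+)
    (simp add: fun_eq_iff field_simps power2_eq_square)

lemma wder_const: "wder (\<lambda>_. c) w 0 0"
  by (simp add: wder_def)

lemma sder_const: "sder (\<lambda>_. c) w 0 0"
  by (simp add: sder_def)

lemma wder_unique: "wder f w p q \<Longrightarrow> wder f w p' q' \<Longrightarrow> p = p' \<and> q = q'"
  using wder_imp_dz by metis

lemma sder_unique: "sder f w p q \<Longrightarrow> sder f w p' q' \<Longrightarrow> p = p' \<and> q = q'"
  using sder_imp_sdz by metis

lemma wder_eqI: "wder f w p q \<Longrightarrow> p = p' \<Longrightarrow> q = q' \<Longrightarrow> wder f w p' q'"
  by simp

lemma sder_eqI: "sder f w p q \<Longrightarrow> p = p' \<Longrightarrow> q = q' \<Longrightarrow> sder f w p' q'"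
  by simp

lemma wder_cong_open:
  assumes "open D" "w \<in> D" "\<And>v. v \<in> D \<Longrightarrow> f v = g v" "wder f w p q"
  shows "wder g w p q"
  using assms has_derivative_transform_within_open unfolding wder_def by blast

lemma sder_cong_open:
  assumes "open D" "w \<in> D" "\<And>v. v \<in> D \<Longrightarrow> f v = g v" "sder f w p q"
  shows "sder g w p q"
  using assms has_derivative_transform_within_open unfolding sder_def by blast

lemma sder_zero_on:
  assumes "open D" "w \<in> D" "\<And>v. v \<in> D \<Longrightarrow> f v = 0" "sder f w p q"
  shows "p = 0" "q = 0"
  using sder_unique[OF sder_cong_open[OF assms(1,2) _ assms(4)] sder_const[of 0]] assms(3) by simp_all

lemma wder_compose_holomorphic:
  assumes "wder f (\<tau> w) p q" "(\<tau> has_field_derivative c) (at w)"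
  shows "wder (\<lambda>w. f (\<tau> w)) w (c *s p) (cnj c *s q)"
proof -
  have "((\<lambda>w. f (\<tau> w)) has_derivative (\<lambda>h. (c * h) *s p + cnj (c * h) *s q)) (at w)"
    using assms unfolding wder_def has_field_derivative_def
    by (intro has_derivative_compose[where g = f and f = \<tau>]) auto
  then show ?thesis
    unfolding wder_def by (simp add: vector_smult_assoc mult.commute)
qed

lemma sder_holomorphic:
  assumes "(f has_field_derivative c) (at w)"
  shows "sder f w c 0"
  using assms by (simp add: sder_def has_field_derivative_def mult.commute[of _ c])

lemma sder_imp_field_derivative: "sder f w c 0 \<Longrightarrow> (f has_field_derivative c) (at w)"
  by (simp add: sder_def has_field_derivative_def mult.commute[of _ c])

lemma smooth_on_vcnj: "open D \<Longrightarrow> smooth_on D f \<Longrightarrow> smooth_on D (\<lambda>w. vcnj (f w))"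
  by (rule smooth_on_bounded_linear[OF _ bounded_linear_vcnj])

lemma smooth_on_cvec: "open D \<Longrightarrow> smooth_on D f \<Longrightarrow> smooth_on D (\<lambda>w. cvec (f w))"
  by (rule smooth_on_bounded_linear[OF _ bounded_linear_cvec])

lemma smooth_on_cscale: "open D \<Longrightarrow> smooth_on D f \<Longrightarrow> smooth_on D g \<Longrightarrow> smooth_on D (\<lambda>w. f w *s (g w :: complex^'n))"
  by (rule smooth_on_bilinear[OF _ bounded_bilinear_cscale])

lemma smooth_on_bdot: "open D \<Longrightarrow> smooth_on D f \<Longrightarrow> smooth_on D g \<Longrightarrow> smooth_on D (\<lambda>w. f w \<odot> g w)"
  by (rule smooth_on_bilinear[OF _ bounded_bilinear_bdot])

lemma smooth_on_mult:
  fixes f g :: "complex \<Rightarrow> 'b::real_normed_algebra"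
  shows "open D \<Longrightarrow> smooth_on D f \<Longrightarrow> smooth_on D g \<Longrightarrow> smooth_on D (\<lambda>w. f w * g w)"
  by (rule smooth_on_bilinear[OF _ bounded_bilinear_mult])

lemma smooth_on_minus: "open D \<Longrightarrow> smooth_on D f \<Longrightarrow> smooth_on D (\<lambda>w. - f w)"
  by (rule smooth_on_bounded_linear[OF _ bounded_linear_minus[OF bounded_linear_ident]])

lemma smooth_on_diff: "open D \<Longrightarrow> smooth_on D f \<Longrightarrow> smooth_on D g \<Longrightarrow> smooth_on D (\<lambda>w. f w - g w)"
  using smooth_on_add[OF _ _ smooth_on_minus, of D f g] by simp

lemma smooth_on_dz:
  assumes "open D" "smooth_on D f"
  shows "smooth_on D (dz f)" "smooth_on D (dzb f)"
proof -
  have "smooth_on D (\<lambda>w. (1/2) *s (pd 1 f w - \<i> *s pd \<i> f w))"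
       "smooth_on D (\<lambda>w. (1/2) *s (pd 1 f w + \<i> *s pd \<i> f w))"
    by (intro smooth_on_cscale smooth_on_const smooth_on_diff smooth_on_add smooth_on_pd assms)+
  then show "smooth_on D (dz f)" "smooth_on D (dzb f)"
    by (simp_all add: dz_def[abs_def] dzb_def[abs_def])
qed

lemma pd_bounded_linear:
  "bounded_linear L \<Longrightarrow> f differentiable (at w) \<Longrightarrow> pd a (\<lambda>w. L (f w)) w = L (pd a f w)"
  by (rule pd_eq) (rule bounded_linear.has_derivative, assumption, rule pd_has_derivative, assumption)

lemma pd_pd_commute:
  fixes f :: "complex \<Rightarrow> 'b::euclidean_space"
  assumes D: "open D" "w \<in> D" and f: "smooth_on D f"
  shows "pd \<i> (pd 1 f) w = pd 1 (pd \<i> f) w"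
proof (rule euclidean_eqI)
  fix b :: 'b assume "b \<in> Basis"
  let ?L = "\<lambda>x. x \<bullet> b"
  have L: "bounded_linear ?L" by (rule bounded_linear_inner_left)
  have *: "pd c (pd a (\<lambda>w. ?L (f w))) w = ?L (pd c (pd a f) w)" if "smooth_on D (pd a f)" for c a
  proof -
    have "pd c (pd a (\<lambda>w. ?L (f w))) w = pd c (\<lambda>w. ?L (pd a f w)) w"
      by (rule pd_transform(2)[OF D])
        (use smooth_on_differentiable[OF f] smooth_on_differentiable[OF smooth_on_bounded_linear[OF D(1) L that]] D
          pd_bounded_linear[OF L] in auto)
    also have "\<dots> = ?L (pd c (pd a f) w)"
      by (rule pd_bounded_linear[OF L smooth_on_differentiable[OF that D(2)]])
    finally show ?thesis .
  qed
  have "Ck_on 2 D (\<lambda>w. ?L (f w))"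
    using smooth_on_bounded_linear[OF D(1) L f] by (simp add: smooth_on_def)
  from pd_pd_commute_real[OF D this]
  show "?L (pd \<i> (pd 1 f) w) = ?L (pd 1 (pd \<i> f) w)"
    using * smooth_on_pd[OF f] by simp
qed

lemma pd_lincomb:
  fixes f g :: "complex \<Rightarrow> complex^'n"
  assumes "f differentiable (at w)" "g differentiable (at w)"
  shows "pd a (\<lambda>w. c *s (f w + d *s g w)) w = c *s (pd a f w + d *s pd a g w)"
  by (rule pd_eq, rule bounded_linear.has_derivative[OF bounded_linear_cscale], rule has_derivative_add,
      rule pd_has_derivative[OF assms(1)], rule bounded_linear.has_derivative[OF bounded_linear_cscale],
      rule pd_has_derivative[OF assms(2)])

lemma dz_dzb:
  assumes D: "open D" "w \<in> D" and f: "smooth_on D f"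
  shows "dz (dzb f) w = (1/4) *s (pd 1 (pd 1 f) w + pd \<i> (pd \<i> f) w)" "dzb (dz f) w = dz (dzb f) w"
    "dz (dz f) w = (1/4) *s (pd 1 (pd 1 f) w - pd \<i> (pd \<i> f) w - (2 * \<i>) *s pd \<i> (pd 1 f) w)"
proof -
  note d = smooth_on_differentiable[OF smooth_on_pd(1)[OF f] D(2)]
    smooth_on_differentiable[OF smooth_on_pd(2)[OF f] D(2)]
  have 1: "dzb f = (\<lambda>w. (1/2) *s (pd 1 f w + \<i> *s pd \<i> f w))"
    "dz f = (\<lambda>w. (1/2) *s (pd 1 f w + (- \<i>) *s pd \<i> f w))"
    by (simp_all add: fun_eq_iff dzb_def dz_def vec_eq_iff)
  note c = pd_pd_commute[OF D f]
  show "dz (dzb f) w = (1/4) *s (pd 1 (pd 1 f) w + pd \<i> (pd \<i> f) w)"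
    unfolding dz_def[of "dzb f"] unfolding 1 pd_lincomb[OF d] c by (simp add: vec_eq_iff algebra_simps)
  show "dzb (dz f) w = dz (dzb f) w"
    unfolding dz_def[of "dzb f"] dzb_def[of "dz f"] unfolding 1 pd_lincomb[OF d] c
    by (simp add: vec_eq_iff algebra_simps)
  show "dz (dz f) w = (1/4) *s (pd 1 (pd 1 f) w - pd \<i> (pd \<i> f) w - (2 * \<i>) *s pd \<i> (pd 1 f) w)"
    unfolding dz_def[of "dz f"] unfolding 1 pd_lincomb[OF d] c
    by (simp add: vec_eq_iff algebra_simps)
qed

section \<open>Linear algebra of the cross product\<close>

lemma triple_self [simp]: "(u \<otimes> v) \<odot> u = 0" "(u \<otimes> v) \<odot> v = 0" "u \<odot> (u \<otimes> v) = 0" "v \<odot> (u \<otimes> v) = 0"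
  using triple_cyclic[of u u v] triple_cyclic[of u v v] triple_cyclic[of v u v]
  by (simp_all add: bdot_commute[of _ "u \<otimes> v"])

lemma triple_skew: "u \<odot> (f \<otimes> v) = - ((f \<otimes> u) \<odot> v)"
  by (metis bdot_commute bdot_simps(5) ccross_antisym triple_cyclic)

lemma ccross_same: "u \<otimes> (u \<otimes> v) = (u \<odot> v) *s u - (u \<odot> u) *s v"
proof -
  have "2 * ((u \<otimes> (u \<otimes> v)) $ i) = 2 * (((u \<odot> v) *s u - (u \<odot> u) *s v) $ i)" for i
    using arg_cong[OF ccross_ccross[of u u v], of "\<lambda>x. x $ i"] by (simp add: algebra_simps)
  then show ?thesis
    unfolding vec_eq_iff by (metis mult_cancel_left zero_neq_numeral)
qed

lemma ccross_ccross_orth: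
  assumes "f \<odot> x = 0" "f \<odot> y = 0"
  shows "f \<otimes> (x \<otimes> y) = (x \<odot> y) *s f - x \<otimes> (f \<otimes> y)"
  using ccross_ccross[of f x y] assms by (simp add: algebra_simps)

lemma bdot_ccross_ccross_same: "(u \<otimes> v) \<odot> (w \<otimes> v) = (u \<odot> w) * (v \<odot> v) - (u \<odot> v) * (w \<odot> v)"
proof -
  have "(u \<otimes> v) \<odot> (w \<otimes> v) = - ((v \<otimes> u) \<odot> (w \<otimes> v))"
    by (subst ccross_antisym) simp
  also have "\<dots> = u \<odot> (v \<otimes> (w \<otimes> v))"
    by (simp add: triple_skew)
  also have "\<dots> = - (u \<odot> (v \<otimes> (v \<otimes> w)))"
    by (subst ccross_antisym[of w v]) simp
  finally show ?thesis
    by (simp add: ccross_same bdot_commute[of w v] mult.commute)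
qed

text \<open>Polarization of \<open>bdot_ccross_ccross_same\<close> in the shared factor. It is what
  makes the coassociative form alternating in its middle arguments, see
  \<open>psi_skew\<close>.\<close>

lemma bdot_ccross_ccross_swap:
  "(u \<otimes> v) \<odot> (w \<otimes> x) + (u \<otimes> x) \<odot> (w \<otimes> v)
    = 2 * (u \<odot> w) * (v \<odot> x) - (u \<odot> v) * (w \<odot> x) - (u \<odot> x) * (w \<odot> v)"
  using bdot_ccross_ccross_same[of u "v + x" w] bdot_ccross_ccross_same[of u v w]
    bdot_ccross_ccross_same[of u x w]
  by (simp add: algebra_simps bdot_commute[of x v])

lemma cross7_triple_skew: "u \<bullet> cross7 f v = - (cross7 f u \<bullet> v)"
  using triple_skew[of "cvec u" "cvec f" "cvec v"] by (simp flip: of_real_minus)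

lemma cross7_triple_self: "u \<bullet> cross7 u v = 0" "v \<bullet> cross7 u v = 0"
  using triple_self(3)[of "cvec u" "cvec v"] triple_self(4)[of "cvec v" "cvec u"] by auto

lemma cross7_same: "cross7 u (cross7 u v) = (u \<bullet> v) *\<^sub>R u - (u \<bullet> u) *\<^sub>R v"
proof -
  have "cvec (cross7 u (cross7 u v)) = cvec ((u \<bullet> v) *\<^sub>R u - (u \<bullet> u) *\<^sub>R v)"
    using ccross_same[of "cvec u" "cvec v"] by simp
  then show ?thesis by (simp only: cvec_simps(6))
qed

lemma cross7_orth:
  assumes "f \<bullet> x = 0" "f \<bullet> y = 0"
  shows "cross7 f (cross7 x y) = (x \<bullet> y) *\<^sub>R f - cross7 x (cross7 f y)"
proof -
  have "cvec (cross7 f (cross7 x y)) = cvec ((x \<bullet> y) *\<^sub>R f - cross7 x (cross7 f y))"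
    using ccross_ccross_orth[of "cvec f" "cvec x" "cvec y"] assms by simp
  then show ?thesis by (simp only: cvec_simps(6))
qed

lemma card_le_2_subset:
  assumes "finite B" "card B \<le> 2"
  shows "\<exists>p q. B \<subseteq> {p, q}"
proof -
  consider "card B = 0" | "card B = 1" | "card B = 2" using assms(2) by linarith
  then show ?thesis
    by cases (use assms(1) in \<open>auto simp: card_1_singleton_iff card_2_iff\<close>)
qed

lemma exists_orthogonal_to_5:
  fixes v1 v2 v3 v4 v5 :: "real^7"
  obtains x where "x \<noteq> 0" "x \<bullet> v1 = 0" "x \<bullet> v2 = 0" "x \<bullet> v3 = 0" "x \<bullet> v4 = 0" "x \<bullet> v5 = 0"
proof -
  have "dim {v1, v2, v3, v4, v5} \<le> card {v1, v2, v3, v4, v5}"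
    by (rule dim_le_card') simp
  also have "\<dots> \<le> 5"
    by (simp add: card_insert_if)
  finally have "dim {v1, v2, v3, v4, v5} < DIM(real^7)" by simp
  from orthogonal_to_subspace_exists[OF this] obtain x
    where "x \<noteq> 0" "\<And>y. y \<in> span {v1, v2, v3, v4, v5} \<Longrightarrow> orthogonal x y" by blast
  then show ?thesis
    using that[of x] span_base[of _ "{v1, v2, v3, v4, v5}"] by (auto simp: orthogonal_def)
qed

text \<open>If \<open>\<langle>\<phi> \<times> (x \<times> y), z\<rangle>\<close> vanishes on the orthogonal complement \<open>E\<close> of \<open>\<phi>\<close> and \<open>C\<close>, choose
  \<open>l\<close> in \<open>E\<close> with \<open>\<phi> \<times> l\<close> in \<open>E\<close> and then \<open>y\<close> in \<open>E\<close> orthogonal to both: the vectors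
  \<open>\<phi> \<times> (l \<times> y)\<close> and \<open>\<phi> \<times> ((\<phi> \<times> l) \<times> y)\<close> span \<open>C\<close> and are exchanged by \<open>\<phi> \<times> _\<close> up to sign.\<close>

lemma cross7_invariant_complement:
  fixes f :: "real^7"
  assumes f: "f \<bullet> f = 1" and C: "subspace C" "dim C \<le> 2" "\<And>c. c \<in> C \<Longrightarrow> f \<bullet> c = 0"
    and E: "E = {x. f \<bullet> x = 0 \<and> (\<forall>c\<in>C. c \<bullet> x = 0)}"
    and T: "\<And>x y z. x \<in> E \<Longrightarrow> y \<in> E \<Longrightarrow> z \<in> E \<Longrightarrow> cross7 f (cross7 x y) \<bullet> z = 0"
    and c: "c \<in> C"
  shows "cross7 f c \<in> C"
proof -
  obtain B where B: "B \<subseteq> C" "independent B" "C \<subseteq> span B" "card B = dim C"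
    using basis_exists by blast
  then obtain p q where pq: "B \<subseteq> {p, q}"
    using card_le_2_subset[of B] C(2) finiteI_independent by fastforce
  have E_I: "x \<in> E" if "f \<bullet> x = 0" "x \<bullet> p = 0" "x \<bullet> q = 0" for x
  proof -
    have "orthogonal x c" if "c \<in> C" for c
    proof (rule orthogonal_to_span)
      show "c \<in> span {p, q}" using that B(3) pq span_mono by blast
    qed (use \<open>x \<bullet> p = 0\<close> \<open>x \<bullet> q = 0\<close> in \<open>auto simp: orthogonal_def\<close>)
    then show ?thesis using that by (auto simp: E orthogonal_def inner_commute)
  qed
  have E_C: "x \<in> C" if "f \<bullet> x = 0" "\<And>z. z \<in> E \<Longrightarrow> x \<bullet> z = 0" for x
  proof -
    obtain u v where uv: "u \<in> span C" "\<And>w. w \<in> span C \<Longrightarrow> orthogonal v w" "x = u + v"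
      using orthogonal_subspace_decomp_exists by blast
    have u: "u \<in> C" using uv(1) C(1) span_eq_iff by blast
    have "v \<in> E"
      using uv C(3)[OF u] that(1) span_base[of _ C]
      by (auto simp: E orthogonal_def inner_commute inner_add_right)
    then have "x \<bullet> v = 0" "u \<bullet> v = 0" using that(2) uv by (auto simp: orthogonal_def inner_commute)
    then have "v = 0" by (simp add: uv(3) inner_add_left)
    then show ?thesis using u uv(3) by simp
  qed
  \<comment> \<open>Five linear conditions in dimension 7. The last two place
    \<open>cross7 f l\<close> in \<open>E\<close>, because \<open>cross7 f\<close> is skew.\<close>
  obtain l where l: "l \<noteq> 0" "l \<bullet> f = 0" "l \<bullet> p = 0" "l \<bullet> q = 0" "l \<bullet> cross7 f p = 0" "l \<bullet> cross7 f q = 0"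
    using exists_orthogonal_to_5 by metis
  define m where "m = cross7 f l"
  obtain y where y: "y \<noteq> 0" "y \<bullet> f = 0" "y \<bullet> p = 0" "y \<bullet> q = 0" "y \<bullet> l = 0" "y \<bullet> m = 0"
    using exists_orthogonal_to_5 by metis
  have fm: "f \<bullet> m = 0" by (simp add: m_def cross7_triple_self)
  have mpq: "m \<bullet> p = 0" "m \<bullet> q = 0"
    using l(5,6) by (simp_all add: m_def cross7_triple_skew)
  have EE: "l \<in> E" "y \<in> E" "m \<in> E"
    using E_I[of l] E_I[of y] E_I[of m] l(2,3,4) y(2,3,4) fm mpq by (simp_all add: inner_commute[of f])
  define R where "R = cross7 f (cross7 l y)"
  define R' where "R' = cross7 f (cross7 m y)"
  have RC: "R \<in> C" "R' \<in> C"
    unfolding R_def R'_def by (rule E_C, rule cross7_triple_self(1), rule T, rule EE, rule EE, assumption)+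
  have fly: "f \<bullet> cross7 l y = 0"
    using cross7_triple_skew[of f l y] cross7_antisym[of l f] y(6) by (simp add: m_def inner_commute)
  have fR: "cross7 f R = - cross7 l y"
    by (simp add: R_def cross7_same f fly)
  have "cross7 f (cross7 y l) = - cross7 y m"
    using cross7_orth[of f y l] l(2) y(2,5) by (simp add: m_def inner_commute)
  then have "cross7 m y = cross7 f (cross7 y l)"
    by (metis cross7_antisym)
  then have "R' = cross7 l y"
    using fly cross7_antisym[of y l] by (simp add: R'_def cross7_same f)
  with fR have fRR': "cross7 f R = - R'" "R' = - cross7 f R" by simp_all
  have fR': "cross7 f R' = R"
  proof -
    have "f \<bullet> R = 0" by (simp add: R_def cross7_triple_self)
    then have "cross7 f (cross7 f R) = - R" by (simp add: cross7_same f)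
    moreover have "cross7 f (- cross7 f R) = - cross7 f (cross7 f R)"
      by (rule bilinear_rneg[OF bilinear_cross7])
    ultimately show ?thesis unfolding fRR'(2) by (simp only: minus_minus)
  qed
  have RR': "R \<bullet> R' = 0" by (simp add: fRR'(2) cross7_triple_self)
  have "R' \<bullet> R' = (l \<bullet> l) * (y \<bullet> y)"
  proof -
    have "of_real (R' \<bullet> R') = complex_of_real ((l \<bullet> l) * (y \<bullet> y))"
      using bdot_ccross_ccross_same[of "cvec l" "cvec y" "cvec l"] y(5) \<open>R' = cross7 l y\<close>
      by (simp add: inner_commute)
    then show ?thesis using of_real_eq_iff by blast
  qed
  then have R'0: "R' \<noteq> 0" using l(1) y(1) by auto
  then have R0: "R \<noteq> 0" using fRR'(2) bilinear_rzero[OF bilinear_cross7, of f] by auto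
  have "independent {R, R'}"
    using R0 R'0 RR' by (intro pairwise_orthogonal_independent) (auto simp: pairwise_def orthogonal_def inner_commute)
  moreover have "R \<noteq> R'" using RR' R0 by auto
  ultimately have "C \<subseteq> span {R, R'}"
    using RC C(2) by (intro card_ge_dim_independent) auto
  with c have "c \<in> span {R, R'}" by blast
  then obtain \<alpha> where "c - \<alpha> *\<^sub>R R \<in> span {R'}" unfolding span_breakdown_eq by blast
  then obtain \<beta> where "c - \<alpha> *\<^sub>R R = \<beta> *\<^sub>R R'" unfolding span_singleton by blast
  then have c: "c = \<alpha> *\<^sub>R R + \<beta> *\<^sub>R R'" by (simp add: algebra_simps)
  have "cross7 f c = \<alpha> *\<^sub>R cross7 f R + \<beta> *\<^sub>R cross7 f R'"
    unfolding c by (simp add: bilinear_radd[OF bilinear_cross7] bilinear_rmul[OF bilinear_cross7])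
  also have "\<dots> = (- \<alpha>) *\<^sub>R R' + \<beta> *\<^sub>R R" by (simp add: fRR'(1) fR')
  also have "\<dots> \<in> C" by (intro subspace_add subspace_scale RC C(1))
  finally show ?thesis .
qed

text \<open>The pointwise data of a conformal harmonic immersion \<open>\<phi>\<close> into the 6-sphere: \<open>f\<close> is
  \<open>\<phi>\<close>, \<open>a\<close> is \<open>\<phi>\<^sub>z\<close>, and \<open>s\<close> is the normal component of \<open>\<phi>\<^sub>z\<^sub>z\<close>.\<close>

locale osculating_frame =
  fixes f a s :: "complex^7"
  assumes f_real: "vcnj f = f" and ff: "f \<odot> f = 1" and fa: "f \<odot> a = 0" and aa: "a \<odot> a = 0"
    and a_nz: "a \<odot> vcnj a \<noteq> 0" and fs: "f \<odot> s = 0" and as: "a \<odot> s = 0" and As: "vcnj a \<odot> s = 0"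
begin

abbreviation A where "A \<equiv> vcnj a"
abbreviation S where "S \<equiv> vcnj s"

lemma frame_simps:
  "f \<odot> f = 1" "f \<odot> a = 0" "a \<odot> f = 0" "f \<odot> A = 0" "A \<odot> f = 0" "a \<odot> a = 0" "A \<odot> A = 0"
  "A \<odot> a = a \<odot> A" "f \<odot> s = 0" "s \<odot> f = 0" "f \<odot> S = 0" "S \<odot> f = 0" "a \<odot> s = 0" "s \<odot> a = 0"
  "A \<odot> s = 0" "s \<odot> A = 0" "a \<odot> S = 0" "S \<odot> a = 0" "A \<odot> S = 0" "S \<odot> A = 0" "S \<odot> s = s \<odot> S"
proof -
  have c: "u \<odot> vcnj v = 0" "vcnj v \<odot> u = 0" if "vcnj u \<odot> v = 0" for u v :: "complex^7"
    using that bdot_vcnj_left[of u v] bdot_commute[of u "vcnj v"] by simp_all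
  show "f \<odot> A = 0" "A \<odot> f = 0" "f \<odot> S = 0" "S \<odot> f = 0" "A \<odot> A = 0" "A \<odot> S = 0" "S \<odot> A = 0"
    "a \<odot> S = 0" "S \<odot> a = 0"
    using c[of f a] c[of f s] c[of A a] c[of A s] c[of a s] f_real fa fs aa as As by simp_all
qed (use ff fa aa fs as As in \<open>simp_all add: bdot_commute[of a f] bdot_commute[of s f] bdot_commute[of s a]
      bdot_commute[of s A] bdot_commute[of S s] bdot_commute[of A a]\<close>)

text \<open>The complement of the osculating space. Since \<open>f\<close> is real and the other
  vectors come in conjugate pairs, bilinear orthogonality here agrees with Hermitian orthogonality,
  so the space is closed under conjugation and a vector of it that is bilinearly orthogonal to all
  of it vanishes.\<close>

definition nrm :: "complex^7 \<Rightarrow> bool" where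
  "nrm y \<longleftrightarrow> y \<odot> f = 0 \<and> y \<odot> a = 0 \<and> y \<odot> A = 0 \<and> y \<odot> s = 0 \<and> y \<odot> S = 0"

lemma nrm_vcnj: "nrm y \<Longrightarrow> nrm (vcnj y)"
  unfolding nrm_def by (simp add: bdot_vcnj_left f_real)

lemma nrm_lin: "nrm x \<Longrightarrow> nrm y \<Longrightarrow> nrm (x + y)" "nrm x \<Longrightarrow> nrm y \<Longrightarrow> nrm (x - y)" "nrm x \<Longrightarrow> nrm (c *s x)" "nrm 0"
  "nrm x \<Longrightarrow> nrm (- x)"
  by (simp_all add: nrm_def)

lemma nrm_orth_eq_0:
  assumes "nrm x" "\<And>y. nrm y \<Longrightarrow> x \<odot> y = 0"
  shows "x = 0"
  using assms(2)[OF nrm_vcnj[OF assms(1)]] by simp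

lemma nrm_orth_nrm_eq_0:
  assumes "x \<odot> f = 0" "x \<odot> a = 0" "x \<odot> A = 0" "x \<odot> s = 0" "x \<odot> S = 0" "\<And>y. nrm y \<Longrightarrow> x \<odot> y = 0"
  shows "x = 0"
  using assms nrm_orth_eq_0 by (simp add: nrm_def)

text \<open>Up to sign, the contraction of the coassociative 4-form with \<open>f\<close>. It is
  alternating only on the complement of \<open>f\<close>, which explains the orthogonality
  hypotheses of \<open>I_cyclic\<close> and its consequences.\<close>

definition I where "I x y z = (f \<otimes> (x \<otimes> y)) \<odot> z"

lemma I_lin [simp]:
  "I (x + x') y z = I x y z + I x' y z" "I x (y + y') z = I x y z + I x y' z"
  "I x y (z + z') = I x y z + I x y z'" "I (c *s x) y z = c * I x y z"
  "I x (c *s y) z = c * I x y z" "I x y (c *s z) = c * I x y z"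
  by (simp_all add: I_def)

lemma I_skew: "I y x z = - I x y z"
  unfolding I_def by (subst ccross_antisym) simp

lemma I_cyclic:
  assumes "f \<odot> x = 0" "f \<odot> y = 0" "f \<odot> z = 0"
  shows "I x y z = I y z x"
proof -
  have "I z x y = - ((z \<otimes> x) \<odot> (f \<otimes> y))" for x y z
    unfolding I_def using triple_skew[of "z \<otimes> x" f y] by simp
  moreover have "I x y z = - ((x \<otimes> (f \<otimes> y)) \<odot> z)" if "f \<odot> x = 0" "f \<odot> y = 0" "f \<odot> z = 0" for x y z
    unfolding I_def using that by (simp add: ccross_ccross_orth)
  moreover have "(x \<otimes> (f \<otimes> y)) \<odot> z = (z \<otimes> x) \<odot> (f \<otimes> y)" for x y z
    by (metis triple_cyclic)
  ultimately show ?thesis using assms by metis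
qed

lemma I_perms:
  assumes "f \<odot> x = 0" "f \<odot> y = 0" "f \<odot> z = 0" "I x y z = 0"
  shows "I x y z = 0" "I y z x = 0" "I z x y = 0" "I y x z = 0" "I z y x = 0" "I x z y = 0"
  using I_cyclic[of x y z] I_cyclic[of y z x] I_skew[of y x z] I_skew[of z y x] I_skew[of x z y] assms
  by simp_all

lemma I_same [simp]: "f \<odot> x = 0 \<Longrightarrow> f \<odot> y = 0 \<Longrightarrow> I x x y = 0" "f \<odot> x = 0 \<Longrightarrow> f \<odot> y = 0 \<Longrightarrow> I x y x = 0"
  "f \<odot> x = 0 \<Longrightarrow> f \<odot> y = 0 \<Longrightarrow> I y x x = 0"
  using I_perms[of x x y] by (simp_all add: I_def)

end

text \<open>\<open>nondeg\<close> is the nonvanishing of the Gram determinant of \<open>s\<close>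
  and its conjugate, that is, their linear independence. \<open>P1\<close> is pseudo-umbilicity and
  \<open>P2\<close> is what its derivative in the conjugate variable gives.\<close>

locale nondegenerate_frame = osculating_frame +
  assumes nondeg: "(s \<odot> vcnj s)\<^sup>2 \<noteq> (s \<odot> s) * (vcnj s \<odot> vcnj s)"
    and P1: "(f \<otimes> s) \<odot> (a \<otimes> vcnj a) = 0" and P2: "(f \<otimes> s) \<odot> (a \<otimes> vcnj s) = 0"
begin

text \<open>An alternating 3-form on four vectors is determined by the four triples that omit one of
  them. \<open>P1\<close> and \<open>P2\<close> settle two triples, conjugation the other two, and
  repeated arguments give zero.\<close>

lemma I_zero:
  assumes "x \<in> {a, A, s, S}" "y \<in> {a, A, s, S}" "z \<in> {a, A, s, S}"
  shows "I x y z = 0"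
proof -
  have *: "I x y z = - ((f \<otimes> z) \<odot> (x \<otimes> y))" for x y z
    unfolding I_def using triple_skew[of "x \<otimes> y" f z] by (simp add: bdot_commute)
  have c: "I (vcnj x) (vcnj y) (vcnj z) = cnj (I x y z)" for x y z
    unfolding I_def using f_real by (metis bdot_vcnj vcnj_ccross)
  have 1: "I a A s = 0" "I a S s = 0" using P1 P2 by (simp_all add: *)
  then have 2: "I A a S = 0" "I A s S = 0"
    using c[of a A s] c[of a S s] by simp_all
  note p = I_perms[OF _ _ _ 1(1)] I_perms[OF _ _ _ 1(2)] I_perms[OF _ _ _ 2(1)] I_perms[OF _ _ _ 2(2)]
  have "\<forall>x\<in>{a, A, s, S}. \<forall>y\<in>{a, A, s, S}. \<forall>z\<in>{a, A, s, S}. I x y z = 0"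
    by (simp add: frame_simps p)
  then show ?thesis using assms by blast
qed

lemma ortho_span:
  assumes "f \<odot> x = 0" "\<And>y. nrm y \<Longrightarrow> x \<odot> y = 0"
  shows "\<exists>c1 c2 c3 c4. x = c1 *s a + c2 *s A + c3 *s s + c4 *s S"
proof -
  let ?n = "s \<odot> S" and ?q = "s \<odot> s" and ?r = "S \<odot> S"
  define d where "d = ?n\<^sup>2 - ?q * ?r"
  have d: "d \<noteq> 0" using nondeg by (simp add: d_def)
  \<comment> \<open>As \<open>a\<close> and \<open>A\<close> are isotropic, each coefficient is read
    off by pairing with the other vector. The coefficients of \<open>s\<close> and \<open>S\<close>
    solve a 2 by 2 Gram system by Cramer's rule, with determinant \<open>d\<close> up to
    sign.\<close>
  let ?z = "((x \<odot> A) / (a \<odot> A)) *s a + ((x \<odot> a) / (a \<odot> A)) *s A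
      + ((?n * (x \<odot> S) - ?r * (x \<odot> s)) / d) *s s + ((?n * (x \<odot> s) - ?q * (x \<odot> S)) / d) *s S"
  have "x - ?z = 0"
  proof (rule nrm_orth_nrm_eq_0)
    have 1: "u / d * q + v / d * r = t" if "u * q + v * r = t * d" for u v q r t
      using that d by (metis add_divide_distrib nonzero_mult_div_cancel_right times_divide_eq_left)
    show "(x - ?z) \<odot> s = 0"
      using 1[of "?n * (x \<odot> S) - ?r * (x \<odot> s)" ?q "?n * (x \<odot> s) - ?q * (x \<odot> S)" ?n "x \<odot> s"]
      by (simp add: frame_simps d_def algebra_simps power2_eq_square)
    show "(x - ?z) \<odot> S = 0"
      using 1[of "?n * (x \<odot> S) - ?r * (x \<odot> s)" ?n "?n * (x \<odot> s) - ?q * (x \<odot> S)" ?r "x \<odot> S"]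
      by (simp add: frame_simps d_def algebra_simps power2_eq_square)
    show "(x - ?z) \<odot> y = 0" if "nrm y" for y
      using that assms(2)[OF that] by (simp add: nrm_def bdot_commute[of _ y])
  qed (use a_nz assms(1) in \<open>simp_all add: frame_simps bdot_commute[of x f]\<close>)
  then have "x = ?z" by simp
  then show ?thesis by blast
qed

lemma nrm_cvec_split:
  assumes "nrm y"
  obtains u v where "nrm (cvec u)" "nrm (cvec v)" "y = cvec u + \<i> *s cvec v"
proof -
  obtain u v where uv: "y = cvec u + \<i> *s cvec v" "cvec u = (1/2) *s (y + vcnj y)" "cvec v = (-\<i>/2) *s (y - vcnj y)"
    by (rule cvec_split)
  have "nrm (cvec u)" "nrm (cvec v)" unfolding uv(2,3) by (intro nrm_lin nrm_vcnj assms)+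
  then show ?thesis using that uv(1) by blast
qed

lemma f_cvec: obtains f' where "f = cvec f'" "f' \<bullet> f' = 1"
proof -
  obtain f' k where "f = cvec f' + \<i> *s cvec k" "cvec k = (-\<i>/2) *s (f - vcnj f)" by (rule cvec_split)
  then have f: "f = cvec f'" by (simp add: f_real)
  moreover have "complex_of_real (f' \<bullet> f') = 1" using ff unfolding f by simp
  ultimately show ?thesis using that by simp
qed

text \<open>The real and imaginary parts of the frame give five independent real vectors, and 7 - 5
  = 2.\<close>

lemma dim_nrm: "dim {c. nrm (cvec c)} \<le> 2"
proof -
  obtain f' where f': "f = cvec f'" "f' \<bullet> f' = 1" by (rule f_cvec)
  obtain e1 e2 where a: "a = cvec e1 + \<i> *s cvec e2" and A: "A = cvec e1 - \<i> *s cvec e2"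
    by (rule cvec_split)
  obtain n r where s: "s = cvec n + \<i> *s cvec r" and S: "S = cvec n - \<i> *s cvec r"
    by (rule cvec_split)
  have e: "e1 \<bullet> e1 = e2 \<bullet> e2" "e1 \<bullet> e2 = 0"
    using aa unfolding a by (auto simp: complex_eq_iff inner_commute)
  have e1: "e1 \<noteq> 0" "e2 \<noteq> 0"
    using a_nz e(1) unfolding A unfolding a by auto
  have fe: "f' \<bullet> e1 = 0" "f' \<bullet> e2 = 0" "f' \<bullet> n = 0" "f' \<bullet> r = 0"
    using fa fs unfolding f' a s by (auto simp: complex_eq_iff)
  have en: "e1 \<bullet> n = 0" "e1 \<bullet> r = 0" "e2 \<bullet> n = 0" "e2 \<bullet> r = 0"
    using as As unfolding A unfolding a s by (auto simp: complex_eq_iff)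
  have nd: "(n \<bullet> n) * (r \<bullet> r) \<noteq> (n \<bullet> r)\<^sup>2"
    using nondeg unfolding S unfolding s
    by (auto simp: complex_eq_iff power2_eq_square algebra_simps inner_commute)
  then have n0: "n \<noteq> 0" by auto
  \<comment> \<open>Gram-Schmidt for the real and imaginary parts \<open>n\<close> and
    \<open>r\<close> of \<open>s\<close>; by \<open>nd\<close> their Gram determinant is nonzero, so
    \<open>t\<close> does not vanish.\<close>
  define t where "t = r - ((n \<bullet> r) / (n \<bullet> n)) *\<^sub>R n"
  have t0: "t \<noteq> 0"
  proof
    assume "t = 0"
    then have "r = ((n \<bullet> r) / (n \<bullet> n)) *\<^sub>R n" by (simp add: t_def)
    then obtain c where "r = c *\<^sub>R n" by blast
    then show False using nd by (simp add: power2_eq_square)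
  qed
  have nt: "n \<bullet> t = 0" using n0 by (simp add: t_def inner_diff_right)
  have ot: "f' \<bullet> t = 0" "e1 \<bullet> t = 0" "e2 \<bullet> t = 0"
    using fe en by (simp_all add: t_def inner_diff_right)
  let ?B = "{f', e1, e2, n, t}"
  have f0: "f' \<noteq> 0" using f' by auto
  have ne: "f' \<noteq> e1" "f' \<noteq> e2" "f' \<noteq> n" "f' \<noteq> t" "e1 \<noteq> e2" "e1 \<noteq> n" "e1 \<noteq> t" "e2 \<noteq> n" "e2 \<noteq> t" "n \<noteq> t"
    using f0 e1 n0 t0 fe e en nt ot by auto
  then have card: "card ?B = 5" by simp
  have "independent ?B"
    using f0 e1 n0 t0 fe e en nt ot
    by (intro pairwise_orthogonal_independent) (auto simp: pairwise_def orthogonal_def inner_commute)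
  then have dB: "dim (span ?B) = 5"
    using card by (metis dim_span indep_card_eq_dim_span)
  have "dim {y \<in> UNIV. \<forall>x\<in>span ?B. orthogonal x y} + dim (span ?B) = dim (UNIV :: (real^7) set)"
    by (rule dim_subspace_orthogonal_to_vectors) auto
  then have d2: "dim {y. \<forall>x\<in>span ?B. orthogonal x y} = 2"
    unfolding dB by simp
  have "{c. nrm (cvec c)} \<subseteq> {y. \<forall>x\<in>span ?B. orthogonal x y}"
  proof safe
    fix c x assume c: "nrm (cvec c)" and x: "x \<in> span ?B"
    have "cvec c \<odot> f = 0" "cvec c \<odot> a = 0" "cvec c \<odot> s = 0"
      using c by (simp_all add: nrm_def)
    then have "c \<bullet> f' = 0" "c \<bullet> e1 = 0" "c \<bullet> e2 = 0" "c \<bullet> n = 0" "c \<bullet> r = 0"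
      unfolding f' a s by (auto simp: complex_eq_iff)
    then have "orthogonal c y" if "y \<in> ?B" for y
      using that by (auto simp: orthogonal_def t_def inner_diff_right)
    then have "orthogonal c x"
      by (rule orthogonal_to_span[OF x])
    then show "orthogonal x c"
      by (simp add: orthogonal_commute)
  qed
  from dim_subset[OF this] show ?thesis unfolding d2 .
qed

lemma subspace_nrm: "subspace {c. nrm (cvec c)}"
  by (rule subspaceI) (auto simp: nrm_lin)

text \<open>Real vectors orthogonal to \<open>f\<close> and to the complement lie in the complex
  span of \<open>a\<close>, \<open>A\<close>, \<open>s\<close>, \<open>S\<close> by
  \<open>ortho_span\<close>, so trilinearity and \<open>I_zero\<close> supply the vanishing
  hypothesis of \<open>cross7_invariant_complement\<close>, applied to the real points of the
  complement.\<close>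

lemma nrm_invariant:
  assumes "nrm y"
  shows "nrm (f \<otimes> y)"
proof -
  let ?C = "{c. nrm (cvec c)}"
  obtain f' where f': "f = cvec f'" "f' \<bullet> f' = 1" by (rule f_cvec)
  define E where "E = {x. f' \<bullet> x = 0 \<and> (\<forall>c\<in>?C. c \<bullet> x = 0)}"
  have E: "\<exists>c1 c2 c3 c4. cvec x = c1 *s a + c2 *s A + c3 *s s + c4 *s S" if x: "x \<in> E" for x
  proof (rule ortho_span)
    show "f \<odot> cvec x = 0" using x by (simp add: E_def f')
    show "cvec x \<odot> y = 0" if ny: "nrm y" for y
    proof -
      obtain u v where uv: "nrm (cvec u)" "nrm (cvec v)" "y = cvec u + \<i> *s cvec v"
        by (rule nrm_cvec_split[OF ny])
      have "u \<bullet> x = 0" "v \<bullet> x = 0" using uv(1,2) x by (auto simp: E_def)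
      then show ?thesis unfolding uv(3) by (simp add: inner_commute[of x])
    qed
  qed
  have T: "cross7 f' (cross7 x y) \<bullet> z = 0" if "x \<in> E" "y \<in> E" "z \<in> E" for x y z
  proof -
    have 1: "I x' y' (cvec z) = 0" if "x' \<in> {a, A, s, S}" "y' \<in> {a, A, s, S}" for x' y'
    proof -
      obtain c1 c2 c3 c4 where z: "cvec z = c1 *s a + c2 *s A + c3 *s s + c4 *s S"
        using E[OF \<open>z \<in> E\<close>] by blast
      show ?thesis unfolding z using that by (simp add: I_zero del: insert_iff) (simp add: I_zero insertI1 insertI2)
    qed
    have 2: "I x' (cvec y) (cvec z) = 0" if "x' \<in> {a, A, s, S}" for x'
    proof -
      obtain c1 c2 c3 c4 where y: "cvec y = c1 *s a + c2 *s A + c3 *s s + c4 *s S"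
        using E[OF \<open>y \<in> E\<close>] by blast
      show ?thesis unfolding y using that 1 by simp
    qed
    obtain c1 c2 c3 c4 where x: "cvec x = c1 *s a + c2 *s A + c3 *s s + c4 *s S"
      using E[OF \<open>x \<in> E\<close>] by blast
    have "I (cvec x) (cvec y) (cvec z) = 0"
      unfolding x using 2 by simp
    then show ?thesis unfolding I_def unfolding f' by simp
  qed
  have C0: "f' \<bullet> c = 0" if "c \<in> ?C" for c
  proof -
    have "cvec c \<odot> f = 0" using that by (simp add: nrm_def)
    then show ?thesis unfolding f' by (simp add: inner_commute)
  qed
  have *: "nrm (f \<otimes> cvec c)" if "nrm (cvec c)" for c
  proof -
    have "cross7 f' c \<in> ?C"
      by (rule cross7_invariant_complement[OF f'(2) subspace_nrm dim_nrm C0 E_def T]) (use that in auto)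
    then show ?thesis by (simp add: f')
  qed
  obtain u v where "nrm (cvec u)" "nrm (cvec v)" "y = cvec u + \<i> *s cvec v"
    by (rule nrm_cvec_split[OF assms])
  then show ?thesis using * by (simp add: nrm_lin)
qed

lemma nrm_cross:
  assumes "x \<in> {a, A, s, S}" "y \<in> {a, A, s, S}"
  shows "nrm (f \<otimes> (x \<otimes> y))"
  using I_zero[OF assms] unfolding nrm_def I_def by (simp add: bdot_commute[of _ f])

text \<open>By \<open>nrm_cross\<close> and invariance,
  \<open>f \<otimes> (f \<otimes> (x \<otimes> y))\<close> is normal; the double product rule
  identifies it with \<open>- (x \<otimes> y)\<close> up to a multiple of \<open>f\<close>.\<close>

lemma triple_zero:
  assumes "x \<in> {a, A, s, S}" "y \<in> {a, A, s, S}" "z \<in> {a, A, s, S}"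
  shows "(x \<otimes> y) \<odot> z = 0"
  using nrm_invariant[OF nrm_cross[OF assms(1,2)]] assms(3)
  by (auto simp: nrm_def ccross_same ff frame_simps)

text \<open>The operator \<open>f \<otimes> _\<close> is skew, so invariance of a subspace passes to
  its orthogonal complement.\<close>

lemma f_cross_orth_nrm: "x \<in> {a, A, s, S} \<Longrightarrow> nrm y \<Longrightarrow> (f \<otimes> x) \<odot> y = 0"
  using nrm_invariant[of y] triple_skew[of x f y] by (auto simp: nrm_def bdot_commute)

end

context nondegenerate_frame
begin

text \<open>\<open>V\<close> is \<open>\<i>\<close> times a real vector; that vector and its product
  with \<open>f\<close> are orthogonal and nonzero, hence a basis of the real points of the
  complement, whose dimension is at most two.\<close>

lemma nrm_span:
  assumes V: "nrm V" "vcnj V = - V" "V \<noteq> 0" and y: "nrm y"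
  shows "\<exists>\<alpha> \<beta>. y = \<alpha> *s V + \<beta> *s (f \<otimes> V)"
proof -
  let ?C = "{c. nrm (cvec c)}"
  obtain f' where f': "f = cvec f'" "f' \<bullet> f' = 1" by (rule f_cvec)
  define v where "v = (\<chi> i. Im (V $ i))"
  have "Re (V $ i) = 0" for i
    using arg_cong[OF V(2), of "\<lambda>x. Re (x $ i)"] by (simp add: vcnj_def)
  then have Vv: "V = \<i> *s cvec v"
    by (auto simp: v_def vec_eq_iff cvec_def complex_eq_iff)
  have vV: "cvec v = (-\<i>) *s V" by (simp add: Vv vector_smult_assoc)
  then have nv: "nrm (cvec v)" using V(1) by (simp add: nrm_lin del: vector_smult_lneg)
  define w where "w = cross7 f' v"
  have "cvec w = f \<otimes> cvec v" by (simp add: w_def f')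
  then have wV: "cvec w = (-\<i>) *s (f \<otimes> V)" unfolding vV ccross_simps .
  have nw: "nrm (cvec w)" using nrm_invariant[OF nv] by (simp add: w_def f')
  have vw: "v \<bullet> w = 0" by (simp add: w_def cross7_triple_self)
  have v0: "v \<noteq> 0" using V(3) Vv by auto
  have w0: "w \<noteq> 0"
  proof
    assume "w = 0"
    then have "cross7 f' w = 0" using bilinear_rzero[OF bilinear_cross7] by simp
    moreover have "cvec v \<odot> f = 0" using nv by (simp add: nrm_def)
    then have "f' \<bullet> v = 0" unfolding f' by (simp add: inner_commute)
    ultimately show False using v0 f'(2) by (simp add: w_def cross7_same)
  qed
  have "independent {v, w}"
    using v0 w0 vw by (intro pairwise_orthogonal_independent) (auto simp: pairwise_def orthogonal_def inner_commute)
  moreover have "v \<noteq> w" using vw v0 by auto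
  ultimately have C: "?C \<subseteq> span {v, w}"
    using nv nw dim_nrm by (intro card_ge_dim_independent) auto
  have real: "\<exists>\<alpha> \<beta>. cvec c = \<alpha> *s V + \<beta> *s (f \<otimes> V)" if "nrm (cvec c)" for c
  proof -
    from that C have "c \<in> span {v, w}" by blast
    then obtain \<alpha> where "c - \<alpha> *\<^sub>R v \<in> span {w}" unfolding span_breakdown_eq by blast
    then obtain \<beta> where "c - \<alpha> *\<^sub>R v = \<beta> *\<^sub>R w" unfolding span_singleton by blast
    then have c: "c = \<alpha> *\<^sub>R v + \<beta> *\<^sub>R w" by (simp add: algebra_simps)
    have "cvec c = (-\<i> * of_real \<alpha>) *s V + (-\<i> * of_real \<beta>) *s (f \<otimes> V)"
      unfolding c cvec_simps vV wV by (simp add: vec_eq_iff)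
    then show ?thesis by blast
  qed
  obtain p q where pq: "nrm (cvec p)" "nrm (cvec q)" "y = cvec p + \<i> *s cvec q"
    by (rule nrm_cvec_split[OF y])
  obtain a1 b1 a2 b2 where "cvec p = a1 *s V + b1 *s (f \<otimes> V)" "cvec q = a2 *s V + b2 *s (f \<otimes> V)"
    using real[OF pq(1)] real[OF pq(2)] by blast
  then have "y = (a1 + \<i> * a2) *s V + (b1 + \<i> * b2) *s (f \<otimes> V)"
    unfolding pq(3) by (simp add: vec_eq_iff algebra_simps)
  then show ?thesis by blast
qed

text \<open>In the application \<open>e\<close> is \<open>s\<^sub>z\<close>, and the hypotheses are the differential consequences of
  the two identities of the locale.\<close>

lemma degenerate_cross:
  assumes B: "(f \<otimes> A) \<odot> s = 0" and \<kappa>: "\<kappa> * (a \<odot> A) = s \<odot> S"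
    and Bz: "(f \<otimes> S) \<odot> s = - \<kappa> * (f \<odot> (a \<otimes> A))"
    and He: "(a \<otimes> A) \<odot> e = - (a \<odot> A) * ((f \<otimes> a) \<odot> s)"
    and Ve: "(f \<otimes> (a \<otimes> A)) \<odot> e = 0" and Xe: "(f \<otimes> (S \<otimes> a)) \<odot> e = 0" and fe: "f \<odot> e = 0"
  shows "s \<otimes> A = 0"
proof -
  define H where "H = a \<otimes> A"
  define V where "V = f \<otimes> H"
  define \<Theta> where "\<Theta> = f \<odot> H"
  define g where "g = a \<odot> A"
  have g: "g \<noteq> 0" "cnj g = g" using a_nz by (simp_all add: g_def bdot_vcnj_self_real)
  have H: "vcnj H = - H" unfolding H_def by (subst ccross_antisym) simp
  have \<Theta>: "cnj \<Theta> = - \<Theta>"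
    using bdot_vcnj[of f H] by (simp add: \<Theta>_def f_real H)
  have Bc: "(f \<otimes> a) \<odot> S = 0"
    using arg_cong[OF B, of cnj] bdot_vcnj[of "f \<otimes> A" s] by (simp add: f_real)
  have ffx: "f \<otimes> (f \<otimes> x) = (f \<odot> x) *s f - x" for x
    by (simp add: ccross_same ff)
  have nV: "nrm V" unfolding V_def H_def by (rule nrm_cross) auto
  show ?thesis
  proof (cases "(f \<otimes> a) \<odot> s = 0")
    \<comment> \<open>Here \<open>a\<close> and \<open>s\<close> are eigenvectors of
      \<open>f \<otimes> _\<close> with the same eigenvalue \<open>\<tau>\<close>, a square root of
      -1, while \<open>A\<close> has eigenvalue \<open>- \<tau>\<close>. Moving \<open>f\<close>
      past \<open>s \<otimes> A\<close> through one factor or through the other then gives opposite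
      signs.\<close>
    case True
    define \<tau> where "\<tau> = \<Theta> / g"
    have \<tau>c: "cnj \<tau> = - \<tau>" by (simp add: \<tau>_def g \<Theta>)
    have "f \<otimes> a - \<tau> *s a = 0"
    proof (rule nrm_orth_nrm_eq_0)
      have "(f \<otimes> a) \<odot> A = \<Theta>"
        unfolding \<Theta>_def H_def using triple_cyclic[of f a A] bdot_commute by metis
      then show "(f \<otimes> a - \<tau> *s a) \<odot> A = 0" using g by (simp add: \<tau>_def g_def)
      show "(f \<otimes> a - \<tau> *s a) \<odot> y = 0" if "nrm y" for y
        using f_cross_orth_nrm[of a y] that by (simp add: nrm_def bdot_commute[of a])
    qed (simp_all add: frame_simps True Bc)
    then have fa': "f \<otimes> a = \<tau> *s a" by simp
    have "\<tau>\<^sup>2 *s a = - a"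
      using ffx[of a] by (simp add: fa' frame_simps vector_smult_assoc power2_eq_square)
    then have "(\<tau>\<^sup>2 *s a) \<odot> A = (- a) \<odot> A" by simp
    then have "(\<tau>\<^sup>2 + 1) * g = 0" by (simp add: g_def algebra_simps)
    then have \<tau>2: "\<tau>\<^sup>2 = -1" using g by (simp add: eq_neg_iff_add_eq_0)
    have fA': "f \<otimes> A = (- \<tau>) *s A"
      using arg_cong[OF fa', of vcnj] by (simp add: f_real \<tau>c)
    have Ss: "s \<odot> (f \<otimes> S) = - \<tau> * (s \<odot> S)"
    proof -
      have "\<kappa> * \<Theta> = \<tau> * (\<kappa> * g)" using g by (simp add: \<tau>_def)
      also have "\<kappa> * g = s \<odot> S" using \<kappa> by (simp add: g_def)
      finally show ?thesis using Bz by (simp add: \<Theta>_def H_def bdot_commute[of s])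
    qed
    have sS: "(f \<otimes> s) \<odot> S = \<tau> * (s \<odot> S)"
      using triple_skew[of s f S] Ss by simp
    have fsfS: "(f \<otimes> s) \<odot> (f \<otimes> S) = s \<odot> S"
      using triple_skew[of s f "f \<otimes> S"] by (simp add: ffx frame_simps)
    have "(f \<otimes> s - \<tau> *s s) \<odot> vcnj (f \<otimes> s - \<tau> *s s) = (1 + \<tau>\<^sup>2) * (s \<odot> S)"
      by (simp add: f_real \<tau>c fsfS sS Ss algebra_simps power2_eq_square)
    also have "\<dots> = 0" by (simp add: \<tau>2)
    finally have "f \<otimes> s - \<tau> *s s = 0" unfolding bdot_vcnj_self_eq_0_iff .
    then have fs': "f \<otimes> s = \<tau> *s s" by simp
    have "f \<otimes> (s \<otimes> A) = \<tau> *s (s \<otimes> A)"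
      using ccross_ccross_orth[of f s A] by (simp add: frame_simps fA')
    moreover have "f \<otimes> (A \<otimes> s) = - (\<tau> *s (A \<otimes> s))"
      using ccross_ccross_orth[of f A s] by (simp add: frame_simps fs')
    moreover have "A \<otimes> s = - (s \<otimes> A)" by (rule ccross_antisym)
    ultimately have "(\<tau> *s (s \<otimes> A)) = - (\<tau> *s (s \<otimes> A))" by simp
    then have "\<tau> *s (s \<otimes> A) = 0" by (simp add: vec_eq_iff)
    then show ?thesis using \<tau>2 by (auto simp: vec_eq_iff)
  next
    \<comment> \<open>Now \<open>V\<close> and \<open>W\<close> span the complement and
      \<open>W\<close> pairs nontrivially with \<open>e\<close>. Since \<open>f \<otimes> X\<close>
      and \<open>V\<close> are both orthogonal to \<open>e\<close>, the product
      \<open>f \<otimes> X\<close> has no \<open>W\<close> component, so \<open>X\<close> is a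
      multiple of \<open>W\<close>. But \<open>X\<close> is orthogonal to \<open>f\<close> and
      \<open>H\<close>, hence to \<open>W\<close>, and \<open>W\<close> is not isotropic; so
      \<open>X = 0\<close>, and conjugation gives the claim.\<close>
    case False
    define W where "W = f \<otimes> V"
    define X where "X = S \<otimes> a"
    have W: "W = \<Theta> *s f - H" by (simp add: W_def V_def ffx \<Theta>_def)
    have We: "W \<odot> e \<noteq> 0" using He False fe g by (simp add: W H_def g_def)
    have V0: "V \<noteq> 0" using We by (auto simp: W_def)
    have Vc: "vcnj V = - V" by (simp add: V_def f_real H)
    have VV: "V \<odot> V \<noteq> 0" using bdot_vcnj_self_eq_0_iff[of V] V0 by (simp add: Vc)
    have "W \<odot> W = - (V \<odot> (f \<otimes> W))" using triple_skew[of V f W] by (simp add: W_def)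
    also have "\<dots> = V \<odot> V" using nV by (simp add: W_def ffx nrm_def)
    finally have WW: "W \<odot> W \<noteq> 0" using VV by simp
    have "nrm (f \<otimes> X)" unfolding X_def by (rule nrm_cross) auto
    from nrm_span[OF nV Vc V0 this] obtain \<alpha> \<beta> where Y: "f \<otimes> X = \<alpha> *s V + \<beta> *s W"
      unfolding W_def by blast
    have "(f \<otimes> X) \<odot> e = 0" "V \<odot> e = 0" using Xe Ve by (simp_all add: X_def V_def H_def)
    then have "\<beta> * (W \<odot> e) = 0" unfolding Y by simp
    then have "\<beta> = 0" using We by simp
    then have Y: "f \<otimes> X = \<alpha> *s V" using Y by simp
    have fX: "f \<odot> X = 0"
    proof -
      have "X \<odot> f = (a \<otimes> f) \<odot> S" unfolding X_def by (rule triple_cyclic)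
      also have "a \<otimes> f = - (f \<otimes> a)" by (rule ccross_antisym)
      finally show ?thesis using Bc by (simp add: bdot_commute[of f])
    qed
    have X: "X = - \<alpha> *s W"
      using arg_cong[OF Y, of "\<lambda>x. f \<otimes> x"] unfolding ffx fX W_def by (simp add: minus_equation_iff) (metis minus_minus)
    have "H = - (A \<otimes> a)" unfolding H_def by (rule ccross_antisym)
    then have "H \<odot> X = 0" unfolding X_def
      using bdot_ccross_ccross_same[of A a S] by (simp add: frame_simps)
    then have "X \<odot> W = 0" by (simp add: W fX bdot_commute[of X])
    then have "\<alpha> = 0" using WW unfolding X by simp
    then have "X = 0" using X by simp
    then have "vcnj X = 0" by simp
    then show ?thesis by (simp add: X_def)
  qed
qed

end

section \<open>Conformal harmonic maps in a chart\<close>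

locale minimal_chart =
  fixes D :: "complex set" and ph :: "complex \<Rightarrow> complex^7"
  assumes open_D: "open D" and smooth_ph: "smooth_on D ph"
    and ph_real: "w \<in> D \<Longrightarrow> vcnj (ph w) = ph w" and ph_unit: "w \<in> D \<Longrightarrow> ph w \<odot> ph w = 1"
    and conformal: "w \<in> D \<Longrightarrow> dz ph w \<odot> dz ph w = 0"
    and immersed: "w \<in> D \<Longrightarrow> dz ph w \<noteq> 0"
    and harmonic: "w \<in> D \<Longrightarrow> dzb (dz ph) w = - (dz ph w \<odot> vcnj (dz ph w)) *s ph w"
begin

definition a where "a = dz ph"
definition A where "A w = vcnj (a w)"
definition g where "g w = a w \<odot> A w"
definition b where "b = dz a"
text \<open>The tangential coefficient of the second derivative, equal to the z-derivative of log
  \<open>g\<close> by \<open>sder_g\<close>.\<close>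

definition mu where "mu w = (b w \<odot> A w) * inverse (g w)"
definition xi where "xi w = b w - mu w *s a w"
definition Xi where "Xi w = vcnj (xi w)"
definition Q where "Q w = xi w \<odot> xi w"
definition kap where "kap w = (xi w \<odot> Xi w) * inverse (g w)"

lemma g_nz: "w \<in> D \<Longrightarrow> g w \<noteq> 0"
  using immersed by (simp add: g_def A_def a_def)

lemma g_real: "cnj (g w) = g w"
  by (simp add: g_def A_def bdot_vcnj_self_real)

lemma smooth_a: "smooth_on D a" and smooth_A: "smooth_on D A" and smooth_b: "smooth_on D b"
  and smooth_g: "smooth_on D g" and smooth_mu: "smooth_on D mu" and smooth_xi: "smooth_on D xi"
  and smooth_Xi: "smooth_on D Xi" and smooth_kap: "smooth_on D kap"
proof -
  show a: "smooth_on D a" unfolding a_def by (intro smooth_on_dz open_D smooth_ph)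
  show A: "smooth_on D A" unfolding A_def[abs_def] by (intro smooth_on_vcnj open_D a)
  show b: "smooth_on D b" unfolding b_def by (intro smooth_on_dz open_D a)
  show g: "smooth_on D g" unfolding g_def[abs_def] by (intro smooth_on_bdot open_D a A)
  have ig: "smooth_on D (\<lambda>w. inverse (g w))" by (rule smooth_on_inverse[OF open_D g g_nz])
  show mu: "smooth_on D mu"
    unfolding mu_def[abs_def] by (intro smooth_on_bdot smooth_on_mult open_D A b ig)
  show xi: "smooth_on D xi"
    unfolding xi_def[abs_def] by (intro smooth_on_diff smooth_on_cscale open_D mu a b)
  show Xi: "smooth_on D Xi" unfolding Xi_def[abs_def] by (intro smooth_on_vcnj open_D xi)
  show "smooth_on D kap" unfolding kap_def[abs_def] by (intro smooth_on_mult smooth_on_bdot open_D xi Xi ig)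
qed

lemma wder_smooth: "smooth_on D f \<Longrightarrow> w \<in> D \<Longrightarrow> wder f w (dz f w) (dzb f w)"
  by (intro wder_dz smooth_on_differentiable)

lemma sder_smooth: "smooth_on D f \<Longrightarrow> w \<in> D \<Longrightarrow> sder f w (sdz f w) (sdzb f w)"
  by (intro sder_sdz smooth_on_differentiable)

lemma wder_ph: "w \<in> D \<Longrightarrow> wder ph w (a w) (A w)"
proof -
  assume w: "w \<in> D"
  have 1: "wder ph w (dz ph w) (dzb ph w)" by (rule wder_smooth[OF smooth_ph w])
  have "wder ph w (vcnj (dzb ph w)) (vcnj (dz ph w))"
    by (rule wder_cong_open[OF open_D w _ wder_vcnj[OF 1]]) (simp add: ph_real)
  with 1 show ?thesis using wder_unique by (metis A_def a_def)
qed

lemma wder_a: "w \<in> D \<Longrightarrow> wder a w (b w) (- (g w *s ph w))"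
  using wder_smooth[OF smooth_a, of w] harmonic[of w] by (simp add: b_def g_def A_def a_def)

lemma wder_A: "w \<in> D \<Longrightarrow> wder A w (- (g w *s ph w)) (vcnj (b w))"
  using wder_vcnj[OF wder_a, of w] by (simp add: A_def[abs_def] g_real ph_real)

lemma ph_orth: assumes w: "w \<in> D" shows "ph w \<odot> a w = 0" "ph w \<odot> A w = 0"
proof -
  have "sder (\<lambda>w. ph w \<odot> ph w) w 0 0"
    by (rule sder_cong_open[OF open_D w _ sder_const[of 1]]) (simp add: ph_unit)
  from sder_unique[OF this sder_bdot[OF wder_ph[OF w] wder_ph[OF w]]]
  show "ph w \<odot> a w = 0" "ph w \<odot> A w = 0" by (simp_all add: bdot_commute[of "a w"] bdot_commute[of "A w"])
qed

lemma aa: "w \<in> D \<Longrightarrow> a w \<odot> a w = 0"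
  by (simp add: a_def conformal)

lemma AA: "w \<in> D \<Longrightarrow> A w \<odot> A w = 0"
  by (simp add: A_def bdot_vcnj aa)

lemma ph_b: assumes w: "w \<in> D" shows "ph w \<odot> b w = 0"
  using sder_zero_on(1)[OF open_D w ph_orth(1) sder_bdot[OF wder_ph[OF w] wder_a[OF w]]]
  by (simp add: aa w)

lemma a_b: assumes w: "w \<in> D" shows "a w \<odot> b w = 0" "b w \<odot> a w = 0"
  using sder_zero_on(1)[OF open_D w aa sder_bdot[OF wder_a[OF w] wder_a[OF w]]]
  by (simp_all add: bdot_commute[of "b w"])

lemma b_xi: "b w = xi w + mu w *s a w"
  by (simp add: xi_def)

lemma b_A: "w \<in> D \<Longrightarrow> b w \<odot> A w = mu w * g w"
  using g_nz[of w] by (simp add: mu_def)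

lemma sder_g: "w \<in> D \<Longrightarrow> sder g w (mu w * g w) (cnj (mu w) * g w)"
proof -
  assume w: "w \<in> D"
  have 1: "sder g w (b w \<odot> A w) (a w \<odot> vcnj (b w))"
    using sder_bdot[OF wder_a[OF w] wder_A[OF w]] w
    by (simp add: g_def[abs_def] ph_orth bdot_commute[of _ "ph w"])
  have "a w \<odot> vcnj (b w) = cnj (b w \<odot> A w)"
    by (simp add: A_def bdot_vcnj_left[symmetric] bdot_commute)
  then show ?thesis using 1 by (simp add: b_A w g_real)
qed

lemma frame: "w \<in> D \<Longrightarrow> osculating_frame (ph w) (a w) (xi w)"
proof
  assume w: "w \<in> D"
  show "vcnj (ph w) = ph w" "ph w \<odot> ph w = 1" using w by (auto simp: ph_real ph_unit)
  show "ph w \<odot> a w = 0" "a w \<odot> a w = 0" using w by (auto simp: ph_orth aa)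
  show "a w \<odot> vcnj (a w) \<noteq> 0" using g_nz[OF w] by (simp add: g_def A_def)
  show "ph w \<odot> xi w = 0" "a w \<odot> xi w = 0" using w by (auto simp: xi_def ph_b ph_orth a_b aa)
  show "vcnj (a w) \<odot> xi w = 0"
    using b_A[OF w] by (simp add: xi_def g_def A_def bdot_commute[of "vcnj (a w)"])
qed

lemma frame_xi:
  assumes w: "w \<in> D"
  shows "ph w \<odot> xi w = 0" "xi w \<odot> ph w = 0" "a w \<odot> xi w = 0" "xi w \<odot> a w = 0" "A w \<odot> xi w = 0" "xi w \<odot> A w = 0"
    "ph w \<odot> Xi w = 0" "Xi w \<odot> ph w = 0" "a w \<odot> Xi w = 0" "Xi w \<odot> a w = 0" "A w \<odot> Xi w = 0" "Xi w \<odot> A w = 0"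
    "a w \<odot> ph w = 0" "A w \<odot> ph w = 0" "A w \<odot> a w = g w" "a w \<odot> A w = g w"
  using osculating_frame.frame_simps[OF frame[OF w]] by (auto simp: A_def Xi_def g_def)

lemma vcnj_b: "vcnj (b w) = Xi w + cnj (mu w) *s A w"
  by (simp add: b_xi Xi_def A_def)

text \<open>A Codazzi equation: the derivative in the conjugate variable has no normal component.
  Commuting derivatives expresses that of \<open>b\<close> by \<open>ph\<close> and
  \<open>a\<close>; the \<open>ph\<close> terms cancel in \<open>xi\<close>, and the remaining
  coefficient of \<open>a\<close>, which contains the unknown derivative of \<open>mu\<close>, is
  found by differentiating \<open>xi w \<odot> A w = 0\<close>.\<close>

lemma wder_xi: assumes w: "w \<in> D" shows "wder xi w (dz xi w) (- (kap w *s a w))"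
proof -
  have 1: "wder b w (dz b w) (dzb b w)" by (rule wder_smooth[OF smooth_b w])
  have dzba: "wder (dzb a) w (- ((mu w * g w) *s ph w + g w *s a w)) (- ((cnj (mu w) * g w) *s ph w + g w *s A w))"
  proof (rule wder_cong_open[OF open_D w])
    show "(-1) *s (g v *s ph v) = dzb a v" if "v \<in> D" for v
      using wder_imp_dz(2)[OF wder_a[OF that]] by simp
    show "wder (\<lambda>v. (-1) *s (g v *s ph v)) w (- ((mu w * g w) *s ph w + g w *s a w)) (- ((cnj (mu w) * g w) *s ph w + g w *s A w))"
      using wder_cscale[OF sder_const[of "-1"] wder_cscale[OF sder_g[OF w] wder_ph[OF w]]] by simp
  qed
  have "dzb b w = dz (dzb a) w"
    unfolding b_def by (rule dz_dzb(2)[OF open_D w smooth_a])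
  also have "\<dots> = - ((mu w * g w) *s ph w + g w *s a w)"
    by (rule wder_imp_dz(1)[OF dzba])
  finally have 2: "wder b w (dz b w) (- ((mu w * g w) *s ph w + g w *s a w))" using 1 by simp
  obtain m1 m2 where m: "sder mu w m1 m2" using sder_smooth[OF smooth_mu w] by blast
  have 3: "wder xi w (dz b w - (m1 *s a w + mu w *s b w)) ((- (g w + m2)) *s a w)"
    unfolding xi_def[abs_def]
    by (rule wder_eqI[OF wder_diff[OF 2 wder_cscale[OF m wder_a[OF w]]]]) (simp_all add: vec_eq_iff algebra_simps)
  from sder_zero_on(2)[OF open_D w frame_xi(6) sder_bdot[OF 3 wder_A[OF w]]]
  have "(- (g w + m2)) * g w + xi w \<odot> vcnj (b w) = 0"
    by (simp add: frame_xi w algebra_simps)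
  then have "(- (g w + m2)) * g w = - (xi w \<odot> Xi w)"
    by (simp add: vcnj_b frame_xi w add_eq_0_iff2)
  then have "- (g w + m2) = - kap w"
    using g_nz[OF w] by (simp add: kap_def field_simps)
  then have "wder xi w (dz b w - (m1 *s a w + mu w *s b w)) (- (kap w *s a w))"
    using 3 by simp
  then show ?thesis using wder_imp_dz(1) by metis
qed

text \<open>The antiholomorphic derivative of \<open>xi\<close> is a multiple of \<open>a\<close>,
  which is orthogonal to \<open>xi\<close>; this is the holomorphy of the Hopf type
  differential.\<close>

lemma sder_Q: assumes w: "w \<in> D" shows "sder Q w (2 * (xi w \<odot> dz xi w)) 0"
  using sder_bdot[OF wder_xi[OF w] wder_xi[OF w]]
  by (simp add: Q_def[abs_def] frame_xi w bdot_commute[of "dz xi w"])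

lemma Q_holomorphic: "Q holomorphic_on D"
  unfolding holomorphic_on_def using sder_imp_field_derivative[OF sder_Q]
  by (meson field_differentiable_at_within field_differentiable_def)

lemma dz_xi:
  assumes w: "w \<in> D"
  shows "ph w \<odot> dz xi w = 0" "a w \<odot> dz xi w = - Q w" "A w \<odot> dz xi w = 0"
proof -
  show "ph w \<odot> dz xi w = 0"
    using sder_zero_on(1)[OF open_D w frame_xi(1) sder_bdot[OF wder_ph[OF w] wder_xi[OF w]]]
    by (simp add: frame_xi w)
  show "a w \<odot> dz xi w = - Q w"
    using sder_zero_on(1)[OF open_D w frame_xi(3) sder_bdot[OF wder_a[OF w] wder_xi[OF w]]]
    by (simp add: frame_xi w b_xi Q_def eq_neg_iff_add_eq_0 add.commute)
  show "A w \<odot> dz xi w = 0"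
    using sder_zero_on(1)[OF open_D w frame_xi(5) sder_bdot[OF wder_A[OF w] wder_xi[OF w]]]
    by (simp add: frame_xi w)
qed

definition H where "H w = a w \<otimes> A w"

lemma wder_H:
  assumes w: "w \<in> D"
  shows "wder H w (xi w \<otimes> A w + mu w *s H w + g w *s (ph w \<otimes> a w))
    (a w \<otimes> Xi w + cnj (mu w) *s H w - g w *s (ph w \<otimes> A w))"
proof -
  have 1: "a w \<otimes> ph w = - (ph w \<otimes> a w)" by (rule ccross_antisym)
  show ?thesis
    unfolding H_def[abs_def]
  proof (rule wder_eqI[OF wder_ccross[OF wder_a[OF w] wder_A[OF w]]])
    show "b w \<otimes> A w + a w \<otimes> - (g w *s ph w) = xi w \<otimes> A w + mu w *s (a w \<otimes> A w) + g w *s (ph w \<otimes> a w)"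
      by (simp add: b_xi[of w] 1)
    show "- (g w *s ph w) \<otimes> A w + a w \<otimes> vcnj (b w)
        = a w \<otimes> Xi w + cnj (mu w) *s (a w \<otimes> A w) - g w *s (ph w \<otimes> A w)"
      by (simp add: vcnj_b)
  qed
qed

section \<open>Pseudo-umbilicity and its differential consequences\<close>

definition pseudo_umbilic where
  "pseudo_umbilic \<longleftrightarrow> (\<forall>w\<in>D. (ph w \<otimes> xi w) \<odot> H w = 0)"

text \<open>In each product the two cross products can be arranged to share a factor, so
  \<open>bdot_ccross_ccross_same\<close> reduces it to dot products of the frame, all of which
  cancel.\<close>

lemma cross_orth:
  assumes w: "w \<in> D"
  shows "(A w \<otimes> xi w) \<odot> H w = 0" "(ph w \<otimes> a w) \<odot> H w = 0" "(ph w \<otimes> xi w) \<odot> (ph w \<otimes> A w) = 0"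
    "(ph w \<otimes> H w) \<odot> a w = 0" "(ph w \<otimes> (xi w \<otimes> A w)) \<odot> xi w = 0" "(xi w \<otimes> A w) \<odot> H w = 0"
    "(ph w \<otimes> A w) \<odot> H w = 0"
proof -
  note f = frame_xi[OF w] aa[OF w] AA[OF w] ph_orth[OF w] ph_unit[OF w]
  have H: "H w = - (A w \<otimes> a w)" unfolding H_def by (rule ccross_antisym)
  show 1: "(xi w \<otimes> A w) \<odot> H w = 0"
    unfolding H_def by (simp add: bdot_ccross_ccross_same f)
  show "(A w \<otimes> xi w) \<odot> H w = 0"
    using 1 by (subst ccross_antisym) simp
  show 2: "(ph w \<otimes> a w) \<odot> H w = 0"
    unfolding H by (simp add: bdot_ccross_ccross_same f)
  show "(ph w \<otimes> A w) \<odot> H w = 0"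
    unfolding H_def by (simp add: bdot_ccross_ccross_same f)
  have "(ph w \<otimes> xi w) \<odot> (ph w \<otimes> A w) = (xi w \<otimes> ph w) \<odot> (A w \<otimes> ph w)"
    using ccross_antisym[of "ph w" "xi w"] ccross_antisym[of "ph w" "A w"] by simp
  then show "(ph w \<otimes> xi w) \<odot> (ph w \<otimes> A w) = 0"
    by (simp add: bdot_ccross_ccross_same f)
  show "(ph w \<otimes> H w) \<odot> a w = 0"
    using triple_skew[of "H w" "ph w" "a w"] 2 by (simp add: bdot_commute[of "H w"])
  have "(ph w \<otimes> (xi w \<otimes> A w)) \<odot> xi w = - ((xi w \<otimes> A w) \<odot> (ph w \<otimes> xi w))"
    using triple_skew[of "xi w \<otimes> A w" "ph w" "xi w"] by simp
  also have "\<dots> = (A w \<otimes> xi w) \<odot> (ph w \<otimes> xi w)"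
    using ccross_antisym[of "A w" "xi w"] by simp
  finally show "(ph w \<otimes> (xi w \<otimes> A w)) \<odot> xi w = 0"
    by (simp add: bdot_ccross_ccross_same f)
qed

lemma ccross_ph_ph: "w \<in> D \<Longrightarrow> ph w \<otimes> (ph w \<otimes> x) = (ph w \<odot> x) *s ph w - x"
  by (simp add: ccross_same ph_unit)

text \<open>The first claim is the antiholomorphic derivative of the condition. The second is the
  condition itself after moving the skew operator across; the third is its z-derivative, and the
  fourth is the antiholomorphic derivative of the third.\<close>

lemma pseudo_umbilic_derived:
  assumes P: pseudo_umbilic and w: "w \<in> D"
  shows "(ph w \<otimes> xi w) \<odot> (a w \<otimes> Xi w) = 0" "(ph w \<otimes> H w) \<odot> xi w = 0" "(ph w \<otimes> H w) \<odot> dz xi w = 0"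
    "(ph w \<otimes> (Xi w \<otimes> a w)) \<odot> dz xi w = 0"
proof -
  have P': "(ph v \<otimes> xi v) \<odot> H v = 0" if "v \<in> D" for v using P that by (simp add: pseudo_umbilic_def)
  have V: "(ph v \<otimes> H v) \<odot> xi v = 0" if "v \<in> D" for v
    using triple_skew[of "xi v" "ph v" "H v"] P'[OF that] by (simp add: bdot_commute[of "xi v"])
  show "(ph w \<otimes> H w) \<odot> xi w = 0" by (rule V[OF w])
  note ccw = cross_orth[OF w] frame_xi[OF w] ph_orth[OF w] aa[OF w] AA[OF w]
  show "(ph w \<otimes> xi w) \<odot> (a w \<otimes> Xi w) = 0"
    using sder_zero_on(2)[OF open_D w P' sder_bdot[OF wder_ccross[OF wder_ph[OF w] wder_xi[OF w]] wder_H[OF w]]]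
    by (simp add: ccw P' w)
  note dV = wder_ccross[OF wder_ph wder_H]
  have aH: "a v \<otimes> H v = g v *s a v" if v: "v \<in> D" for v
    by (simp add: H_def ccross_same aa v frame_xi)
  have W: "(ph v \<otimes> H v) \<odot> dz xi v = 0" if v: "v \<in> D" for v
    using sder_zero_on(1)[OF open_D v V sder_bdot[OF dV[OF v v] wder_xi[OF v]]]
    by (simp add: cross_orth[OF v] frame_xi[OF v] V[OF v] ccross_ph_ph[OF v] aH[OF v] ph_orth[OF v])
  then show "(ph w \<otimes> H w) \<odot> dz xi w = 0" using w by blast
  have "smooth_on D (dz xi)" by (intro smooth_on_dz open_D smooth_xi)
  then have d1: "wder (dz xi) w (dz (dz xi) w) (dzb (dz xi) w)" by (rule wder_smooth[OF _ w])
  obtain k1 k2 where k: "sder kap w k1 k2" using sder_smooth[OF smooth_kap w] by blast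
  \<comment> \<open>Commuting the derivatives avoids computing third derivatives of the immersion.
    The unknown \<open>k1\<close> only multiplies \<open>a\<close>, which is orthogonal to
    \<open>ph w \<otimes> H w\<close>.\<close>
  have d2: "dzb (dz xi) w = - (k1 *s a w + kap w *s b w)"
  proof -
    have "wder (dzb xi) w (- (k1 *s a w + kap w *s b w)) (- (k2 *s a w - (kap w * g w) *s ph w))"
    proof (rule wder_cong_open[OF open_D w])
      show "(-1) *s (kap v *s a v) = dzb xi v" if "v \<in> D" for v
        using wder_imp_dz(2)[OF wder_xi[OF that]] by simp
      show "wder (\<lambda>v. (-1) *s (kap v *s a v)) w (- (k1 *s a w + kap w *s b w)) (- (k2 *s a w - (kap w * g w) *s ph w))"
        using wder_cscale[OF sder_const[of "-1"] wder_cscale[OF k wder_a[OF w]]] by (simp add: vector_smult_assoc)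
    qed
    then have "dz (dzb xi) w = - (k1 *s a w + kap w *s b w)" by (rule wder_imp_dz)
    then show ?thesis using dz_dzb(2)[OF open_D w smooth_xi] by simp
  qed
  have AH: "A w \<otimes> H w = - (g w *s A w)"
  proof -
    have "A w \<otimes> H w = - (A w \<otimes> (A w \<otimes> a w))" unfolding H_def by (subst ccross_antisym[of "a w"]) simp
    then show ?thesis by (simp add: ccross_same ccw)
  qed
  have "(ph w \<otimes> (a w \<otimes> Xi w)) \<odot> dz xi w = 0"
    using sder_zero_on(2)[OF open_D w W sder_bdot[OF dV[OF w w] d1]]
    by (simp add: d2 AH b_xi ccw V w W ccross_ph_ph dz_xi)
  then show "(ph w \<otimes> (Xi w \<otimes> a w)) \<odot> dz xi w = 0"
    by (subst ccross_antisym[of "Xi w"]) simp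
qed

text \<open>If the Gram determinant of \<open>xi\<close> and its conjugate is nonzero at
  \<open>w\<close>, it is so on an open set \<open>D'\<close>. There the frame lemmas give
  identities in a neighbourhood, which may be differentiated to produce the hypotheses of
  \<open>degenerate_cross\<close>.\<close>

lemma pseudo_umbilic_dichotomy:
  assumes P: pseudo_umbilic and w: "w \<in> D"
  shows "xi w \<otimes> A w = 0 \<or> (xi w \<odot> Xi w)\<^sup>2 = Q w * cnj (Q w)"
proof (rule disjCI)
  assume nd: "(xi w \<odot> Xi w)\<^sup>2 \<noteq> Q w * cnj (Q w)"
  define E where "E v = (xi v \<odot> Xi v)\<^sup>2 - Q v * cnj (Q v)" for v
  define D' where "D' = {v \<in> D. E v \<noteq> 0}"
  have "continuous_on D E"
    unfolding E_def[abs_def] Q_def[abs_def]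
    by (intro continuous_intros smooth_on_continuous smooth_on_bdot open_D smooth_xi smooth_Xi)
  then have "open (D \<inter> E -` (- {0}))"
    by (rule continuous_open_preimage[OF _ open_D]) auto
  moreover have "D \<inter> E -` (- {0}) = D'" by (auto simp: D'_def)
  ultimately have D': "open D'" by simp
  have wD': "w \<in> D'" using nd w by (simp add: D'_def E_def)
  have nf: "nondegenerate_frame (ph v) (a v) (xi v)" if "v \<in> D'" for v
  proof -
    have v: "v \<in> D" using that by (simp add: D'_def)
    show ?thesis
    proof (intro nondegenerate_frame.intro frame v nondegenerate_frame_axioms.intro)
      show "(xi v \<odot> vcnj (xi v))\<^sup>2 \<noteq> (xi v \<odot> xi v) * (vcnj (xi v) \<odot> vcnj (xi v))"
        using that by (simp add: D'_def E_def Xi_def Q_def bdot_vcnj)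
      show "(ph v \<otimes> xi v) \<odot> (a v \<otimes> vcnj (a v)) = 0"
        using P v by (simp add: pseudo_umbilic_def H_def A_def)
      show "(ph v \<otimes> xi v) \<odot> (a v \<otimes> vcnj (xi v)) = 0"
        using pseudo_umbilic_derived(1)[OF P v] by (simp add: Xi_def)
    qed
  qed
  have DD: "v \<in> D" if "v \<in> D'" for v using that by (simp add: D'_def)
  \<comment> \<open>Two derivatives are drawn from \<open>K\<close>: the antiholomorphic one gives
    \<open>B\<close>, with \<open>T\<close> removing the remaining term, and the z-derivative gives
    \<open>He\<close>. Differentiating \<open>B\<close> in the conjugate variable then gives
    \<open>Bz\<close>.\<close>
  have K: "H v \<odot> xi v = 0" if "v \<in> D'" for v
    using nondegenerate_frame.triple_zero[OF nf[OF that], of "a v" "vcnj (a v)" "xi v"]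
    by (simp add: H_def A_def)
  have T: "(a v \<otimes> Xi v) \<odot> xi v = 0" if "v \<in> D'" for v
    using nondegenerate_frame.triple_zero[OF nf[OF that], of "a v" "vcnj (xi v)" "xi v"]
    by (simp add: Xi_def)
  have aH: "H v \<odot> a v = 0" for v by (simp add: H_def)
  have B: "(ph v \<otimes> A v) \<odot> xi v = 0" if v: "v \<in> D'" for v
    using sder_zero_on(2)[OF D' v K sder_bdot[OF wder_H[OF DD[OF v]] wder_xi[OF DD[OF v]]]]
    by (simp add: K[OF v] T[OF v] aH g_nz[OF DD[OF v]])
  have He: "H w \<odot> dz xi w = - g w * ((ph w \<otimes> a w) \<odot> xi w)"
    using sder_zero_on(1)[OF D' wD' K sder_bdot[OF wder_H[OF w] wder_xi[OF w]]]
    by (simp add: K[OF wD'] eq_neg_iff_add_eq_0 add.commute)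
  have phAa: "(ph w \<otimes> A w) \<odot> a w = - (ph w \<odot> H w)"
  proof -
    have "(ph w \<otimes> A w) \<odot> a w = (A w \<otimes> a w) \<odot> ph w" by (rule triple_cyclic)
    also have "A w \<otimes> a w = - H w" unfolding H_def by (rule ccross_antisym)
    finally show ?thesis by (simp add: bdot_commute)
  qed
  have Bz: "(ph w \<otimes> Xi w) \<odot> xi w = - kap w * (ph w \<odot> H w)"
    using sder_zero_on(2)[OF D' wD' B
        sder_bdot[OF wder_ccross[OF wder_ph[OF w] wder_A[OF w]] wder_xi[OF w]]]
    by (simp add: vcnj_b B[OF wD'] phAa eq_neg_iff_add_eq_0)
  show "xi w \<otimes> A w = 0"
    unfolding A_def
  proof (rule nondegenerate_frame.degenerate_cross[OF nf[OF wD']])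
    show "(ph w \<otimes> vcnj (a w)) \<odot> xi w = 0" using B[OF wD'] by (simp add: A_def)
    show "kap w * (a w \<odot> vcnj (a w)) = xi w \<odot> vcnj (xi w)"
      using g_nz[OF w] by (simp add: kap_def Xi_def g_def A_def)
    show "(ph w \<otimes> vcnj (xi w)) \<odot> xi w = - kap w * (ph w \<odot> (a w \<otimes> vcnj (a w)))"
      using Bz by (simp add: Xi_def H_def A_def)
    show "(a w \<otimes> vcnj (a w)) \<odot> dz xi w = - (a w \<odot> vcnj (a w)) * ((ph w \<otimes> a w) \<odot> xi w)"
      using He by (simp add: H_def A_def g_def)
    show "(ph w \<otimes> (a w \<otimes> vcnj (a w))) \<odot> dz xi w = 0"
      using pseudo_umbilic_derived(3)[OF P w] by (simp add: H_def A_def)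
    show "(ph w \<otimes> (vcnj (xi w) \<otimes> a w)) \<odot> dz xi w = 0"
      using pseudo_umbilic_derived(4)[OF P w] by (simp add: Xi_def)
    show "ph w \<odot> dz xi w = 0" by (rule dz_xi(1)[OF w])
  qed
qed

text \<open>The double product \<open>xi w \<otimes> (xi w \<otimes> A w)\<close> equals
  \<open>- (Q w *s A w)\<close>. Hence, in the pseudo-umbilic case, nonzero \<open>Q\<close> forces
  the second alternative of the dichotomy.\<close>

lemma xi_cross_eq_0_imp: "w \<in> D \<Longrightarrow> xi w \<otimes> A w = 0 \<Longrightarrow> Q w = 0"
proof -
  assume w: "w \<in> D" and "xi w \<otimes> A w = 0"
  then have "xi w \<otimes> (xi w \<otimes> A w) = 0" by simp
  then have "Q w *s A w = 0" by (simp add: ccross_same frame_xi w Q_def)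
  moreover have "Q w * g w = (Q w *s A w) \<odot> a w" by (simp add: frame_xi w)
  ultimately have "Q w * g w = 0" by (simp only: bdot_simps)
  then show "Q w = 0" using g_nz[OF w] by simp
qed

lemma real_frame:
  assumes w: "w \<in> D"
  obtains f' e1 e2 where "ph w = cvec f'" "a w = cvec e1 + \<i> *s cvec e2" "A w = cvec e1 - \<i> *s cvec e2"
    "cvec e1 = (1/2) *s (a w + A w)" "cvec e2 = (-\<i>/2) *s (a w - A w)"
    "f' \<noteq> 0" "e1 \<noteq> 0" "e2 \<noteq> 0" "f' \<bullet> e1 = 0" "f' \<bullet> e2 = 0" "e1 \<bullet> e2 = 0"
proof -
  obtain f' k where "ph w = cvec f' + \<i> *s cvec k" "cvec k = (-\<i>/2) *s (ph w - vcnj (ph w))" by (rule cvec_split)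
  then have f': "ph w = cvec f'" by (simp add: ph_real w)
  obtain e1 e2 where a: "a w = cvec e1 + \<i> *s cvec e2" and A: "A w = cvec e1 - \<i> *s cvec e2"
    and e12: "cvec e1 = (1/2) *s (a w + A w)" "cvec e2 = (-\<i>/2) *s (a w - A w)"
    unfolding A_def by (rule cvec_split)
  have e: "e1 \<bullet> e1 = e2 \<bullet> e2" "e1 \<bullet> e2 = 0"
    using aa[OF w] unfolding a by (auto simp: complex_eq_iff inner_commute)
  have e0: "e1 \<noteq> 0" "e2 \<noteq> 0"
    using g_nz[OF w] e(1) unfolding g_def A unfolding a by auto
  have f0: "f' \<noteq> 0" using ph_unit[OF w] unfolding f' by auto
  have "f' \<bullet> e1 = 0" "f' \<bullet> e2 = 0"
    using ph_orth(1)[OF w] unfolding a f' by (auto simp: complex_eq_iff)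
  then show ?thesis using that f' a A e12 f0 e0 e(2) by blast
qed

lemma Xi_Xi: "Xi w \<odot> Xi w = cnj (Q w)"
  by (simp add: Xi_def Q_def bdot_vcnj)

lemma xi_Xi_real: "cnj (xi w \<odot> Xi w) = xi w \<odot> Xi w" "Xi w \<odot> xi w = xi w \<odot> Xi w"
  by (simp_all add: Xi_def bdot_vcnj_self_real bdot_commute)

text \<open>The equality case of Cauchy-Schwarz for \<open>xi\<close> and its conjugate: the
  hypothesis makes the Hermitian norm of the difference vanish.\<close>

lemma Xi_collinear:
  assumes "Q w \<noteq> 0" and c: "(xi w \<odot> Xi w)\<^sup>2 = Q w * cnj (Q w)"
  shows "Xi w = ((xi w \<odot> Xi w) / Q w) *s xi w"
proof -
  define N where "N = xi w \<odot> Xi w"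
  have N: "cnj N = N" "N * N = Q w * cnj (Q w)" using c by (simp_all add: N_def xi_Xi_real power2_eq_square)
  let ?y = "Xi w - (N / Q w) *s xi w"
  have "vcnj (Xi w) = xi w" "vcnj (xi w) = Xi w" by (simp_all add: Xi_def)
  moreover have "N * N / Q w = cnj (Q w)" "N * N / cnj (Q w) = Q w"
    using assms(1) by (simp_all add: N(2))
  ultimately have "?y \<odot> vcnj ?y = 0"
    by (simp add: assms(1) N(1) Xi_Xi xi_Xi_real(2) N_def[symmetric] Q_def[symmetric])
  then have "?y = 0" unfolding bdot_vcnj_self_eq_0_iff .
  then show ?thesis by (simp add: N_def)
qed

section \<open>The parallel osculating 4-space\<close>

definition R where "R = {w \<in> D. Q w \<noteq> 0}"

lemma open_R: "open R"
proof -
  have "open (D \<inter> Q -` (- {0}))"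
    using Q_holomorphic by (intro continuous_open_preimage open_D holomorphic_on_imp_continuous_on) auto
  moreover have "D \<inter> Q -` (- {0}) = R" by (auto simp: R_def)
  ultimately show ?thesis by simp
qed

text \<open>The (complexified) orthogonal projection onto the span of \<open>\<phi>\<close>, its tangent plane and its
  first normal line.\<close>

definition proj where
  "proj w x = (ph w \<odot> x) *s ph w + inverse (g w) *s ((a w \<odot> x) *s A w + (A w \<odot> x) *s a w)
    + inverse (Q w) *s ((xi w \<odot> x) *s xi w)"

text \<open>Collinearity closes the frame \<open>ph\<close>, \<open>a\<close>, \<open>A\<close>,
  \<open>xi\<close> under both derivatives: no second normal component appears, and the projection
  onto a parallel subspace is constant.\<close>

lemma wder_proj:
  assumes col: "\<And>v. v \<in> R \<Longrightarrow> (xi v \<odot> Xi v)\<^sup>2 = Q v * cnj (Q v)" and w: "w \<in> R"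
  shows "wder (\<lambda>w. proj w x) w 0 0"
proof -
  have wD: "w \<in> D" and Q0: "Q w \<noteq> 0" using w by (auto simp: R_def)
  define n where "n v = xi v \<odot> Xi v" for v
  have XiR: "Xi v = (n v / Q v) *s xi v" if "v \<in> R" for v
    using Xi_collinear[of v] col[OF that] that by (simp add: R_def n_def)
  have n0: "n v \<noteq> 0" if "v \<in> R" for v
    using col[OF that] that by (auto simp: n_def R_def)
  have xiR: "xi v = (Q v * inverse (n v)) *s Xi v" if "v \<in> R" for v
    using n0[OF that] that by (subst XiR[OF that]) (simp add: R_def vector_smult_assoc)
  have kap: "kap w = n w / g w" by (simp add: kap_def n_def divide_inverse)
  have kap_real: "cnj (kap w) = kap w" by (simp add: kap n_def xi_Xi_real g_real)
  have dXi: "wder Xi w (- (kap w *s A w)) (vcnj (dz xi w))"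
    using wder_vcnj[OF wder_xi[OF wD]] by (simp add: Xi_def[abs_def] kap_real A_def)
  have "smooth_on R (\<lambda>v. Q v * inverse (n v))"
  proof (intro smooth_on_mult open_R smooth_on_inverse)
    have sub: "R \<subseteq> D" by (auto simp: R_def)
    show "smooth_on R Q" unfolding Q_def[abs_def]
      by (intro smooth_on_subset[OF _ sub] smooth_on_bdot open_D smooth_xi)
    show "smooth_on R n" unfolding n_def[abs_def]
      by (intro smooth_on_subset[OF _ sub] smooth_on_bdot open_D smooth_xi smooth_Xi)
  qed (rule n0)
  then obtain l1 l2 where l: "sder (\<lambda>v. Q v * inverse (n v)) w l1 l2"
    using sder_sdz[OF smooth_on_differentiable[OF _ w]] by blast
  \<comment> \<open>The z-derivative of \<open>Xi\<close> is known by conjugating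
    \<open>wder_xi\<close>. Writing \<open>xi\<close> as a scalar multiple of \<open>Xi\<close>
    therefore determines \<open>dz xi\<close> within the frame.\<close>
  have "wder xi w (l1 *s Xi w + (Q w * inverse (n w)) *s (- (kap w *s A w)))
      (l2 *s Xi w + (Q w * inverse (n w)) *s vcnj (dz xi w))"
    by (rule wder_cong_open[OF open_R w _ wder_cscale[OF l dXi]]) (simp add: xiR[symmetric])
  then have "dz xi w = l1 *s Xi w + (Q w * inverse (n w)) *s (- (kap w *s A w))" by (rule wder_imp_dz)
  moreover define lam where "lam = l1 * (n w / Q w)"
  ultimately have dx: "dz xi w = lam *s xi w - (Q w / g w) *s A w"
    using n0[OF w] by (simp add: XiR[OF w] kap vector_smult_assoc field_simps)
  have dxi: "wder xi w (lam *s xi w - (Q w / g w) *s A w) (- ((n w / g w) *s a w))"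
    using wder_xi[OF wD] by (simp add: dx kap)
  have dQ: "sder Q w (2 * lam * Q w) 0"
    using sder_Q[OF wD] by (simp add: dx frame_xi wD Q_def[symmetric] mult.assoc)
  have da: "wder a w (xi w + mu w *s a w) (- (g w *s ph w))"
    using wder_a[OF wD] by (simp add: b_xi[of w])
  have dA: "wder A w (- (g w *s ph w)) ((n w / Q w) *s xi w + cnj (mu w) *s A w)"
    using wder_A[OF wD] by (simp add: vcnj_b XiR[OF w])
  note c = wder_const[of x w]
  have ig: "sder (\<lambda>v. inverse (g v)) w (- (mu w * inverse (g w))) (- (cnj (mu w) * inverse (g w)))"
    by (rule sder_eqI[OF sder_inverse[OF sder_g[OF wD] g_nz[OF wD]]])
      (use g_nz[OF wD] in \<open>simp_all add: power2_eq_square field_simps\<close>)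
  have iQ: "sder (\<lambda>v. inverse (Q v)) w (- (2 * lam * inverse (Q w))) 0"
    by (rule sder_eqI[OF sder_inverse[OF dQ Q0]]) (use Q0 in \<open>simp_all add: power2_eq_square field_simps\<close>)
  have inv: "g w * (inverse (g w) * t) = t" "Q w * (inverse (Q w) * t) = t" for t
    using g_nz[OF wD] Q0 by simp_all
  note d = wder_add[OF wder_add[OF wder_cscale[OF sder_bdot[OF wder_ph[OF wD] c] wder_ph[OF wD]]
      wder_cscale[OF ig wder_add[OF wder_cscale[OF sder_bdot[OF da c] dA] wder_cscale[OF sder_bdot[OF dA c] da]]]]
      wder_cscale[OF iQ wder_cscale[OF sder_bdot[OF dxi c] dxi]]]
  show ?thesis
    unfolding proj_def
    by (rule wder_eqI[OF d])
      (simp_all add: vec_eq_iff algebra_simps inv divide_inverse)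
qed

lemma proj_ph: "w \<in> D \<Longrightarrow> proj w (ph w) = ph w"
  by (simp add: proj_def frame_xi ph_unit)

lemma proj_sym: "proj w x \<odot> y = x \<odot> proj w y"
  by (simp add: proj_def bdot_commute[of x] algebra_simps)

lemma proj_constant:
  assumes col: "\<And>v. v \<in> R \<Longrightarrow> (xi v \<odot> Xi v)\<^sup>2 = Q v * cnj (Q v)"
    and C: "open C" "connected C" "C \<subseteq> R" "v \<in> C" "w \<in> C"
  shows "proj v x = proj w x"
proof -
  have d: "((\<lambda>w. proj w x) has_derivative (\<lambda>_. 0)) (at u within C)" if "u \<in> C" for u
  proof -
    have "u \<in> R" using that C(3) by (rule subsetD[rotated])
    with col have "wder (\<lambda>w. proj w x) u 0 0" by (rule wder_proj)
    then have "((\<lambda>w. proj w x) has_derivative (\<lambda>_. 0)) (at u)"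
      unfolding wder_def vector_smult_rzero add_0_right .
    then show ?thesis by (rule has_derivative_at_withinI)
  qed
  then have "continuous_on C (\<lambda>w. proj w x)"
    by (meson continuous_on_eq_continuous_within has_derivative_continuous)
  then have "(\<lambda>w. proj w x) constant_on C"
    using d by (intro has_derivative_zero_connected_constant_on[OF C(2,1) finite.emptyI]) simp_all
  then show ?thesis using C(4,5) unfolding constant_on_def by auto
qed

text \<open>\<open>proj\<close> is symmetric and fixes \<open>ph\<close>, so a vector killed by the
  constant projection is orthogonal to \<open>ph\<close> at every point of the connected
  set.\<close>

lemma ph_orth_propagates:
  assumes col: "\<And>v. v \<in> R \<Longrightarrow> (xi v \<odot> Xi v)\<^sup>2 = Q v * cnj (Q v)"
    and C: "open C" "connected C" "C \<subseteq> R" "v \<in> C" "w \<in> C" and n: "proj v n = 0"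
  shows "ph w \<odot> n = 0"
proof -
  have "w \<in> D" using C by (auto simp: R_def)
  have "ph w \<odot> n = proj w (ph w) \<odot> n" by (simp add: proj_ph[OF \<open>w \<in> D\<close>])
  also have "\<dots> = ph w \<odot> proj w n" by (rule proj_sym)
  also have "proj w n = 0" using proj_constant[OF col C, of n] n by simp
  finally show ?thesis by simp
qed

lemma proj_eq_0:
  assumes O: "open O'" "O' \<subseteq> D" "w \<in> O'" and n: "\<And>v. v \<in> O' \<Longrightarrow> ph v \<odot> n = 0"
  shows "proj w n = 0"
proof -
  have D: "v \<in> D" if "v \<in> O'" for v using that O by blast
  have 1: "a v \<odot> n = 0" "A v \<odot> n = 0" if "v \<in> O'" for v
    using sder_zero_on[OF O(1) that n sder_bdot[OF wder_ph[OF D[OF that]] wder_const[of n]]] by simp_all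
  have "b w \<odot> n = 0"
    using sder_zero_on(1)[OF O(1,3) 1(1) sder_bdot[OF wder_a[OF D[OF O(3)]] wder_const[of n]]] by simp
  then show ?thesis
    using 1[OF O(3)] n[OF O(3)] by (simp add: proj_def xi_def)
qed

end

section \<open>From real maps to their complexifications\<close>

lemma dz_cvec:
  assumes "f differentiable (at w)"
  shows "dz (\<lambda>w. cvec (f w)) w = (1/2) *s (cvec (pd 1 f w) - \<i> *s cvec (pd \<i> f w))"
    "wder (\<lambda>w. cvec (f w)) w (dz (\<lambda>w. cvec (f w)) w) (vcnj (dz (\<lambda>w. cvec (f w)) w))"
proof -
  note p = pd_bounded_linear[OF bounded_linear_cvec assms]
  show 1: "dz (\<lambda>w. cvec (f w)) w = (1/2) *s (cvec (pd 1 f w) - \<i> *s cvec (pd \<i> f w))"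
    by (simp add: dz_def p)
  have "dzb (\<lambda>w. cvec (f w)) w = (1/2) *s (cvec (pd 1 f w) + \<i> *s cvec (pd \<i> f w))"
    by (simp add: dzb_def p)
  then have "dzb (\<lambda>w. cvec (f w)) w = vcnj (dz (\<lambda>w. cvec (f w)) w)"
    unfolding 1 by simp
  moreover have "(\<lambda>w. cvec (f w)) differentiable (at w)"
    using bounded_linear.has_derivative[OF bounded_linear_cvec pd_has_derivative[OF assms]]
    by (auto simp: differentiable_def)
  ultimately show "wder (\<lambda>w. cvec (f w)) w (dz (\<lambda>w. cvec (f w)) w) (vcnj (dz (\<lambda>w. cvec (f w)) w))"
    using wder_dz by metis
qed

lemma pd_pd_cvec:
  assumes D: "open D" "w \<in> D" and f: "smooth_on D f" and sa: "smooth_on D (pd a f)"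
  shows "pd c (pd a (\<lambda>w. cvec (f w))) w = cvec (pd c (pd a f) w)"
proof -
  have "pd c (pd a (\<lambda>w. cvec (f w))) w = pd c (\<lambda>w. cvec (pd a f w)) w"
  proof (rule pd_transform(2)[OF D])
    show "cvec (pd a f v) = pd a (\<lambda>w. cvec (f w)) v" if "v \<in> D" for v
      by (rule pd_bounded_linear[OF bounded_linear_cvec smooth_on_differentiable[OF f that], symmetric])
    show "(\<lambda>w. cvec (pd a f w)) differentiable at w"
      by (rule smooth_on_differentiable[OF smooth_on_cvec[OF D(1) sa] D(2)])
  qed
  also have "\<dots> = cvec (pd c (pd a f) w)"
    by (rule pd_bounded_linear[OF bounded_linear_cvec smooth_on_differentiable[OF sa D(2)]])
  finally show ?thesis .
qed

section \<open>Charts of a Riemann surface\<close>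

locale rsurface =
  fixes X :: "'a topology" and \<A> :: "'a atlas"
  assumes rs: "riemann_surface X \<A>"
begin

lemma cover: "p \<in> topspace X \<Longrightarrow> \<exists>U z. (U, z) \<in> \<A> \<and> p \<in> U"
  using rs unfolding riemann_surface_def by blast

lemma ex_point: obtains p where "p \<in> topspace X"
  using rs unfolding riemann_surface_def by blast

context
  fixes U z assumes Uz: "(U, z) \<in> \<A>"
begin

lemma chart_openin: "openin X U" and chart_open_image: "open (z ` U)"
  and chart_homeo: "homeomorphic_map (subtopology X U) (top_of_set (z ` U)) z"
  using rs Uz unfolding riemann_surface_def by blast+

lemma chart_subset: "U \<subseteq> topspace X"
  using chart_openin openin_subset by blast

lemma chart_inj: "inj_on z U"
proof -
  have "inj_on z (topspace (subtopology X U))"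
    using chart_homeo homeomorphic_imp_injective_map by blast
  then show ?thesis using chart_subset by (simp add: Int_absorb1)
qed

lemma chart_inv [simp]: "p \<in> U \<Longrightarrow> inv_into U z (z p) = p"
  by (rule inv_into_f_f[OF chart_inj])

lemma in_chart_at [simp]: "p \<in> U \<Longrightarrow> in_chart U z f (z p) = f p"
  by (simp add: in_chart_def)

lemma chart_preimage_open:
  assumes "open V"
  shows "openin X {p \<in> U. z p \<in> V}"
proof -
  have t: "topspace (subtopology X U) = U" using chart_subset by auto
  have "continuous_map (subtopology X U) (top_of_set (z ` U)) z"
    using chart_homeo homeomorphic_imp_continuous_map by blast
  moreover have "openin (top_of_set (z ` U)) (z ` U \<inter> V)"
    using assms by (auto simp: openin_open)
  ultimately have "openin (subtopology X U) {p \<in> U. z p \<in> z ` U \<inter> V}"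
    using openin_continuous_map_preimage t by fastforce
  moreover have "{p \<in> U. z p \<in> z ` U \<inter> V} = {p \<in> U. z p \<in> V}" by auto
  ultimately show ?thesis
    using openin_trans_full[OF _ chart_openin] by simp
qed

lemma chart_image_open:
  assumes "openin X O'"
  shows "open (z ` (O' \<inter> U))"
proof -
  have "open_map (subtopology X U) (top_of_set (z ` U)) z"
    using chart_homeo homeomorphic_imp_open_map by blast
  moreover have "openin (subtopology X U) (O' \<inter> U)"
    using assms by (auto simp: openin_subtopology)
  ultimately have "openin (top_of_set (z ` U)) (z ` (O' \<inter> U))"
    unfolding open_map_def by blast
  then show ?thesis using chart_open_image openin_open_trans by blast
qed

definition disc where "disc p r = {q \<in> U. z q \<in> ball (z p) r}"

lemma openin_disc: "openin X (disc p r)"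
  unfolding disc_def by (rule chart_preimage_open) simp

lemma disc_center: "p \<in> U \<Longrightarrow> r > 0 \<Longrightarrow> p \<in> disc p r"
  by (simp add: disc_def)

end

lemma transition_holomorphic:
  "(U, z) \<in> \<A> \<Longrightarrow> (V, y) \<in> \<A> \<Longrightarrow> (y \<circ> inv_into U z) holomorphic_on z ` (U \<inter> V)"
  using rs unfolding riemann_surface_def by blast

lemma open_overlap: "(U, z) \<in> \<A> \<Longrightarrow> (V, y) \<in> \<A> \<Longrightarrow> open (z ` (U \<inter> V))"
  using chart_image_open[of U z V] chart_openin[of V y] by (simp add: Int_commute)

lemma transition_deriv:
  assumes U: "(U, z) \<in> \<A>" and V: "(V, y) \<in> \<A>" and p: "p \<in> U" "p \<in> V"
  shows "((y \<circ> inv_into U z) has_field_derivative deriv (y \<circ> inv_into U z) (z p)) (at (z p))"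
    "deriv (y \<circ> inv_into U z) (z p) \<noteq> 0"
proof -
  let ?t = "y \<circ> inv_into U z" and ?s = "z \<circ> inv_into V y"
  have zp: "z p \<in> z ` (U \<inter> V)" and yp: "y p \<in> y ` (V \<inter> U)" using p by auto
  show t: "(?t has_field_derivative deriv ?t (z p)) (at (z p))"
    by (rule holomorphic_derivI[OF transition_holomorphic[OF U V] open_overlap[OF U V] zp])
  have s: "(?s has_field_derivative deriv ?s (y p)) (at (y p))"
    by (rule holomorphic_derivI[OF transition_holomorphic[OF V U] open_overlap[OF V U] yp])
  have tz: "?t (z p) = y p" using p chart_inv[OF U] by simp
  have "((\<lambda>w. ?s (?t w)) has_field_derivative deriv ?s (y p) * deriv ?t (z p)) (at (z p))"
    by (rule DERIV_chain2[OF _ t]) (use s tz in \<open>simp add: comp_def\<close>)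
  moreover have "((\<lambda>w. ?s (?t w)) has_field_derivative 1) (at (z p))"
    by (rule has_field_derivative_transform_within_open[OF DERIV_ident open_overlap[OF U V] zp])
      (use chart_inv[OF U] chart_inv[OF V] in auto)
  ultimately have "deriv ?s (y p) * deriv ?t (z p) = 1" by (rule DERIV_unique)
  then show "deriv ?t (z p) \<noteq> 0" by auto
qed

text \<open>The local alternative makes both \<open>S\<close> and its complement open. It turns
  arguments on single chart discs into global statements.\<close>

lemma connected_dichotomy:
  assumes S: "S \<subseteq> topspace X"
    and loc: "\<And>p. p \<in> topspace X \<Longrightarrow> \<exists>O'. openin X O' \<and> p \<in> O' \<and> (O' \<subseteq> S \<or> O' \<inter> S = {})"
  shows "S = {} \<or> S = topspace X"
proof -
  have "openin X S"
    using loc S by (subst openin_subopen) (metis disjoint_iff subsetD)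
  moreover have "openin X (topspace X - S)"
  proof (subst openin_subopen, safe)
    fix p assume p: "p \<in> topspace X" "p \<notin> S"
    then obtain O' where O': "openin X O'" "p \<in> O'" "O' \<subseteq> S \<or> O' \<inter> S = {}" using loc by blast
    then have "O' \<subseteq> topspace X - S" using p openin_subset by blast
    then show "\<exists>T. openin X T \<and> p \<in> T \<and> T \<subseteq> topspace X - S" using O' by blast
  qed
  then have "closedin X S" using S by (simp add: closedin_def)
  moreover have "connected_space X" using rs by (simp add: riemann_surface_def)
  ultimately show ?thesis unfolding connected_space_clopen_in by blast
qed

end

section \<open>Conformal harmonic immersions of a Riemann surface\<close>

locale minimal_surface = rsurface X \<A> for X :: "'a topology" and \<A> +
  fixes \<phi> :: "'a \<Rightarrow> real^7"
  assumes conf: "conformal_immersion \<A> \<phi>" and harm: "harmonic_into_sphere X \<A> \<phi>"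
begin

definition rph where "rph U z = in_chart U z \<phi>"
definition cph where "cph U z = (\<lambda>w. cvec (in_chart U z \<phi> w))"

lemma unit: "p \<in> topspace X \<Longrightarrow> \<phi> p \<bullet> \<phi> p = 1"
  using harm unfolding harmonic_into_sphere_def by (auto simp: dot_square_norm)

lemma smooth_rph: "(U, z) \<in> \<A> \<Longrightarrow> smooth_on (z ` U) (rph U z)"
  using conf unfolding conformal_immersion_def smooth_map_def rph_def by blast

lemma rph_conformal:
  assumes "(U, z) \<in> \<A>" "w \<in> z ` U"
  shows "pd 1 (rph U z) w \<noteq> 0" "pd 1 (rph U z) w \<bullet> pd 1 (rph U z) w = pd \<i> (rph U z) w \<bullet> pd \<i> (rph U z) w"
    "pd 1 (rph U z) w \<bullet> pd \<i> (rph U z) w = 0"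
  using conf assms unfolding conformal_immersion_def rph_def Let_def by blast+

lemma rph_harmonic:
  assumes "(U, z) \<in> \<A>" "w \<in> z ` U"
  shows "\<exists>c. pd 1 (pd 1 (rph U z)) w + pd \<i> (pd \<i> (rph U z)) w = c *\<^sub>R rph U z w"
  using harm assms unfolding harmonic_into_sphere_def rph_def Let_def by force

lemma chart: assumes U: "(U, z) \<in> \<A>" shows "minimal_chart (z ` U) (cph U z)"
proof
  have cr: "cph U z = (\<lambda>w. cvec (rph U z w))" by (simp add: cph_def rph_def)
  note s = smooth_rph[OF U]
  show o: "open (z ` U)" by (rule chart_open_image[OF U])
  show sm: "smooth_on (z ` U) (cph U z)" unfolding cr by (rule smooth_on_cvec[OF o s])
  have unit': "rph U z w \<bullet> rph U z w = 1" if "w \<in> z ` U" for w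
    using that unit chart_subset[OF U] by (auto simp: rph_def in_chart_at[OF U])
  then show u: "cph U z w \<odot> cph U z w = 1" if "w \<in> z ` U" for w
    using that by (simp add: cr)
  fix w assume w: "w \<in> z ` U"
  show "vcnj (cph U z w) = cph U z w" by (simp add: cr)
  note dd = smooth_on_differentiable[OF s]
  have dzw: "dz (cph U z) v = (1/2) *s (cvec (pd 1 (rph U z) v) - \<i> *s cvec (pd \<i> (rph U z) v))"
    "wder (cph U z) v (dz (cph U z) v) (vcnj (dz (cph U z) v))" if "v \<in> z ` U" for v
    using dz_cvec[OF dd[OF that]] by (simp_all add: cr)
  note rc = rph_conformal[OF U w]
  show "dz (cph U z) w \<odot> dz (cph U z) w = 0"
    using rc(2,3) by (simp add: dzw(1)[OF w] inner_commute)
  show "dz (cph U z) w \<noteq> 0"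
  proof
    assume "dz (cph U z) w = 0"
    then have "dz (cph U z) w + vcnj (dz (cph U z) w) = 0" by simp
    moreover have "dz (cph U z) w + vcnj (dz (cph U z) w) = cvec (pd 1 (rph U z) w)"
      unfolding dzw(1)[OF w] by (simp add: vec_eq_iff algebra_simps)
    ultimately have "cvec (pd 1 (rph U z) w) = 0" by simp
    then show False using rc(1) by simp
  qed
  obtain c where c: "pd 1 (pd 1 (rph U z)) w + pd \<i> (pd \<i> (rph U z)) w = c *\<^sub>R rph U z w"
    using rph_harmonic[OF U w] by blast
  have "dzb (dz (cph U z)) w = (1/4) *s (pd 1 (pd 1 (cph U z)) w + pd \<i> (pd \<i> (cph U z)) w)"
    using dz_dzb(1,2)[OF o w sm] by simp
  also have "pd 1 (pd 1 (cph U z)) w + pd \<i> (pd \<i> (cph U z)) w = cvec (c *\<^sub>R rph U z w)"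
    unfolding c[symmetric] cr using pd_pd_cvec[OF o w s] smooth_on_pd[OF s] by simp
  finally have L: "dzb (dz (cph U z)) w = (of_real c / 4) *s cph U z w"
    by (simp add: cr vector_smult_assoc)
  \<comment> \<open>Harmonicity only says that the Laplacian is some multiple of the position
    vector; differentiating this orthogonality in the conjugate variable identifies the
    factor.\<close>
  have 0: "cph U z v \<odot> dz (cph U z) v = 0" if v: "v \<in> z ` U" for v
  proof -
    have "sder (\<lambda>w. cph U z w \<odot> cph U z w) v 0 0"
      by (rule sder_cong_open[OF o v _ sder_const[of 1]]) (simp add: u)
    from sder_unique[OF this sder_bdot[OF dzw(2)[OF v] dzw(2)[OF v]]]
    show ?thesis by (simp add: bdot_commute[of "dz _ _"])
  qed
  have "wder (dz (cph U z)) w (dz (dz (cph U z)) w) (dzb (dz (cph U z)) w)"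
    by (intro wder_dz smooth_on_differentiable[OF smooth_on_dz(1)[OF o sm] w])
  from sder_zero_on(2)[OF o w 0 sder_bdot[OF dzw(2)[OF w] this]]
  have "vcnj (dz (cph U z) w) \<odot> dz (cph U z) w + of_real c / 4 = 0"
    by (simp add: L u w)
  then have "of_real c / 4 = - (dz (cph U z) w \<odot> vcnj (dz (cph U z) w))"
    by (simp add: add_eq_0_iff bdot_commute)
  then show "dzb (dz (cph U z)) w = - (dz (cph U z) w \<odot> vcnj (dz (cph U z) w)) *s cph U z w"
    using L by simp
qed

abbreviation "a' U z \<equiv> minimal_chart.a (cph U z)"
abbreviation "xi' U z \<equiv> minimal_chart.xi (cph U z)"
abbreviation "Q' U z \<equiv> minimal_chart.Q (cph U z)"

text \<open>Under a change of chart with derivative c, the second derivative acquires an extra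
  multiple of \<open>a\<close>, which is absorbed by \<open>mu\<close>. So \<open>xi\<close> scales
  by the square of c, and \<open>Q\<close> transforms as a quartic differential.\<close>

lemma transition:
  assumes U: "(U, z) \<in> \<A>" and V: "(V, y) \<in> \<A>" and p: "p \<in> U" "p \<in> V"
  shows "a' U z (z p) = deriv (y \<circ> inv_into U z) (z p) *s a' V y (y p)"
    "Q' U z (z p) = (deriv (y \<circ> inv_into U z) (z p)) ^ 4 * Q' V y (y p)"
proof -
  let ?t = "y \<circ> inv_into U z" and ?O = "z ` (U \<inter> V)"
  interpret cu: minimal_chart "z ` U" "cph U z" by (rule chart[OF U])
  interpret cv: minimal_chart "y ` V" "cph V y" by (rule chart[OF V])
  have o: "open ?O" by (rule open_overlap[OF U V])
  have tp: "?t (z q) = y q" if "q \<in> U" for q using that chart_inv[OF U] by simp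
  have td: "(?t has_field_derivative deriv ?t w) (at w)" if "w \<in> ?O" for w
    using that transition_deriv(1)[OF U V] by auto
  have tV: "?t w \<in> y ` V" if "w \<in> ?O" for w using that tp by auto
  have UO: "w \<in> z ` U" if "w \<in> ?O" for w using that by auto
  have eq: "cph V y (?t w) = cph U z w" if "w \<in> ?O" for w
    using that tp by (auto simp: cph_def in_chart_at[OF U] in_chart_at[OF V])
  have a: "cu.a w = deriv ?t w *s cv.a (?t w)" if w: "w \<in> ?O" for w
  proof -
    have "wder (cph U z) w (deriv ?t w *s cv.a (?t w)) (cnj (deriv ?t w) *s cv.A (?t w))"
      by (rule wder_cong_open[OF o w eq wder_compose_holomorphic[OF cv.wder_ph[OF tV[OF w]] td[OF w]]])
    from wder_unique[OF this cu.wder_ph[OF UO[OF w]]] show ?thesis by simp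
  qed
  show "a' U z (z p) = deriv ?t (z p) *s a' V y (y p)"
    using a[of "z p"] p tp by auto
  have w: "z p \<in> ?O" using p by auto
  let ?c = "deriv ?t (z p)"
  obtain d where d: "(deriv ?t has_field_derivative d) (at (z p))"
    using holomorphic_derivI[OF holomorphic_deriv[OF transition_holomorphic[OF U V] o] o w] by blast
  have "wder cu.a (z p) (d *s cv.a (y p) + ?c *s (?c *s cv.b (y p)))
      (0 *s cv.a (y p) + ?c *s (cnj ?c *s (- (cv.g (y p) *s cph V y (y p)))))"
    using wder_cong_open[OF o w a[symmetric] wder_cscale[OF sder_holomorphic[OF d]
      wder_compose_holomorphic[OF cv.wder_a[OF tV[OF w]] td[OF w]]]] tp[OF p(1)] by simp
  from wder_unique[OF this cu.wder_a[OF UO[OF w]]]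
  have b: "cu.b (z p) = d *s cv.a (y p) + ?c\<^sup>2 *s cv.b (y p)"
    by (simp add: vector_smult_assoc power2_eq_square)
  have aw: "cu.a (z p) = ?c *s cv.a (y p)" using a[OF w] tp[OF p(1)] by simp
  have c0: "?c \<noteq> 0" by (rule transition_deriv(2)[OF U V p])
  have yp: "y p \<in> y ` V" using p by auto
  have "cu.mu (z p) = d / ?c + ?c * cv.mu (y p)"
    using c0 cv.g_nz[OF yp] cv.b_A[OF yp]
    unfolding cu.mu_def cu.g_def cu.A_def b aw
    by (simp add: cv.A_def[symmetric] cv.g_def[symmetric] field_simps power2_eq_square)
  then have "cu.xi (z p) = ?c\<^sup>2 *s cv.xi (y p)"
    unfolding cu.xi_def b aw cv.xi_def using c0
    by (simp add: vec_eq_iff field_simps power2_eq_square)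
  then show "Q' U z (z p) = ?c ^ 4 * Q' V y (y p)"
    by (simp add: cu.Q_def cv.Q_def power2_eq_square power4_eq_xxxx)
qed

end

section \<open>The primitive of \<open>\<phi> \<times> *d\<phi>\<close>\<close>

lemma orth_proj_plane:
  fixes u v x :: "'b::euclidean_space"
  assumes "u \<bullet> u = E" "v \<bullet> v = E" "u \<bullet> v = 0" "E \<noteq> 0"
  shows "orth_proj (span {u, v}) x = ((x \<bullet> u) / E) *\<^sub>R u + ((x \<bullet> v) / E) *\<^sub>R v"
  unfolding orth_proj_def
proof (rule the_equality)
  let ?p = "((x \<bullet> u) / E) *\<^sub>R u + ((x \<bullet> v) / E) *\<^sub>R v"
  have in_span: "?p \<in> span {u, v}"
    by (intro span_add span_scale) (auto intro: span_base)
  have orth: "orthogonal (x - ?p) s" if "s \<in> span {u, v}" for s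
    using that
  proof (rule orthogonal_to_span)
    show "orthogonal (x - ?p) y" if "y \<in> {u, v}" for y
      using that assms by (auto simp: orthogonal_def inner_diff_left inner_add_left inner_commute[of v u])
  qed
  show "?p \<in> span {u, v} \<and> (\<forall>s\<in>span {u, v}. orthogonal (x - ?p) s)"
    using in_span orth by blast
  fix q assume q: "q \<in> span {u, v} \<and> (\<forall>s\<in>span {u, v}. orthogonal (x - q) s)"
  have "q - ?p \<in> span {u, v}" using q in_span span_diff by blast
  then have "orthogonal (x - q) (q - ?p)" "orthogonal (x - ?p) (q - ?p)" using q orth by blast+
  then have "(q - ?p) \<bullet> (q - ?p) = 0"
    by (simp add: orthogonal_def inner_diff_left)
  then show "q = ?p" by simp
qed

definition rvec :: "complex^'n \<Rightarrow> real^'n" where "rvec x = (\<chi> i. Re (x $ i))"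

lemma rvec_cvec [simp]: "rvec (cvec x) = x"
  by (simp add: rvec_def cvec_def vec_eq_iff)

lemma bounded_linear_rvec: "bounded_linear (rvec :: complex^'n \<Rightarrow> _)"
  by (intro linear_conv_bounded_linear[THEN iffD1] linearI) (simp_all add: rvec_def vec_eq_iff)

lemma cvec_combination_eq_0: "cvec x - \<i> *s cvec y = 0 \<longleftrightarrow> x = 0 \<and> y = 0"
  by (auto simp: vec_eq_iff cvec_def complex_eq_iff)

lemma i_cancel: "(4 * \<i>) * ((- \<i> * r) * x) = 4 * r * x" "(- \<i> * r) * ((4 * \<i>) * x) = 4 * r * x"
  by (simp_all add: algebra_simps)

locale primitive_chart = minimal_chart +
  fixes f :: "complex \<Rightarrow> real^7"
  assumes smooth_f: "smooth_on D f"
    and dz_f: "w \<in> D \<Longrightarrow> dz (\<lambda>w. cvec (f w)) w = \<i> *s (ph w \<otimes> a w)"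
begin

abbreviation cf where "cf \<equiv> \<lambda>w. cvec (f w)"

lemma smooth_cf: "smooth_on D cf"
  by (rule smooth_on_cvec[OF open_D smooth_f])

lemma ph_ph_dot: "w \<in> D \<Longrightarrow> (ph w \<otimes> x) \<odot> (ph w \<otimes> y) = x \<odot> y - (ph w \<odot> x) * (ph w \<odot> y)"
proof -
  assume w: "w \<in> D"
  have "(ph w \<otimes> x) \<odot> (ph w \<otimes> y) = - (x \<odot> (ph w \<otimes> (ph w \<otimes> y)))"
    using triple_skew[of x "ph w" "ph w \<otimes> y"] by simp
  then show ?thesis
    by (simp add: ccross_ph_ph[OF w] bdot_commute[of x "ph w"])
qed

lemma pd_f:
  assumes w: "w \<in> D"
  shows "cvec (pd 1 f w) = \<i> *s (ph w \<otimes> a w) - \<i> *s (ph w \<otimes> A w)"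
    "cvec (pd \<i> f w) = - (ph w \<otimes> a w) - (ph w \<otimes> A w)"
proof -
  have d: "dz cf w = (1/2) *s (cvec (pd 1 f w) - \<i> *s cvec (pd \<i> f w))"
    by (rule dz_cvec(1)[OF smooth_on_differentiable[OF smooth_f w]])
  have "cvec (pd 1 f w) = dz cf w + vcnj (dz cf w)" "cvec (pd \<i> f w) = \<i> *s (dz cf w - vcnj (dz cf w))"
    unfolding d by (simp_all add: vec_eq_iff algebra_simps)
  then show "cvec (pd 1 f w) = \<i> *s (ph w \<otimes> a w) - \<i> *s (ph w \<otimes> A w)"
    "cvec (pd \<i> f w) = - (ph w \<otimes> a w) - (ph w \<otimes> A w)"
    unfolding dz_f[OF w] by (simp_all add: ph_real w A_def vec_eq_iff algebra_simps)
qed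

definition E where "E w = pd 1 f w \<bullet> pd 1 f w"

lemma f_conformal:
  assumes w: "w \<in> D"
  shows "of_real (E w) = 2 * g w" "pd \<i> f w \<bullet> pd \<i> f w = E w" "pd 1 f w \<bullet> pd \<i> f w = 0" "E w \<noteq> 0"
proof -
  note s = ph_ph_dot[OF w] frame_xi[OF w] aa[OF w] AA[OF w] ph_orth[OF w]
  show 1: "of_real (E w) = 2 * g w"
    unfolding E_def bdot_cvec[symmetric] pd_f[OF w] by (simp add: s)
  have "of_real (pd \<i> f w \<bullet> pd \<i> f w) = 2 * g w"
    unfolding bdot_cvec[symmetric] pd_f[OF w] by (simp add: s)
  then show "pd \<i> f w \<bullet> pd \<i> f w = E w" using 1 of_real_eq_iff by metis
  have "complex_of_real (pd 1 f w \<bullet> pd \<i> f w) = 0"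
    unfolding bdot_cvec[symmetric] pd_f[OF w] by (simp add: s)
  then show "pd 1 f w \<bullet> pd \<i> f w = 0" by simp
  show "E w \<noteq> 0" using 1 g_nz[OF w] by auto
qed

lemma pd_pd_f:
  assumes w: "w \<in> D"
  shows "cvec (pd 1 (pd 1 f) w + pd \<i> (pd \<i> f) w) = (- 4 * \<i>) *s H w"
    "cvec (pd 1 (pd 1 f) w - pd \<i> (pd \<i> f) w) - (2 * \<i>) *s cvec (pd \<i> (pd 1 f) w) = (4 * \<i>) *s (ph w \<otimes> b w)"
proof -
  have pp: "A w \<otimes> a w = - H w" unfolding H_def by (rule ccross_antisym)
  have "wder (dz cf) w (\<i> *s (ph w \<otimes> b w)) ((- \<i>) *s H w)"
    by (rule wder_cong_open[OF open_D w dz_f[symmetric]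
          wder_eqI[OF wder_cscale[OF sder_const wder_ccross[OF wder_ph[OF w] wder_a[OF w]]]]])
      (simp_all add: pp)
  then have 1: "dz (dz cf) w = \<i> *s (ph w \<otimes> b w)" "dzb (dz cf) w = (- \<i>) *s H w"
    using wder_imp_dz by metis+
  note c = pd_pd_cvec[OF open_D w smooth_f smooth_on_pd(1)[OF smooth_f]]
    pd_pd_cvec[OF open_D w smooth_f smooth_on_pd(2)[OF smooth_f]]
  note d = dz_dzb[OF open_D w smooth_cf, unfolded c]
  show "cvec (pd 1 (pd 1 f) w + pd \<i> (pd \<i> f) w) = (- 4 * \<i>) *s H w"
    using 1(2) unfolding d(2) d(1) by (simp add: vec_eq_iff field_simps)
  show "cvec (pd 1 (pd 1 f) w - pd \<i> (pd \<i> f) w) - (2 * \<i>) *s cvec (pd \<i> (pd 1 f) w) = (4 * \<i>) *s (ph w \<otimes> b w)"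
    using 1(1) unfolding d(3) by (simp add: vec_eq_iff field_simps)
qed

lemma normal_part_eq:
  assumes w: "w \<in> D"
  shows "normal_part f w v = v - ((v \<bullet> pd 1 f w) / E w) *\<^sub>R pd 1 f w - ((v \<bullet> pd \<i> f w) / E w) *\<^sub>R pd \<i> f w"
  unfolding normal_part_def
  by (subst orth_proj_plane[of "pd 1 f w" "E w" "pd \<i> f w"]) (use f_conformal[OF w] in \<open>simp_all add: E_def\<close>)

lemma mean_curvature_eq:
  assumes w: "w \<in> D"
  shows "mean_curvature f w = (1 / (2 * E w)) *\<^sub>R (pd 1 (pd 1 f) w + pd \<i> (pd \<i> f) w)"
    "cvec (mean_curvature f w) = (- \<i> * inverse (g w)) *s H w"
proof -
  let ?x = "pd 1 (pd 1 f) w" and ?y = "pd \<i> (pd \<i> f) w"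
  note fc = f_conformal[OF w]
  have "complex_of_real ((?x + ?y) \<bullet> pd 1 f w) = 0" "complex_of_real ((?x + ?y) \<bullet> pd \<i> f w) = 0"
    unfolding bdot_cvec[symmetric] pd_pd_f(1)[OF w] pd_f[OF w]
    using cross_orth(2,7)[OF w] by (simp_all add: bdot_commute[of "H w"])
  then have "(?x + ?y) \<bullet> pd 1 f w = 0" "(?x + ?y) \<bullet> pd \<i> f w = 0"
    unfolding of_real_eq_0_iff .
  then have 0: "?x \<bullet> pd 1 f w = - (?y \<bullet> pd 1 f w)" "?x \<bullet> pd \<i> f w = - (?y \<bullet> pd \<i> f w)"
    by (simp_all add: inner_add_left eq_neg_iff_add_eq_0)
  have "normal_part f w ?x + normal_part f w ?y = ?x + ?y"
    by (simp add: normal_part_eq[OF w] 0)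
  then have *: "E w *\<^sub>R normal_part f w ?x + E w *\<^sub>R normal_part f w ?y = E w *\<^sub>R (?x + ?y)"
    by (simp only: scaleR_right_distrib[symmetric])
  show 1: "mean_curvature f w = (1 / (2 * E w)) *\<^sub>R (?x + ?y)"
    using fc by (simp add: mean_curvature_def fff_def sff_def E_def[symmetric] * inner_commute[of "pd \<i> f w" "pd 1 f w"])
  show "cvec (mean_curvature f w) = (- \<i> * inverse (g w)) *s H w"
    unfolding 1 cvec_simps(4) pd_pd_f(1)[OF w] using fc(1) g_nz[OF w]
    by (simp add: vector_smult_assoc field_simps)
qed

abbreviation "h \<equiv> mean_curvature f"

lemma H_H: "w \<in> D \<Longrightarrow> H w \<odot> H w = - (g w)\<^sup>2"
proof -
  assume w: "w \<in> D"
  have "H w \<odot> H w = - ((a w \<otimes> A w) \<odot> (A w \<otimes> a w))"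
    unfolding H_def using ccross_antisym[of "a w" "A w"] by simp
  also have "\<dots> = (a w \<otimes> A w) \<odot> (a w \<otimes> A w)"
    using ccross_antisym[of "a w" "A w"] by simp
  finally show ?thesis
    by (simp add: bdot_ccross_ccross_same frame_xi w aa AA power2_eq_square)
qed

text \<open>Since \<open>H w \<odot> H w = - (g w)\<^sup>2\<close>, the factor
  \<open>- \<i> * inverse (g w)\<close> normalizes \<open>H\<close> to a real unit vector.\<close>

lemma h_props:
  assumes w: "w \<in> D"
  shows "h w \<bullet> h w = 1" "h w \<bullet> pd 1 f w = 0" "h w \<bullet> pd \<i> f w = 0"
proof -
  have "complex_of_real (h w \<bullet> h w) = 1"
    unfolding bdot_cvec[symmetric] mean_curvature_eq(2)[OF w] using g_nz[OF w]
    by (simp add: H_H w power2_eq_square field_simps)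
  then show "h w \<bullet> h w = 1" by simp
  have "complex_of_real (h w \<bullet> pd 1 f w) = 0" "complex_of_real (h w \<bullet> pd \<i> f w) = 0"
    unfolding bdot_cvec[symmetric] mean_curvature_eq(2)[OF w] pd_f[OF w]
    using cross_orth(2,7)[OF w] by (simp_all add: bdot_commute[of "H w"])
  then show "h w \<bullet> pd 1 f w = 0" "h w \<bullet> pd \<i> f w = 0" by simp_all
qed

lemma normal_part_h: "w \<in> D \<Longrightarrow> normal_part f w v \<bullet> h w = v \<bullet> h w"
  using h_props[of w] by (simp add: normal_part_eq inner_diff_left inner_commute[of "pd 1 f w"] inner_commute[of "pd \<i> f w"])

text \<open>The left side is four times the pairing of the second z-derivative of \<open>f\<close>
  with the mean curvature vector, so it vanishes exactly when the shape form in that direction has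
  no trace-free part.\<close>

lemma umbilic_identity:
  assumes w: "w \<in> D"
  shows "complex_of_real ((pd 1 (pd 1 f) w - pd \<i> (pd \<i> f) w) \<bullet> h w)
      - 2 * \<i> * of_real (pd \<i> (pd 1 f) w \<bullet> h w) = 4 * inverse (g w) * ((ph w \<otimes> xi w) \<odot> H w)"
proof -
  have "complex_of_real ((pd 1 (pd 1 f) w - pd \<i> (pd \<i> f) w) \<bullet> h w)
      - 2 * \<i> * of_real (pd \<i> (pd 1 f) w \<bullet> h w)
    = (cvec (pd 1 (pd 1 f) w - pd \<i> (pd \<i> f) w) - (2 * \<i>) *s cvec (pd \<i> (pd 1 f) w)) \<odot> cvec (h w)"
    by (simp only: bdot_simps bdot_cvec)
  also have "\<dots> = 4 * inverse (g w) * ((ph w \<otimes> b w) \<odot> H w)"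
    unfolding pd_pd_f(2)[OF w] mean_curvature_eq(2)[OF w] bdot_simps(7,8)
    by (rule i_cancel)
  also have "(ph w \<otimes> b w) \<odot> H w = (ph w \<otimes> xi w) \<odot> H w"
    using cross_orth(2)[OF w] by (simp add: b_xi)
  finally show ?thesis .
qed

lemma umbilic_point_imp:
  assumes w: "w \<in> D" and u: "\<And>c d. sff f w c d \<bullet> h w = l * fff f w c d"
  shows "(ph w \<otimes> xi w) \<odot> H w = 0"
proof -
  have s: "pd c (pd d f) w \<bullet> h w = l * (pd c f w \<bullet> pd d f w)" for c d
    using u[of c d] normal_part_h[OF w] by (simp add: sff_def fff_def)
  have "complex_of_real ((pd 1 (pd 1 f) w - pd \<i> (pd \<i> f) w) \<bullet> h w)
      - 2 * \<i> * of_real (pd \<i> (pd 1 f) w \<bullet> h w) = 0"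
    using f_conformal[OF w] by (simp add: inner_diff_left s E_def inner_commute[of "pd \<i> f w" "pd 1 f w"])
  then show ?thesis using umbilic_identity[OF w] g_nz[OF w] by simp
qed

lemma umbilic_point:
  assumes w: "w \<in> D" and P: "(ph w \<otimes> xi w) \<odot> H w = 0"
  shows "sff f w c d \<bullet> h w = fff f w c d"
proof -
  let ?x = "pd 1 (pd 1 f) w" and ?y = "pd \<i> (pd \<i> f) w" and ?m = "pd \<i> (pd 1 f) w"
  have m': "pd 1 (pd \<i> f) w = ?m" using pd_pd_commute[OF open_D w smooth_f] by simp
  have "complex_of_real ((?x - ?y) \<bullet> h w) - 2 * \<i> * of_real (?m \<bullet> h w) = 0"
    using umbilic_identity[OF w] P by simp
  then have 1: "?x \<bullet> h w = ?y \<bullet> h w" "?m \<bullet> h w = 0"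
    by (auto simp: complex_eq_iff inner_diff_left)
  \<comment> \<open>The trace of the shape form in the direction \<open>h w\<close> fixes the
    umbilic factor; as \<open>h w\<close> has length one, the factor is 1.\<close>
  have "?x + ?y = (2 * E w) *\<^sub>R h w"
    using f_conformal(4)[OF w] by (simp add: mean_curvature_eq(1)[OF w])
  then have "(?x + ?y) \<bullet> h w = 2 * E w" using h_props(1)[OF w] by simp
  then have 2: "?x \<bullet> h w = E w" "?y \<bullet> h w = E w" using 1 by (simp_all add: inner_add_left)
  have pb: "pd d f v = Re d *\<^sub>R pd 1 f v + Im d *\<^sub>R pd \<i> f v" if "v \<in> D" for d v
    by (rule pd_Re_Im[OF smooth_on_differentiable[OF smooth_f that]])
  have df: "pd 1 f differentiable at w" "pd \<i> f differentiable at w"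
    using smooth_on_differentiable[OF _ w] smooth_on_pd[OF smooth_f] by blast+
  have "pd c (pd d f) w = Re d *\<^sub>R pd c (pd 1 f) w + Im d *\<^sub>R pd c (pd \<i> f) w" for c
  proof -
    have *: "((\<lambda>v. Re d *\<^sub>R pd 1 f v + Im d *\<^sub>R pd \<i> f v) has_derivative
        (\<lambda>c. Re d *\<^sub>R pd c (pd 1 f) w + Im d *\<^sub>R pd c (pd \<i> f) w)) (at w)"
      by (intro has_derivative_add has_derivative_scaleR_right pd_has_derivative df)
    have "(pd d f has_derivative (\<lambda>c. Re d *\<^sub>R pd c (pd 1 f) w + Im d *\<^sub>R pd c (pd \<i> f) w)) (at w)"
      by (rule has_derivative_transform_within_open[OF * open_D w]) (simp add: pb[symmetric])
    then show ?thesis by (simp add: pd_eq)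
  qed
  then have "pd c (pd d f) w = Re d *\<^sub>R (Re c *\<^sub>R ?x + Im c *\<^sub>R ?m) + Im d *\<^sub>R (Re c *\<^sub>R ?m + Im c *\<^sub>R ?y)"
    using pd_Re_Im[OF df(1), of c] pd_Re_Im[OF df(2), of c] m' by simp
  then have "pd c (pd d f) w \<bullet> h w = E w * (Re c * Re d + Im c * Im d)"
    by (simp add: inner_add_left 1 2 algebra_simps)
  moreover have "fff f w c d = E w * (Re c * Re d + Im c * Im d)"
    using f_conformal[OF w] unfolding fff_def pb[OF w, of c] pb[OF w, of d]
    by (simp add: inner_add_left inner_add_right inner_commute[of "pd \<i> f w" "pd 1 f w"] E_def[symmetric] algebra_simps)
  ultimately show ?thesis using normal_part_h[OF w] by (simp add: sff_def)
qed

text \<open>In the z-derivative of the mean curvature vector the \<open>mu\<close> terms cancel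
  against the derivative of \<open>1 / g\<close>. What remains is a nonzero multiple of
  \<open>xi w \<otimes> A w\<close>, normal to \<open>f\<close> by pseudo-umbilicity, plus a
  multiple of \<open>ph w \<otimes> a w\<close>, which is tangent.\<close>

lemma parallel_point_iff:
  assumes w: "w \<in> D" and P: "(ph w \<otimes> xi w) \<odot> H w = 0"
  shows "(\<forall>c. normal_part f w (pd c h w) = 0) \<longleftrightarrow> xi w \<otimes> A w = 0"
proof -
  define N where "N x = x - ((x \<odot> cvec (pd 1 f w)) / of_real (E w)) *s cvec (pd 1 f w)
    - ((x \<odot> cvec (pd \<i> f w)) / of_real (E w)) *s cvec (pd \<i> f w)" for x
  have Nc: "N (cvec v) = cvec (normal_part f w v)" for v
    by (simp add: N_def normal_part_eq[OF w])
  have Nl: "N (x + y) = N x + N y" "N (x - y) = N x - N y" "N (c *s x) = c *s N x" for x y c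
    by (simp_all add: N_def vec_eq_iff algebra_simps add_divide_distrib diff_divide_distrib)
  let ?ch = "\<lambda>w. (- \<i> * inverse (g w)) *s H w"
  have ig: "sder (\<lambda>v. - \<i> * inverse (g v)) w (\<i> * mu w * inverse (g w)) (\<i> * cnj (mu w) * inverse (g w))"
    by (rule sder_eqI[OF sder_mult[OF sder_const sder_inverse[OF sder_g[OF w] g_nz[OF w]]]])
      (use g_nz[OF w] in \<open>simp_all add: power2_eq_square field_simps\<close>)
  have chw: "wder ?ch w ((- \<i> * inverse (g w)) *s (xi w \<otimes> A w) - \<i> *s (ph w \<otimes> a w))
      ((\<i> * cnj (mu w) * inverse (g w)) *s H w
      + (- \<i> * inverse (g w)) *s (a w \<otimes> Xi w + cnj (mu w) *s H w - g w *s (ph w \<otimes> A w)))"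
    by (rule wder_eqI[OF wder_cscale[OF ig wder_H[OF w]]])
      (use g_nz[OF w] in \<open>simp_all add: vec_eq_iff algebra_simps\<close>)
  have chd: "wder (\<lambda>w. cvec (h w)) w ((- \<i> * inverse (g w)) *s (xi w \<otimes> A w) - \<i> *s (ph w \<otimes> a w))
      ((\<i> * cnj (mu w) * inverse (g w)) *s H w
      + (- \<i> * inverse (g w)) *s (a w \<otimes> Xi w + cnj (mu w) *s H w - g w *s (ph w \<otimes> A w)))"
    by (rule wder_cong_open[where f = ?ch and g = "\<lambda>w. cvec (h w)", OF open_D w _ chw])
      (rule mean_curvature_eq(2)[symmetric])
  \<comment> \<open>The definition of \<open>h\<close> through projections does not show
    differentiability; it is inherited from the explicit formula by taking real parts.\<close>
  have "(\<lambda>v. rvec (cvec (h v))) differentiable (at w)"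
    using bounded_linear.has_derivative[OF bounded_linear_rvec pd_has_derivative[OF wder_imp_dz(3)[OF chd]]]
    by (auto simp: differentiable_def)
  then have hd: "h differentiable (at w)" by simp
  have "N ((1/2) *s (cvec (pd 1 h w) - \<i> *s cvec (pd \<i> h w))) = N (dz (\<lambda>w. cvec (h w)) w)"
    by (simp only: dz_cvec(1)[OF hd])
  also have "\<dots> = (- \<i> * inverse (g w)) *s N (xi w \<otimes> A w) - \<i> *s N (ph w \<otimes> a w)"
    unfolding wder_imp_dz(1)[OF chd] Nl ..
  also have "N (ph w \<otimes> a w) = 0"
  proof -
    have pa: "ph w \<otimes> a w = (- \<i> / 2) *s cvec (pd 1 f w) + (- 1 / 2) *s cvec (pd \<i> f w)"
      unfolding pd_f[OF w] by (simp add: vec_eq_iff algebra_simps)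
    have np: "normal_part f w (pd 1 f w) = 0" "normal_part f w (pd \<i> f w) = 0"
      using f_conformal[OF w] by (simp_all add: normal_part_eq[OF w] E_def inner_commute[of "pd \<i> f w" "pd 1 f w"])
    show ?thesis unfolding pa Nl Nc np by simp
  qed
  also have "N (xi w \<otimes> A w) = xi w \<otimes> A w"
  proof -
    note fr = frame_xi[OF w] ph_orth[OF w] aa[OF w] AA[OF w]
    have 1: "(xi w \<otimes> A w) \<odot> (ph w \<otimes> A w) = 0"
      by (simp add: bdot_ccross_ccross_same fr)
    \<comment> \<open>The swap identity converts the tangential component into the pseudo-umbilic
      expression \<open>(ph w \<otimes> xi w) \<odot> H w\<close>.\<close>
    have "(A w \<otimes> xi w) \<odot> (ph w \<otimes> a w) + (A w \<otimes> a w) \<odot> (ph w \<otimes> xi w) = 0"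
      unfolding bdot_ccross_ccross_swap by (simp add: fr)
    moreover have "A w \<otimes> a w = - H w" unfolding H_def by (rule ccross_antisym)
    moreover have "A w \<otimes> xi w = - (xi w \<otimes> A w)" by (rule ccross_antisym)
    ultimately have 2: "(xi w \<otimes> A w) \<odot> (ph w \<otimes> a w) = 0"
      using P by (simp add: bdot_commute[of "H w"])
    show ?thesis unfolding N_def pd_f[OF w] by (simp add: 1 2)
  qed
  finally have "(1/2) *s (cvec (normal_part f w (pd 1 h w)) - \<i> *s cvec (normal_part f w (pd \<i> h w)))
      = (- \<i> * inverse (g w)) *s (xi w \<otimes> A w)"
    by (simp add: Nl Nc)
  then have "cvec (normal_part f w (pd 1 h w)) - \<i> *s cvec (normal_part f w (pd \<i> h w))
      = (- 2 * \<i> * inverse (g w)) *s (xi w \<otimes> A w)"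
    by (simp add: vec_eq_iff field_simps)
  then have iff: "normal_part f w (pd 1 h w) = 0 \<and> normal_part f w (pd \<i> h w) = 0 \<longleftrightarrow> xi w \<otimes> A w = 0"
    using g_nz[OF w] unfolding cvec_combination_eq_0[symmetric] by (simp add: vec_eq_iff)
  have lin: "normal_part f w (pd c h w)
      = Re c *\<^sub>R normal_part f w (pd 1 h w) + Im c *\<^sub>R normal_part f w (pd \<i> h w)" for c
    unfolding normal_part_eq[OF w] pd_Re_Im[OF hd, of c]
    by (simp add: algebra_simps add_divide_distrib inner_add_left)
  show ?thesis
  proof
    assume "\<forall>c. normal_part f w (pd c h w) = 0"
    then have "normal_part f w (pd 1 h w) = 0 \<and> normal_part f w (pd \<i> h w) = 0" by blast
    then show "xi w \<otimes> A w = 0" unfolding iff .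
  next
    assume "xi w \<otimes> A w = 0"
    then have n: "normal_part f w (pd 1 h w) = 0 \<and> normal_part f w (pd \<i> h w) = 0" unfolding iff .
    show "\<forall>c. normal_part f w (pd c h w) = 0"
    proof
      show "normal_part f w (pd c h w) = 0" for c by (subst lin) (simp add: n)
    qed
  qed
qed

end

locale primitive_surface = minimal_surface +
  fixes F :: "'a \<Rightarrow> real^7"
  assumes prim: "is_cross_primitive \<A> \<phi> F"
begin

lemma primitive: assumes U: "(U, z) \<in> \<A>" shows "primitive_chart (z ` U) (cph U z) (in_chart U z F)"
proof (intro primitive_chart.intro chart[OF U] primitive_chart_axioms.intro)
  interpret c: minimal_chart "z ` U" "cph U z" by (rule chart[OF U])
  show sf: "smooth_on (z ` U) (in_chart U z F)"
    using prim U unfolding is_cross_primitive_def smooth_map_def by blast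
  fix w assume w: "w \<in> z ` U"
  have cr: "cph U z = (\<lambda>w. cvec (rph U z w))" by (simp add: cph_def rph_def)
  have p: "pd 1 (in_chart U z F) w = cross7 (rph U z w) (pd \<i> (rph U z) w)"
    "pd \<i> (in_chart U z F) w = - cross7 (rph U z w) (pd 1 (rph U z) w)"
    using prim U w unfolding is_cross_primitive_def Let_def rph_def by blast+
  have 1: "dz (\<lambda>w. cvec (in_chart U z F w)) w
      = (1/2) *s (cvec (pd 1 (in_chart U z F) w) - \<i> *s cvec (pd \<i> (in_chart U z F) w))"
    by (rule dz_cvec(1)[OF smooth_on_differentiable[OF sf w]])
  have 2: "c.a w = (1/2) *s (cvec (pd 1 (rph U z) w) - \<i> *s cvec (pd \<i> (rph U z) w))"
    unfolding c.a_def unfolding cr by (rule dz_cvec(1)[OF smooth_on_differentiable[OF smooth_rph[OF U] w]])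
  show "dz (\<lambda>w. cvec (in_chart U z F w)) w = \<i> *s (cph U z w \<otimes> c.a w)"
    unfolding 1 2 p unfolding cr cvec_simps(3) ccross_cvec[symmetric] ccross_simps
    by (simp add: vec_eq_iff algebra_simps)
qed

lemma pseudo_umbilical_iff:
  "pseudo_umbilical \<A> F \<longleftrightarrow> (\<forall>(U, z)\<in>\<A>. minimal_chart.pseudo_umbilic (z ` U) (cph U z))"
proof
  assume "pseudo_umbilical \<A> F"
  then obtain l where l: "\<And>U z p c d. (U, z) \<in> \<A> \<Longrightarrow> p \<in> U \<Longrightarrow>
      sff (in_chart U z F) (z p) c d \<bullet> mean_curvature (in_chart U z F) (z p)
        = l p * fff (in_chart U z F) (z p) c d"
    unfolding pseudo_umbilical_def Let_def by fast
  show "\<forall>(U, z)\<in>\<A>. minimal_chart.pseudo_umbilic (z ` U) (cph U z)"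
  proof safe
    fix U z assume U: "(U, z) \<in> \<A>"
    interpret c: primitive_chart "z ` U" "cph U z" "in_chart U z F" by (rule primitive[OF U])
    show c.pseudo_umbilic
      unfolding c.pseudo_umbilic_def using c.umbilic_point_imp l[OF U] by blast
  qed
next
  assume P: "\<forall>(U, z)\<in>\<A>. minimal_chart.pseudo_umbilic (z ` U) (cph U z)"
  \<comment> \<open>The factor can be taken to be the constant 1, because the mean curvature vector
    is a unit vector.\<close>
  have "sff (in_chart U z F) (z p) c d \<bullet> mean_curvature (in_chart U z F) (z p)
      = 1 * fff (in_chart U z F) (z p) c d" if U: "(U, z) \<in> \<A>" and p: "p \<in> U" for U z p c d
  proof -
    interpret c: primitive_chart "z ` U" "cph U z" "in_chart U z F" by (rule primitive[OF U])
    have "c.pseudo_umbilic" using P U by blast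
    then show ?thesis
      using c.umbilic_point[of "z p" c d] p unfolding c.pseudo_umbilic_def by simp
  qed
  moreover have "smooth_map \<A> (\<lambda>_. 1 :: real)"
    unfolding smooth_map_def in_chart_def comp_def by (auto intro: smooth_on_const)
  ultimately show "pseudo_umbilical \<A> F"
    unfolding pseudo_umbilical_def Let_def by (intro exI[of _ "\<lambda>_. 1"]) auto
qed

lemma parallel_iff:
  assumes P: "pseudo_umbilical \<A> F"
  shows "parallel_mean_curvature \<A> F \<longleftrightarrow>
    (\<forall>(U, z)\<in>\<A>. \<forall>w\<in>z ` U. xi' U z w \<otimes> minimal_chart.A (cph U z) w = 0)"
proof -
  have "(\<forall>c. normal_part (in_chart U z F) w (pd c (mean_curvature (in_chart U z F)) w) = 0)
      \<longleftrightarrow> xi' U z w \<otimes> minimal_chart.A (cph U z) w = 0" if U: "(U, z) \<in> \<A>" and w: "w \<in> z ` U" for U z w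
  proof -
    interpret c: primitive_chart "z ` U" "cph U z" "in_chart U z F" by (rule primitive[OF U])
    have "c.pseudo_umbilic" using P U unfolding pseudo_umbilical_iff by blast
    then show ?thesis using c.parallel_point_iff[OF w] w unfolding c.pseudo_umbilic_def by blast
  qed
  then show ?thesis unfolding parallel_mean_curvature_def Let_def by fastforce
qed

end

section \<open>Reduction to a great 3-sphere\<close>

context minimal_surface
begin

text \<open>The set \<open>T\<close> of points near which \<open>Q\<close> vanishes in every chart
  is open. Analytic continuation inside a disc shows that a disc meeting \<open>T\<close> lies in
  it, and connectedness finishes; the transition rule makes vanishing independent of the
  chart.\<close>

lemma identity_theorem:
  assumes ex: "(U0, z0) \<in> \<A>" "p0 \<in> U0" "Q' U0 z0 (z0 p0) \<noteq> 0"
    and U: "(U, z) \<in> \<A>" and p: "p \<in> U" and r: "r > 0" "ball (z p) r \<subseteq> z ` U"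
  shows "\<exists>w\<in>ball (z p) r. Q' U z w \<noteq> 0"
proof (rule ccontr)
  assume "\<not> ?thesis"
  then have zero: "Q' U z w = 0" if "w \<in> ball (z p) r" for w using that by blast
  define T where "T = {p\<in>topspace X. \<exists>O'. openin X O' \<and> p \<in> O' \<and>
      (\<forall>(U, z)\<in>\<A>. \<forall>q\<in>U \<inter> O'. Q' U z (z q) = 0)}"
  have disc_T: "disc U z p r \<subseteq> T" if U: "(U, z) \<in> \<A>" and zero: "\<And>w. w \<in> ball (z p) r \<Longrightarrow> Q' U z w = 0" for U z p r
  proof
    fix q assume q: "q \<in> disc U z p r"
    have "Q' V y (y q') = 0" if V: "(V, y) \<in> \<A>" and q': "q' \<in> V" "q' \<in> disc U z p r" for V y q'
    proof -
      have "q' \<in> U" "z q' \<in> ball (z p) r" using q' by (auto simp: disc_def[OF U])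
      then show ?thesis
        using transition(2)[OF U V] transition_deriv(2)[OF U V] q'(1) zero by fastforce
    qed
    then show "q \<in> T"
      using q openin_disc[OF U, of p r] chart_subset[OF U] unfolding T_def
      by (auto simp: disc_def[OF U] intro!: exI[of _ "disc U z p r"])
  qed
  have "T = {} \<or> T = topspace X"
  proof (rule connected_dichotomy)
    show "T \<subseteq> topspace X" by (auto simp: T_def)
    fix p assume "p \<in> topspace X"
    then obtain U z where U: "(U, z) \<in> \<A>" and p: "p \<in> U" using cover by blast
    obtain r where r: "r > 0" "ball (z p) r \<subseteq> z ` U"
      using chart_open_image[OF U] p open_contains_ball by blast
    interpret c: minimal_chart "z ` U" "cph U z" by (rule chart[OF U])
    have "disc U z p r \<subseteq> T" if ne: "disc U z p r \<inter> T \<noteq> {}"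
    proof -
      obtain q O' where q: "q \<in> disc U z p r" "openin X O'" "q \<in> O'"
        and 0: "\<And>U z q. (U, z) \<in> \<A> \<Longrightarrow> q \<in> U \<Longrightarrow> q \<in> O' \<Longrightarrow> Q' U z (z q) = 0"
        using ne unfolding T_def by blast
      have "openin X (disc U z p r \<inter> O')" using openin_disc[OF U] q(2) by blast
      from chart_image_open[OF U this] have o: "open (z ` (disc U z p r \<inter> O' \<inter> U))" .
      have "Q' U z w = 0" if "w \<in> ball (z p) r" for w
      proof (rule analytic_continuation_open[OF o, of "ball (z p) r" "Q' U z" "\<lambda>_. 0"])
        show "Q' U z holomorphic_on ball (z p) r"
          using c.Q_holomorphic r(2) holomorphic_on_subset by blast
        show "z ` (disc U z p r \<inter> O' \<inter> U) \<noteq> {}" using q by (auto simp: disc_def[OF U])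
        show "z ` (disc U z p r \<inter> O' \<inter> U) \<subseteq> ball (z p) r" by (auto simp: disc_def[OF U])
      qed (use 0[OF U] that in auto)
      then show ?thesis by (rule disc_T[OF U])
    qed
    then show "\<exists>O'. openin X O' \<and> p \<in> O' \<and> (O' \<subseteq> T \<or> O' \<inter> T = {})"
      using openin_disc[OF U] disc_center[OF U p r(1)] by blast
  qed
  moreover have "p \<in> T" using disc_T[OF U zero] disc_center[OF U p r(1)] by blast
  ultimately have "p0 \<in> T" using chart_subset[OF ex(1)] ex(2) by blast
  then show False using ex unfolding T_def by blast
qed

lemma isolated_Q_zeros:
  assumes ex: "(U0, z0) \<in> \<A>" "p0 \<in> U0" "Q' U0 z0 (z0 p0) \<noteq> 0"
    and U: "(U, z) \<in> \<A>" and p: "p \<in> U"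
  obtains r where "r > 0" "ball (z p) r \<subseteq> z ` U" "\<And>w. w \<in> ball (z p) r - {z p} \<Longrightarrow> Q' U z w \<noteq> 0"
proof -
  interpret c: minimal_chart "z ` U" "cph U z" by (rule chart[OF U])
  obtain r where r: "r > 0" "ball (z p) r \<subseteq> z ` U"
    using chart_open_image[OF U] p open_contains_ball by blast
  show ?thesis
  proof (cases "Q' U z (z p) = 0")
    case True
    obtain w where w: "w \<in> ball (z p) r" "Q' U z w \<noteq> 0"
      using identity_theorem[OF ex U p r] by blast
    have "Q' U z holomorphic_on ball (z p) r"
      using c.Q_holomorphic r(2) holomorphic_on_subset by blast
    from isolated_zeros[OF this open_ball connected_ball _ True w] r(1) obtain s
      where "0 < s" "ball (z p) s \<subseteq> ball (z p) r" "\<And>w. w \<in> ball (z p) s - {z p} \<Longrightarrow> Q' U z w \<noteq> 0"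
      by (metis centre_in_ball)
    then show ?thesis using that r(2) by blast
  next
    case False
    then have "z p \<in> c.R" using p by (simp add: c.R_def)
    then obtain s where "s > 0" "ball (z p) s \<subseteq> c.R" using c.open_R open_contains_ball by blast
    moreover have "ball (z p) s \<subseteq> z ` U" "\<And>w. w \<in> ball (z p) s - {z p} \<Longrightarrow> Q' U z w \<noteq> 0"
      using calculation unfolding c.R_def by blast+
    ultimately show ?thesis using that by blast
  qed
qed

definition collinear_xi where
  "collinear_xi \<longleftrightarrow> (\<forall>(U, z)\<in>\<A>. \<forall>w\<in>z ` U. Q' U z w \<noteq> 0 \<longrightarrow>
     (xi' U z w \<odot> vcnj (xi' U z w))\<^sup>2 = Q' U z w * cnj (Q' U z w))"

text \<open>The constancy of \<open>proj\<close> is available only where \<open>Q\<close> is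
  nonzero. On a disc whose centre is the only possible zero, orthogonality to \<open>n\<close> is
  propagated over the punctured disc and reaches the centre by continuity; connectedness then passes
  from disc to disc.\<close>

lemma orth_everywhere:
  assumes col: collinear_xi
    and ex: "(U0, z0) \<in> \<A>" "p0 \<in> U0" "Q' U0 z0 (z0 p0) \<noteq> 0"
    and n: "minimal_chart.proj (cph U0 z0) (z0 p0) (cvec n) = 0"
    and q: "q \<in> topspace X"
  shows "\<phi> q \<bullet> n = 0"
proof -
  define S where "S = {p\<in>topspace X. \<exists>O'. openin X O' \<and> p \<in> O' \<and> (\<forall>q\<in>O'. \<phi> q \<bullet> n = 0)}"
  have col': "(minimal_chart.xi (cph U z) v \<odot> minimal_chart.Xi (cph U z) v)\<^sup>2
      = minimal_chart.Q (cph U z) v * cnj (minimal_chart.Q (cph U z) v)"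
    if U: "(U, z) \<in> \<A>" and v: "v \<in> minimal_chart.R (z ` U) (cph U z)" for U z v
  proof -
    interpret c: minimal_chart "z ` U" "cph U z" by (rule chart[OF U])
    show ?thesis using col U v unfolding collinear_xi_def c.R_def c.Xi_def by blast
  qed
  have ph: "cph U z (z q) \<odot> cvec n = of_real (\<phi> q \<bullet> n)" if "(U, z) \<in> \<A>" "q \<in> U" for U z q
    using that by (simp add: cph_def in_chart_at)
  have "S = {} \<or> S = topspace X"
  proof (rule connected_dichotomy)
    show "S \<subseteq> topspace X" by (auto simp: S_def)
    fix p assume "p \<in> topspace X"
    then obtain U z where U: "(U, z) \<in> \<A>" and p: "p \<in> U" using cover by blast
    interpret c: minimal_chart "z ` U" "cph U z" by (rule chart[OF U])
    obtain r where r: "r > 0" "ball (z p) r \<subseteq> z ` U"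
        "\<And>w. w \<in> ball (z p) r - {z p} \<Longrightarrow> Q' U z w \<noteq> 0"
      using isolated_Q_zeros[OF ex U p] by blast
    let ?C = "ball (z p) r - {z p}"
    \<comment> \<open>Deleting a point does not disconnect a disc of real dimension two.\<close>
    have C: "open ?C" "connected ?C" "?C \<subseteq> c.R"
      using r by (auto intro!: connected_open_delete simp: c.R_def)
    have "disc U z p r \<subseteq> S" if ne: "disc U z p r \<inter> S \<noteq> {}"
    proof -
      obtain q O' where q: "q \<in> disc U z p r" "openin X O'" "q \<in> O'" and 0: "\<And>q. q \<in> O' \<Longrightarrow> \<phi> q \<bullet> n = 0"
        using ne unfolding S_def by blast
      have "openin X (disc U z p r \<inter> O')" using openin_disc[OF U] q(2) by blast
      from chart_image_open[OF U this] have o: "open (z ` (disc U z p r \<inter> O' \<inter> U))" .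
      \<comment> \<open>The overlap is punctured as well, so that it lies in \<open>?C\<close>; it
        stays nonempty because a single point is not open.\<close>
      let ?G = "z ` (disc U z p r \<inter> O' \<inter> U) - {z p}"
      have oG: "open ?G" using o by (rule open_delete)
      have GC: "?G \<subseteq> ?C" by (auto simp: disc_def[OF U])
      have "?G \<noteq> {}"
      proof
        assume "?G = {}"
        then have "z ` (disc U z p r \<inter> O' \<inter> U) \<subseteq> {z p}" unfolding Diff_eq_empty_iff .
        then have "z ` (disc U z p r \<inter> O' \<inter> U) = {} \<or> z ` (disc U z p r \<inter> O' \<inter> U) = {z p}"
          by (rule subset_singletonD[THEN disjE]) simp_all
        moreover have "q \<in> disc U z p r \<inter> O' \<inter> U" using q by (auto simp: disc_def[OF U])
        ultimately have "z ` (disc U z p r \<inter> O' \<inter> U) = {z p}" by fast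
        with o have "open {z p}" by (simp only:)
        then show False using not_open_singleton by blast
      qed
      then obtain w where w: "w \<in> ?G" by blast
      have GD: "?G \<subseteq> z ` U" by auto
      have "c.proj w (cvec n) = 0"
        by (rule c.proj_eq_0[OF oG GD w]) (use ph[OF U] 0 in auto)
      then have 1: "cph U z w' \<odot> cvec n = 0" if "w' \<in> ?C" for w'
        using c.ph_orth_propagates[OF col'[OF U] C _ that] GC w by blast
      have 2: "\<phi> q \<bullet> n = 0" if "q \<in> disc U z p r" "q \<noteq> p" for q
      proof -
        have "q \<in> U" "z q \<in> ball (z p) r" using that(1) by (auto simp: disc_def[OF U])
        moreover have "z q \<noteq> z p" using chart_inj[OF U] \<open>q \<in> U\<close> p that(2) by (auto dest: inj_onD)
        ultimately show ?thesis using 1[of "z q"] ph[OF U] by auto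
      qed
      have "((\<lambda>w. cph U z w \<odot> cvec n) \<longlongrightarrow> cph U z (z p) \<odot> cvec n) (at (z p))"
      proof -
        have "continuous_on (z ` U) (\<lambda>w. cph U z w \<odot> cvec n)"
          by (intro smooth_on_continuous smooth_on_bdot c.open_D c.smooth_ph smooth_on_const)
        then have "isCont (\<lambda>w. cph U z w \<odot> cvec n) (z p)"
          using c.open_D p by (simp add: continuous_on_eq_continuous_at)
        then show ?thesis by (simp add: isCont_def)
      qed
      moreover have "\<forall>\<^sub>F w in at (z p). cph U z w \<odot> cvec n = 0"
        unfolding eventually_at using 1 r(1) by (intro exI[of _ r]) (auto simp: dist_commute)
      then have "((\<lambda>w. cph U z w \<odot> cvec n) \<longlongrightarrow> 0) (at (z p))"
        by (rule tendsto_eventually)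
      ultimately have "cph U z (z p) \<odot> cvec n = 0"
        by (rule tendsto_unique[OF at_neq_bot])
      then have "\<phi> p \<bullet> n = 0" using ph[OF U p] by simp
      then have 3: "\<forall>q\<in>disc U z p r. \<phi> q \<bullet> n = 0" using 2 by blast
      show ?thesis
      proof
        fix q assume q: "q \<in> disc U z p r"
        then have "q \<in> topspace X" using chart_subset[OF U] by (auto simp: disc_def[OF U])
        then show "q \<in> S" unfolding S_def using q 3 openin_disc[OF U, of p r] by blast
      qed
    qed
    then show "\<exists>O'. openin X O' \<and> p \<in> O' \<and> (O' \<subseteq> S \<or> O' \<inter> S = {})"
      using openin_disc[OF U] disc_center[OF U p r(1)] by blast
  qed
  moreover have "p0 \<in> S"
  proof -
    interpret c: minimal_chart "z0 ` U0" "cph U0 z0" by (rule chart[OF ex(1)])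
    have "z0 p0 \<in> c.R" using ex by (simp add: c.R_def)
    then obtain s where s: "s > 0" "ball (z0 p0) s \<subseteq> c.R" using c.open_R open_contains_ball by blast
    have "\<phi> q \<bullet> n = 0" if q: "q \<in> disc U0 z0 p0 s" for q
    proof -
      have qU: "q \<in> U0" "z0 q \<in> ball (z0 p0) s" using q by (auto simp: disc_def[OF ex(1)])
      have "cph U0 z0 (z0 q) \<odot> cvec n = 0"
        by (rule c.ph_orth_propagates[OF col'[OF ex(1)] open_ball connected_ball s(2) _ qU(2) n])
          (use s(1) in simp_all)
      then show ?thesis using ph[OF ex(1) qU(1)] by simp
    qed
    then show ?thesis
      unfolding S_def using openin_disc[OF ex(1), of p0 s] disc_center[OF ex(1,2) s(1)] chart_subset[OF ex(1)] ex(2)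
      by blast
  qed
  ultimately have "q \<in> S" using q by blast
  then show ?thesis unfolding S_def by blast
qed

end

section \<open>Real directions and compatible 4-planes\<close>

lemma real_multiple_of_collinear:
  fixes x :: "complex^'n"
  assumes "vcnj x = c *s x" "x \<noteq> 0"
  obtains N \<alpha> where "x = \<alpha> *s cvec N" "\<alpha> \<noteq> 0" "N \<noteq> 0"
proof -
  have r: "cvec (rvec y) = (1/2) *s (y + vcnj y)" for y :: "complex^'n"
    by (auto simp: vec_eq_iff cvec_def rvec_def vcnj_def complex_eq_iff)
  have "\<exists>N \<alpha>. x = \<alpha> *s cvec N"
  \<comment> \<open>The real part of \<open>x\<close> is \<open>(1 + c) / 2\<close> times
    \<open>x\<close>, which determines \<open>x\<close> unless \<open>c = -1\<close>; in that case
    \<open>x\<close> is purely imaginary.\<close>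
  proof (cases "c = -1")
    case True
    have "x = \<i> *s cvec (rvec ((-\<i>) *s x))"
      unfolding r using assms(1) True by (simp add: vec_eq_iff)
    then show ?thesis by blast
  next
    case False
    have "1 + c \<noteq> 0"
    proof
      assume "1 + c = 0"
      then have "c = -1" by (simp add: eq_neg_iff_add_eq_0 add.commute)
      with False show False by simp
    qed
    have "(2 / d) * ((1/2) * d) = 1" if "d \<noteq> 0" for d :: complex using that by simp
    from this[OF \<open>1 + c \<noteq> 0\<close>] have "(2 / (1 + c)) * ((1/2) * (1 + c)) = 1" .
    moreover have "x + c *s x = (1 + c) *s x" by (simp add: vec_eq_iff algebra_simps)
    ultimately have "x = (2 / (1 + c)) *s cvec (rvec x)"
      unfolding r assms(1) by (simp only: vector_smult_assoc vector_smult_lid)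
    then show ?thesis by blast
  qed
  then obtain N \<alpha> where 1: "x = \<alpha> *s cvec N" by blast
  then have "\<alpha> \<noteq> 0" "N \<noteq> 0" using assms(2) by auto
  with 1 that show ?thesis by blast
qed

lemma dim_orthogonal_4:
  fixes a b c d :: "real^7"
  assumes "a \<noteq> 0" "b \<noteq> 0" "c \<noteq> 0" "d \<noteq> 0" "a \<bullet> b = 0" "a \<bullet> c = 0" "a \<bullet> d = 0" "b \<bullet> c = 0" "b \<bullet> d = 0" "c \<bullet> d = 0"
  shows "dim (span {a, b, c, d}) = 4" "dim (span {a, b}) = 2"
proof -
  have "a \<noteq> b" "a \<noteq> c" "a \<noteq> d" "b \<noteq> c" "b \<noteq> d" "c \<noteq> d" using assms by auto
  then have c: "card {a, b, c, d} = 4" "card {a, b} = 2" by simp_all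
  have "independent {a, b, c, d}"
    using assms by (intro pairwise_orthogonal_independent) (auto simp: pairwise_def orthogonal_def inner_commute)
  moreover from this have "independent {a, b}" by (rule independent_mono) auto
  ultimately show "dim (span {a, b, c, d}) = 4" "dim (span {a, b}) = 2"
    using c by (metis dim_span indep_card_eq_dim_span)+
qed

lemma span_sum_pairs: "{x + y | x y. x \<in> span {a, b} \<and> y \<in> span {c, d}} = span {a, b, c, d :: 'b::real_vector}"
proof -
  have "{a, b, c, d} = {a, b} \<union> {c, d}" by auto
  then show ?thesis by (simp only: span_Un)
qed

lemma cross_span_pair:
  assumes "\<And>x y. x \<in> {a, b} \<Longrightarrow> y \<in> {a, b} \<Longrightarrow> cross7 x y \<in> span {m}"
  shows "cross_span (span {a, b}) (span {a, b}) \<subseteq> span {m}"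
proof -
  have lin: "linear (cross7 x)" "linear (\<lambda>x. cross7 x y)" for x y
    using bilinear_cross7 by (auto simp: bilinear_def)
  have 1: "cross7 x y \<in> span {m}" if "x \<in> {a, b}" "y \<in> span {a, b}" for x y
    using that(2)
  proof (induction rule: span_induct)
    case base
    have "subspace (cross7 x -` span {m})" using lin(1) by (intro linear_subspace_vimage) auto
    moreover have "{y. cross7 x y \<in> span {m}} = cross7 x -` span {m}" by auto
    ultimately show ?case by simp
  qed (use assms that in blast)
  have "cross7 x y \<in> span {m}" if "x \<in> span {a, b}" "y \<in> span {a, b}" for x y
    using that(1)
  proof (induction rule: span_induct)
    case base
    have "subspace ((\<lambda>x. cross7 x y) -` span {m})" using lin(2) by (intro linear_subspace_vimage) auto
    moreover have "{x. cross7 x y \<in> span {m}} = (\<lambda>x. cross7 x y) -` span {m}" by auto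
    ultimately show ?case by simp
  qed (use 1 that in blast)
  then show ?thesis
    unfolding cross_span_def by (intro span_minimal) auto
qed

lemma cross7_self: "cross7 x x = 0"
proof -
  have "cvec (cross7 x x) = 0" unfolding ccross_cvec[symmetric] by simp
  then show ?thesis by simp
qed

text \<open>The cross products of a plane with itself fill only the line through the product of two
  basis vectors, so one scalar equation decides compatibility of the splitting.\<close>

lemma admits_cross_compatible_span:
  assumes nz: "a \<noteq> 0" "b \<noteq> 0" "c \<noteq> 0" "d \<noteq> 0"
    and orth: "a \<bullet> b = 0" "a \<bullet> c = 0" "a \<bullet> d = 0" "b \<bullet> c = 0" "b \<bullet> d = 0" "c \<bullet> d = 0"
    and cross: "cross7 a b \<bullet> cross7 c d = 0"
  shows "admits_cross_compatible (span {a, b, c, d})"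
proof -
  have anti: "cross7 y x \<in> span {cross7 x y}" for x y
    using span_neg[OF span_base[of "cross7 x y" "{cross7 x y}"]] cross7_antisym[of y x] by simp
  have s: "cross_span (span {x, y}) (span {x, y}) \<subseteq> span {cross7 x y}" for x y
    by (rule cross_span_pair) (auto simp: cross7_self span_zero anti intro: span_base)
  have "orthogonal u v" if "u \<in> span {cross7 a b}" "v \<in> span {cross7 c d}" for u v
    using that cross by (auto simp: span_singleton orthogonal_def)
  moreover have "orthogonal x y" if x: "x \<in> span {a, b}" and y: "y \<in> span {c, d}" for x y
  proof (rule orthogonal_to_span[OF y])
    fix v assume v: "v \<in> {c, d}"
    have "orthogonal v x"
      by (rule orthogonal_to_span[OF x]) (use v orth in \<open>auto simp: orthogonal_def inner_commute\<close>)
    then show "orthogonal x v" by (simp add: orthogonal_commute)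
  qed
  moreover have "dim (span {a, b}) = 2" "dim (span {c, d}) = 2"
    using dim_orthogonal_4(2)[of a b c d] dim_orthogonal_4(2)[of c d a b] nz orth by (auto simp: inner_commute)
  ultimately have "cross_compatible (span {a, b, c, d}) (span {a, b}) (span {c, d})"
    unfolding cross_compatible_def using s span_sum_pairs[of a b c d] by blast
  then show ?thesis unfolding admits_cross_compatible_def by blast
qed

context minimal_surface
begin

text \<open>\<open>W\<close> is the span of position \<open>f'\<close>, real normal direction
  \<open>N\<close> and tangent vectors \<open>e1\<close>, \<open>e2\<close> at one point with
  nonzero \<open>Q\<close>. In the splitting into the planes of \<open>f'\<close>, \<open>N\<close>
  and of \<open>e1\<close>, \<open>e2\<close>, compatibility is precisely pseudo-umbilicity at that
  point, as \<open>H\<close> is a multiple of the product of \<open>e1\<close> and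
  \<open>e2\<close>.\<close>

lemma hopf_reduction:
  assumes P: "\<And>U z. (U, z) \<in> \<A> \<Longrightarrow> minimal_chart.pseudo_umbilic (z ` U) (cph U z)"
    and col: collinear_xi
    and ex: "(U, z) \<in> \<A>" "p \<in> U" "Q' U z (z p) \<noteq> 0"
  shows "\<exists>W. subspace W \<and> dim W = 4 \<and> admits_cross_compatible W \<and> \<phi> ` topspace X \<subseteq> W"
proof -
  interpret c: minimal_chart "z ` U" "cph U z" by (rule chart[OF ex(1)])
  let ?w = "z p"
  have w: "?w \<in> z ` U" using ex(2) by simp
  have c2: "(c.xi ?w \<odot> c.Xi ?w)\<^sup>2 = c.Q ?w * cnj (c.Q ?w)"
    using col ex unfolding collinear_xi_def c.Xi_def by blast
  have xi0: "c.xi ?w \<noteq> 0" using ex(3) by (auto simp: c.Q_def)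
  have "vcnj (c.xi ?w) = ((c.xi ?w \<odot> c.Xi ?w) / c.Q ?w) *s c.xi ?w"
    using c.Xi_collinear[OF ex(3) c2] by (simp add: c.Xi_def)
  then obtain N \<alpha> where N: "c.xi ?w = \<alpha> *s cvec N" "\<alpha> \<noteq> 0" "N \<noteq> 0"
    using real_multiple_of_collinear xi0 by metis
  obtain f' e1 e2 where f': "cph U z ?w = cvec f'" and a: "c.a ?w = cvec e1 + \<i> *s cvec e2"
    and A: "c.A ?w = cvec e1 - \<i> *s cvec e2" and f'0: "f' \<noteq> 0" and e0: "e1 \<noteq> 0" "e2 \<noteq> 0"
    and fe: "f' \<bullet> e1 = 0" "f' \<bullet> e2 = 0" and e: "e1 \<bullet> e2 = 0"
    using c.real_frame[OF w] .
  have fN: "f' \<bullet> N = 0"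
    using c.frame_xi(1)[OF w] N(2) unfolding N f' by simp
  have eN: "e1 \<bullet> N = 0" "e2 \<bullet> N = 0"
  proof -
    have "c.a ?w \<odot> c.xi ?w = \<alpha> * (c.a ?w \<odot> cvec N)" unfolding N(1) by simp
    then have "c.a ?w \<odot> cvec N = 0" using c.frame_xi(3)[OF w] N(2) by simp
    then show "e1 \<bullet> N = 0" "e2 \<bullet> N = 0" unfolding a by (auto simp: complex_eq_iff)
  qed
  have "cross7 f' N \<bullet> cross7 e1 e2 = 0"
  proof -
    have "(cph U z ?w \<otimes> c.xi ?w) \<odot> (c.a ?w \<otimes> c.A ?w) = 0"
      using P[OF ex(1)] w unfolding c.pseudo_umbilic_def c.H_def by blast
    moreover have "cross7 e2 e1 = - cross7 e1 e2" by (rule cross7_antisym)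
    then have "cvec (cross7 e2 e1) = - cvec (cross7 e1 e2)" by simp
    then have "c.a ?w \<otimes> c.A ?w = (-2 * \<i>) *s cvec (cross7 e1 e2)"
      unfolding A unfolding a by (simp add: cross7_self vec_eq_iff)
    ultimately have "\<alpha> * (-2 * \<i>) * of_real (cross7 f' N \<bullet> cross7 e1 e2) = 0"
      unfolding N(1) f' by simp
    then show ?thesis using N(2) by simp
  qed
  then have comp: "admits_cross_compatible (span {f', N, e1, e2})"
    using f'0 N(3) e0 fe fN eN e by (intro admits_cross_compatible_span) (auto simp: inner_commute)
  have dim: "dim (span {f', N, e1, e2}) = 4"
    using f'0 N(3) e0 fe fN eN e by (intro dim_orthogonal_4) (auto simp: inner_commute)
  have "\<phi> q \<in> span {f', N, e1, e2}" if q: "q \<in> topspace X" for q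
  proof -
    \<comment> \<open>The component \<open>v\<close> of the position normal to \<open>W\<close> is
      killed by the projection at the base point, so \<open>orth_everywhere\<close> makes the
      position orthogonal to its own component \<open>v\<close>.\<close>
    obtain u v where uv: "u \<in> span {f', N, e1, e2}" "\<And>x. x \<in> span {f', N, e1, e2} \<Longrightarrow> orthogonal v x" "\<phi> q = u + v"
      using orthogonal_subspace_decomp_exists by blast
    have "v \<bullet> f' = 0" "v \<bullet> N = 0" "v \<bullet> e1 = 0" "v \<bullet> e2 = 0"
      using uv(2) span_base[of _ "{f', N, e1, e2}"] by (auto simp: orthogonal_def)
    then have "c.proj ?w (cvec v) = 0"
      unfolding c.proj_def N f' A unfolding a by (simp add: inner_commute[of _ v])
    from orth_everywhere[OF col ex this q] have "\<phi> q \<bullet> v = 0" .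
    moreover have "u \<bullet> v = 0" using uv(1,2) by (simp add: orthogonal_def inner_commute)
    ultimately have "v \<bullet> v = 0" by (simp add: uv(3) inner_add_left)
    then show ?thesis using uv(1,3) by simp
  qed
  then show ?thesis using comp dim by blast
qed

end

context primitive_surface
begin

text \<open>At a non-parallel point the dichotomy gives equality of the squared norm of
  \<open>xi\<close> with the modulus of \<open>Q\<close>, so \<open>Q\<close> is nonzero there.
  Wherever \<open>Q\<close> is nonzero, \<open>xi_cross_eq_0_imp\<close> excludes the other
  alternative, so collinearity holds at all such points.\<close>

lemma nonparallel_imp:
  assumes "pseudo_umbilical \<A> F" "\<not> parallel_mean_curvature \<A> F"
  shows "\<exists>W. subspace W \<and> dim W = 4 \<and> admits_cross_compatible W \<and> \<phi> ` topspace X \<subseteq> W"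
    "\<exists>U z p. (U, z) \<in> \<A> \<and> p \<in> U \<and> Q' U z (z p) \<noteq> 0"
proof -
  have P: "minimal_chart.pseudo_umbilic (z ` U) (cph U z)" if "(U, z) \<in> \<A>" for U z
    using assms(1) that unfolding pseudo_umbilical_iff by blast
  obtain U z p where ex: "(U, z) \<in> \<A>" "p \<in> U" "xi' U z (z p) \<otimes> minimal_chart.A (cph U z) (z p) \<noteq> 0"
    using assms(2) unfolding parallel_iff[OF assms(1)] by blast
  have dich: "(xi' U z w \<odot> vcnj (xi' U z w))\<^sup>2 = Q' U z w * cnj (Q' U z w)"
    if U: "(U, z) \<in> \<A>" and w: "w \<in> z ` U" and n: "xi' U z w \<otimes> minimal_chart.A (cph U z) w \<noteq> 0" for U z w
  proof -
    interpret c: minimal_chart "z ` U" "cph U z" by (rule chart[OF U])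
    show ?thesis using c.pseudo_umbilic_dichotomy[OF P[OF U] w] n by (simp add: c.Xi_def)
  qed
  have col: collinear_xi
    unfolding collinear_xi_def
  proof safe
    fix U z p assume U: "(U, z) \<in> \<A>" and p: "p \<in> U" and Q: "Q' U z (z p) \<noteq> 0"
    interpret c: minimal_chart "z ` U" "cph U z" by (rule chart[OF U])
    have "c.xi (z p) \<otimes> c.A (z p) \<noteq> 0" using c.xi_cross_eq_0_imp[of "z p"] p Q by blast
    then show "(c.xi (z p) \<odot> vcnj (c.xi (z p)))\<^sup>2 = c.Q (z p) * cnj (c.Q (z p))"
      using dich[OF U, of "z p"] p by blast
  qed
  have "xi' U z (z p) \<noteq> 0" using ex(3) by auto
  then have "xi' U z (z p) \<odot> vcnj (xi' U z (z p)) \<noteq> 0" by simp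
  then have Q: "Q' U z (z p) \<noteq> 0" using dich[OF ex(1) _ ex(3)] ex(2) by force
  then show "\<exists>U z p. (U, z) \<in> \<A> \<and> p \<in> U \<and> Q' U z (z p) \<noteq> 0" using ex by blast
  show "\<exists>W. subspace W \<and> dim W = 4 \<and> admits_cross_compatible W \<and> \<phi> ` topspace X \<subseteq> W"
    by (rule hopf_reduction[OF P col ex(1,2) Q])
qed

end

section \<open>The harmonic sequence\<close>

lemma hinner_simps [simp]:
  "hinner (u + v) w = hinner u w + hinner v w" "hinner (u - v) w = hinner u w - hinner v w"
  "hinner (c *s u) w = c * hinner u w" "hinner u (c *s w) = cnj c * hinner u w" "hinner u u = 0 \<longleftrightarrow> u = 0"
  by (simp_all add: hinner_eq_bdot)

lemma vec_span_scale: "c \<noteq> 0 \<Longrightarrow> vec.span {c *s v} = vec.span {v :: complex^'n}"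
proof (rule set_eqI)
  fix x assume "c \<noteq> 0"
  then have "x = k *s v \<longleftrightarrow> x = (k / c) *s (c *s v)" for k by (simp add: vector_smult_assoc)
  moreover have "x = k *s (c *s v) \<longleftrightarrow> x = (k * c) *s v" for k by (simp add: vector_smult_assoc)
  ultimately show "x \<in> vec.span {c *s v} \<longleftrightarrow> x \<in> vec.span {v}"
    unfolding vec.span_singleton by blast
qed

lemma herm_perp_part_line:
  assumes s: "s \<noteq> 0" and e: "hinner e s = 0"
  shows "herm_perp_part (vec.span {s}) (c *s s + e) = e"
  unfolding herm_perp_part_def
proof (rule the_equality)
  have "hinner e b = 0" if "b \<in> vec.span {s}" for b
    using that e by (auto simp: vec.span_singleton)
  then show "(\<forall>b\<in>vec.span {s}. hinner e b = 0) \<and> c *s s + e - e \<in> vec.span {s}"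
    by (auto simp: vec.span_singleton)
  fix u assume u: "(\<forall>b\<in>vec.span {s}. hinner u b = 0) \<and> c *s s + e - u \<in> vec.span {s}"
  then obtain k where k: "c *s s + e - u = k *s s" by (auto simp: vec.span_singleton)
  then have eu: "e - u = (k - c) *s s" by (simp add: vec_eq_iff algebra_simps)
  have "s \<in> vec.span {s}" by (rule vec.span_base) simp
  then have "hinner (e - u) s = 0" using u e by simp
  then have "(k - c) * hinner s s = 0" unfolding eu by (simp only: hinner_simps(3))
  then have "k - c = 0" using s by simp
  then show "u = e" using eu by simp
qed

lemma dz_scalar_mult:
  assumes "sder k w k1 k2" "s differentiable (at w)"
  shows "dz (\<lambda>w. k w *s s w) w = k1 *s s w + k w *s dz s w"
  using wder_imp_dz(1)[OF wder_cscale[OF assms(1) wder_dz[OF assms(2)]]] .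

context rsurface
begin

definition line_frame ::
  "'a set \<Rightarrow> ('a \<Rightarrow> complex) \<Rightarrow> ('a \<Rightarrow> (complex^'n) set) \<Rightarrow> 'a \<Rightarrow> complex set \<Rightarrow> (complex \<Rightarrow> complex^'n) \<Rightarrow> bool" where
  "line_frame U z B p D s \<longleftrightarrow> open D \<and> z p \<in> D \<and> D \<subseteq> z ` U \<and> smooth_on D s \<and>
     (\<forall>w\<in>D. s w \<noteq> 0 \<and> in_chart U z B w = vec.span {s w})"

text \<open>Every section is \<open>k\<close> times the frame, and the term containing the
  derivative of \<open>k\<close> lies in the line itself. The projection leaves only multiples of
  \<open>e\<close>, all of which are attained with constant \<open>k\<close>.\<close>

lemma A'_image_line:
  assumes U: "(U, z) \<in> \<A>" and p: "p \<in> U" and fr: "line_frame U z B p D s"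
    and d: "dz s (z p) = l *s s (z p) + e" and e: "hinner e (s (z p)) = 0"
  shows "A'_image U z B p = vec.span {e}"
proof -
  have o: "open D" "z p \<in> D" "D \<subseteq> z ` U" and sm: "smooth_on D s"
    and s0: "\<And>w. w \<in> D \<Longrightarrow> s w \<noteq> 0" and B: "\<And>w. w \<in> D \<Longrightarrow> in_chart U z B w = vec.span {s w}"
    using fr by (auto simp: line_frame_def)
  have Bp: "B p = vec.span {s (z p)}" using B[OF o(2)] in_chart_at[OF U p] by metis
  have sd: "s differentiable (at (z p))" by (rule smooth_on_differentiable[OF sm o(2)])
  show ?thesis
  proof (intro set_eqI iffI)
    fix x assume "x \<in> A'_image U z B p"
    then obtain v D1 where x: "x = herm_perp_part (B p) (dz v (z p))" and D1: "z p \<in> D1" "local_section U z B D1 v"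
      unfolding A'_image_def by blast
    then have v: "open D1" "smooth_on D1 v" "\<And>w. w \<in> D1 \<Longrightarrow> v w \<in> in_chart U z B w"
      by (auto simp: local_section_def)
    let ?O = "D \<inter> D1"
    have oO: "open ?O" "z p \<in> ?O" using o v D1 by auto
    \<comment> \<open>The coefficient is written as a Hermitian quotient to make its smoothness
      visible.\<close>
    let ?k = "\<lambda>w. (v w \<odot> vcnj (s w)) * inverse (s w \<odot> vcnj (s w))"
    have sO: "smooth_on ?O s" "smooth_on ?O v" using smooth_on_subset sm v(2) by blast+
    have k: "smooth_on ?O ?k"
      using s0 by (intro smooth_on_mult smooth_on_bdot smooth_on_vcnj smooth_on_inverse oO sO) simp
    have vk: "?k w *s s w = v w" if w: "w \<in> ?O" for w
    proof -
      have "v w \<in> vec.span {s w}" using v(3)[of w] B[of w] w by blast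
      then obtain c where "v w = c *s s w" unfolding vec.span_singleton by blast
      then show ?thesis using s0[of w] w by simp
    qed
    obtain k1 k2 where "sder ?k (z p) k1 k2"
      using sder_sdz[OF smooth_on_differentiable[OF k oO(2)]] by blast
    note dk = dz_scalar_mult[OF this sd]
    have wk: "wder (\<lambda>w. ?k w *s s w) (z p) (dz (\<lambda>w. ?k w *s s w) (z p)) (dzb (\<lambda>w. ?k w *s s w) (z p))"
      by (intro wder_dz smooth_on_differentiable[OF smooth_on_cscale[OF oO(1) k sO(1)] oO(2)])
    have "wder v (z p) (dz (\<lambda>w. ?k w *s s w) (z p)) (dzb (\<lambda>w. ?k w *s s w) (z p))"
      by (rule wder_cong_open[where f = "\<lambda>w. ?k w *s s w" and g = v, OF oO _ wk]) (rule vk)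
    then have "dz v (z p) = dz (\<lambda>w. ?k w *s s w) (z p)" by (rule wder_imp_dz)
    then have "dz v (z p) = k1 *s s (z p) + ?k (z p) *s dz s (z p)" using dk by simp
    also have "\<dots> = (k1 + ?k (z p) * l) *s s (z p) + ?k (z p) *s e"
      unfolding d by (simp add: vec_eq_iff algebra_simps)
    finally have "x = ?k (z p) *s e"
      unfolding x Bp using e s0[OF o(2)] by (simp only:) (rule herm_perp_part_line, simp_all)
    then show "x \<in> vec.span {e}" by (auto simp: vec.span_singleton)
  next
    fix x assume "x \<in> vec.span {e}"
    then obtain k where x: "x = k *s e" by (auto simp: vec.span_singleton)
    have ls: "local_section U z B D (\<lambda>w. k *s s w)"
      unfolding local_section_def using o B
      by (auto simp: vec.span_singleton intro!: smooth_on_cscale smooth_on_const sm)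
    have "dz (\<lambda>w. k *s s w) (z p) = (k * l) *s s (z p) + k *s e"
      using dz_scalar_mult[OF sder_const sd, of k] d by (simp add: vec_eq_iff algebra_simps)
    then have "x = herm_perp_part (B p) (dz (\<lambda>w. k *s s w) (z p))"
      unfolding x Bp using e s0[OF o(2)] by (simp only:) (rule herm_perp_part_line[symmetric], simp_all)
    then show "x \<in> A'_image U z B p"
      unfolding A'_image_def using ls o(2) by blast
  qed
qed

lemma smooth_subbundle_line:
  assumes "\<And>U z p. (U, z) \<in> \<A> \<Longrightarrow> p \<in> U \<Longrightarrow> \<exists>D s. line_frame U z B p D s"
  shows "smooth_subbundle \<A> 1 B"
  unfolding smooth_subbundle_def
proof safe
  fix U z p assume "(U, z) \<in> \<A>" "p \<in> U"
  then obtain D s where "line_frame U z B p D s" using assms by blast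
  then show "\<exists>D s. open D \<and> z p \<in> D \<and> D \<subseteq> z ` U \<and> (\<forall>i<1. smooth_on D (s i)) \<and>
      (\<forall>w\<in>D. inj_on (\<lambda>i. s i w) {..<1} \<and> vec.independent ((\<lambda>i. s i w) ` {..<1::nat}) \<and>
         in_chart U z B w = vec.span ((\<lambda>i. s i w) ` {..<1}))"
    by (intro exI[of _ D] exI[of _ "\<lambda>i. s"]) (auto simp: line_frame_def lessThan_Suc vec.dependent_single)
qed

end

context minimal_surface
begin

text \<open>These zeros serve as the exceptional set in \<open>image_bundle\<close>. The transition
  rule allows them to be tested in a single chart near a putative accumulation point.\<close>

lemma Q_zeros_isolated:
  assumes ex: "(U0, z0) \<in> \<A>" "p0 \<in> U0" "Q' U0 z0 (z0 p0) \<noteq> 0"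
  shows "X derived_set_of {p \<in> topspace X. \<exists>(U, z)\<in>\<A>. p \<in> U \<and> Q' U z (z p) = 0} = {}" (is "_ derived_set_of ?Z = {}")
proof -
  have False if p: "p \<in> X derived_set_of ?Z" for p
  proof -
    have "p \<in> topspace X" using p by (simp add: derived_set_of_def)
    then obtain U z where U: "(U, z) \<in> \<A>" and pU: "p \<in> U" using cover by blast
    obtain r where r: "r > 0" "ball (z p) r \<subseteq> z ` U" "\<And>w. w \<in> ball (z p) r - {z p} \<Longrightarrow> Q' U z w \<noteq> 0"
      using isolated_Q_zeros[OF ex U pU] by blast
    obtain q where q: "q \<noteq> p" "q \<in> ?Z" "q \<in> disc U z p r"
      using p openin_disc[OF U, of p r] disc_center[OF U pU r(1)] unfolding derived_set_of_def by blast
    then obtain V y where V: "(V, y) \<in> \<A>" "q \<in> V" "Q' V y (y q) = 0" by blast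
    have qU: "q \<in> U" "z q \<in> ball (z p) r" using q(3) by (auto simp: disc_def[OF U])
    have "Q' U z (z q) = 0" using transition(2)[OF U V(1) qU(1) V(2)] V(3) by simp
    moreover have "z q \<noteq> z p" using chart_inj[OF U] qU(1) pU q(1) by (auto dest: inj_onD)
    ultimately show False using r(3)[of "z q"] qU(2) by blast
  qed
  then show ?thesis by blast
qed

text \<open>In a great 3-sphere the harmonic sequence is periodic: it runs through \<open>\<phi>\<close>, \<open>\<phi>\<^sub>z\<close>, the unit
  normal \<open>N\<close> and the conjugate of \<open>\<phi>\<^sub>z\<close>.\<close>

definition tangent where
  "tangent p = (SOME x. \<exists>U z. (U, z) \<in> \<A> \<and> p \<in> U \<and> x = a' U z (z p))"

text \<open>The chart chosen in \<open>tangent\<close> is immaterial: another one changes the vector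
  by a nonzero factor, so the line it spans is globally defined.\<close>

lemma tangent_chart:
  assumes U: "(U, z) \<in> \<A>" and p: "p \<in> U"
  obtains c where "c \<noteq> 0" "tangent p = c *s a' U z (z p)"
proof -
  have "\<exists>V y. (V, y) \<in> \<A> \<and> p \<in> V \<and> tangent p = a' V y (y p)"
    unfolding tangent_def by (rule someI_ex) (use U p in blast)
  then obtain V y where V: "(V, y) \<in> \<A>" "p \<in> V" "tangent p = a' V y (y p)" by blast
  then show ?thesis
    using that transition(1)[OF V(1) U V(2) p] transition_deriv(2)[OF V(1) U V(2) p] by metis
qed

text \<open>The complex span of a subspace \<open>W\<close>, encoded by its real annihilator;
  membership of derivatives then follows by differentiating linear equations with constant
  coefficients.\<close>

definition complexification :: "(real^7) set \<Rightarrow> (complex^7) set" where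
  "complexification W = {x. \<forall>n. (\<forall>y\<in>W. n \<bullet> y = 0) \<longrightarrow> x \<odot> cvec n = 0}"

lemma complexification_lin:
  "x \<in> complexification W \<Longrightarrow> y \<in> complexification W \<Longrightarrow> x + y \<in> complexification W"
  "x \<in> complexification W \<Longrightarrow> y \<in> complexification W \<Longrightarrow> x - y \<in> complexification W"
  "x \<in> complexification W \<Longrightarrow> c *s x \<in> complexification W"
  "x \<in> complexification W \<Longrightarrow> vcnj x \<in> complexification W"
  "w \<in> W \<Longrightarrow> cvec w \<in> complexification W"
  by (auto simp: complexification_def bdot_vcnj_left inner_commute)

lemma complexification_real:
  assumes "subspace W" "cvec x \<in> complexification W"
  shows "x \<in> W"
proof -
  obtain u v where uv: "u \<in> span W" "\<And>y. y \<in> span W \<Longrightarrow> orthogonal v y" "x = u + v"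
    using orthogonal_subspace_decomp_exists by blast
  have "v \<bullet> y = 0" if "y \<in> W" for y using uv(2)[OF span_base[OF that]] by (simp add: orthogonal_def)
  then have "cvec x \<odot> cvec v = 0" using assms(2) by (auto simp: complexification_def)
  moreover have "u \<bullet> v = 0" using uv(1,2) by (simp add: orthogonal_def inner_commute)
  ultimately have "v \<bullet> v = 0" by (simp add: uv(3) inner_add_left)
  then show ?thesis using uv assms(1) by (metis add.right_neutral inner_eq_zero_iff span_eq_iff)
qed

end

locale hopf_surface = minimal_surface +
  fixes W :: "(real^7) set"
  assumes W: "subspace W" "dim W = 4" and \<phi>W: "\<phi> ` topspace X \<subseteq> W"
begin

abbreviation "Wc \<equiv> complexification W"

text \<open>Defined by orthogonality inside the complexified 4-space rather than as the span of
  \<open>xi\<close>, so that it remains a line at the zeros of \<open>xi\<close>. This is the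
  extension across the singularities.\<close>

definition normal_line where
  "normal_line p = {x \<in> Wc. x \<odot> cvec (\<phi> p) = 0 \<and> x \<odot> tangent p = 0 \<and> x \<odot> vcnj (tangent p) = 0}"

lemma normal_line_chart:
  assumes U: "(U, z) \<in> \<A>" and p: "p \<in> U"
  shows "normal_line p = {x \<in> Wc. x \<odot> cph U z (z p) = 0 \<and> x \<odot> a' U z (z p) = 0 \<and> x \<odot> vcnj (a' U z (z p)) = 0}"
proof -
  obtain c where "c \<noteq> 0" "tangent p = c *s a' U z (z p)" using tangent_chart[OF U p] .
  then show ?thesis unfolding normal_line_def using p by (auto simp: cph_def in_chart_at[OF U])
qed

lemma derivatives_Wc:
  assumes U: "(U, z) \<in> \<A>" and w: "w \<in> z ` U"
  shows "cph U z w \<in> Wc" "a' U z w \<in> Wc" "minimal_chart.b (cph U z) w \<in> Wc"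
proof -
  interpret c: minimal_chart "z ` U" "cph U z" by (rule chart[OF U])
  have 0: "cph U z v \<odot> cvec n = 0" if "\<forall>y\<in>W. n \<bullet> y = 0" "v \<in> z ` U" for n v
    using that \<phi>W chart_subset[OF U] by (force simp: cph_def in_chart_at[OF U] inner_commute)
  have 1: "c.a v \<odot> cvec n = 0" if n: "\<forall>y\<in>W. n \<bullet> y = 0" and v: "v \<in> z ` U" for n v
    using sder_zero_on(1)[OF c.open_D v 0[OF n] sder_bdot[OF c.wder_ph[OF v] wder_const[of "cvec n"]]] by simp
  have 2: "c.b v \<odot> cvec n = 0" if n: "\<forall>y\<in>W. n \<bullet> y = 0" and v: "v \<in> z ` U" for n v
    using sder_zero_on(1)[OF c.open_D v 1[OF n] sder_bdot[OF c.wder_a[OF v] wder_const[of "cvec n"]]] by simp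
  show "cph U z w \<in> Wc" "a' U z w \<in> Wc" "c.b w \<in> Wc"
    using 0 1 2 w by (auto simp: complexification_def)
qed

lemma Wc_split:
  assumes "x \<in> Wc"
  obtains r i where "r \<in> W" "i \<in> W" "x = cvec r + \<i> *s cvec i"
proof -
  obtain r i where x: "x = cvec r + \<i> *s cvec i" and ri: "cvec r = (1/2) *s (x + vcnj x)" "cvec i = (-\<i>/2) *s (x - vcnj x)"
    by (rule cvec_split)
  have "cvec r \<in> Wc" "cvec i \<in> Wc" unfolding ri by (intro complexification_lin assms)+
  then show ?thesis using that complexification_real[OF W(1)] x by blast
qed

lemma Wc_normal_unique:
  assumes U: "(U, z) \<in> \<A>" and w: "w \<in> z ` U" and N: "N \<in> W" "N \<noteq> 0"
    "cvec N \<odot> cph U z w = 0" "cvec N \<odot> a' U z w = 0"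
    and x: "x \<in> Wc" "x \<odot> cph U z w = 0" "x \<odot> a' U z w = 0" "x \<odot> vcnj (a' U z w) = 0"
  shows "\<exists>k. x = k *s cvec N"
proof -
  interpret c: minimal_chart "z ` U" "cph U z" by (rule chart[OF U])
  obtain f' e1 e2 where f': "cph U z w = cvec f'" and a: "c.a w = cvec e1 + \<i> *s cvec e2"
    and A: "c.A w = cvec e1 - \<i> *s cvec e2"
    and e12: "cvec e1 = (1/2) *s (c.a w + c.A w)" "cvec e2 = (-\<i>/2) *s (c.a w - c.A w)"
    and f0: "f' \<noteq> 0" and e0: "e1 \<noteq> 0" "e2 \<noteq> 0"
    and fe: "f' \<bullet> e1 = 0" "f' \<bullet> e2 = 0" and e: "e1 \<bullet> e2 = 0"
    using c.real_frame[OF w] .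
  have fN: "N \<bullet> f' = 0" using N(3) unfolding f' by simp
  have eN: "N \<bullet> e1 = 0" "N \<bullet> e2 = 0"
    using N(4) unfolding a by (auto simp: complex_eq_iff)
  have aW: "c.a w \<in> Wc" by (rule derivatives_Wc[OF U w])
  have AW: "c.A w \<in> Wc" unfolding c.A_def by (rule complexification_lin(4)[OF aW])
  have "cvec e1 \<in> Wc" "cvec e2 \<in> Wc" unfolding e12 by (intro complexification_lin aW AW)+
  then have eW: "e1 \<in> W" "e2 \<in> W" using complexification_real W by blast+
  have fW: "f' \<in> W" using derivatives_Wc(1)[OF U w] complexification_real[OF W(1)] unfolding f' by blast
  let ?B = "{f', e1, e2, N}"
  have "dim (span ?B) = 4"
    using f0 e0 N(2) fe fN eN e by (intro dim_orthogonal_4) (auto simp: inner_commute)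
  moreover have "span ?B \<subseteq> W" using fW eW N(1) W(1) by (intro span_minimal) auto
  ultimately have BW: "span ?B = W"
    using subspace_dim_equal[of "span ?B" W] W by simp
  have real: "\<exists>k. y = k *\<^sub>R N" if y: "y \<in> W" "y \<bullet> f' = 0" "y \<bullet> e1 = 0" "y \<bullet> e2 = 0" for y
  proof -
    define d where "d = y - ((y \<bullet> N) / (N \<bullet> N)) *\<^sub>R N"
    have "d \<in> span ?B" unfolding BW d_def using y N(1) W(1) by (intro subspace_diff subspace_scale)
    moreover have "orthogonal d v" if "v \<in> ?B" for v
      using that y fN eN N(2) by (auto simp: d_def orthogonal_def inner_diff_left)
    ultimately have "orthogonal d d" by (rule orthogonal_to_span)
    then have "d = 0" by (simp add: orthogonal_def)
    then show ?thesis unfolding d_def by (metis right_minus_eq)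
  qed
  obtain r i where riW: "r \<in> W" "i \<in> W" and xri: "x = cvec r + \<i> *s cvec i"
    using Wc_split[OF x(1)] .
  have xe: "x \<odot> cvec e1 = 0" "x \<odot> cvec e2 = 0"
    using x(3,4) unfolding c.A_def[symmetric] A unfolding a by (auto simp: algebra_simps add_eq_0_iff2)
  have "r \<bullet> f' = 0" "i \<bullet> f' = 0" "r \<bullet> e1 = 0" "i \<bullet> e1 = 0" "r \<bullet> e2 = 0" "i \<bullet> e2 = 0"
    using x(2) xe unfolding xri f' by (auto simp: complex_eq_iff)
  then obtain k1 k2 where ri: "r = k1 *\<^sub>R N" "i = k2 *\<^sub>R N" using real[OF riW(1)] real[OF riW(2)] by blast
  then have "x = (of_real k1 + \<i> * of_real k2) *s cvec N"
    unfolding xri unfolding ri by (simp add: vec_eq_iff algebra_simps)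
  then show ?thesis by blast
qed

text \<open>A vector \<open>n\<close> of \<open>W\<close> normal at \<open>p\<close> exists because
  three vectors cannot span a 4-space. Projecting this fixed vector onto the normal line at nearby
  points gives a smooth real section that is nonzero near \<open>p\<close>.\<close>

lemma normal_frame:
  assumes U: "(U, z) \<in> \<A>" and p: "p \<in> U"
  obtains D N where "line_frame U z normal_line p D N"
    "\<And>w. w \<in> D \<Longrightarrow> vcnj (N w) = N w \<and> N w \<in> Wc \<and> N w \<odot> cph U z w = 0 \<and> N w \<odot> a' U z w = 0"
proof -
  interpret c: minimal_chart "z ` U" "cph U z" by (rule chart[OF U])
  have zp: "z p \<in> z ` U" using p by simp
  obtain e1 e2 where e: "e1 \<in> W" "e2 \<in> W" and a: "c.a (z p) = cvec e1 + \<i> *s cvec e2"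
    using Wc_split[OF derivatives_Wc(2)[OF U zp]] by blast
  have A: "c.A (z p) = cvec e1 - \<i> *s cvec e2"
    unfolding c.A_def a by (simp add: vec_eq_iff)
  define f' where "f' = \<phi> p"
  have f': "cph U z (z p) = cvec f'" using p by (simp add: cph_def f'_def in_chart_at[OF U])
  have f'W: "f' \<in> W" using \<phi>W chart_subset[OF U] p unfolding f'_def by blast
  have "dim {f', e1, e2} \<le> card {f', e1, e2}" by (rule dim_le_card') simp
  also have "\<dots> \<le> 3" by (simp add: card_insert_if)
  finally have "dim (span {f', e1, e2}) < dim W" using W by simp
  moreover have "span {f', e1, e2} \<subseteq> W" using f'W e W by (intro span_minimal) auto
  ultimately have "span {f', e1, e2} \<subset> span W" using W(1) span_eq_iff by (metis order_less_irrefl psubsetI)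
  then obtain n where n: "n \<noteq> 0" "n \<in> span W" "\<And>y. y \<in> span {f', e1, e2} \<Longrightarrow> orthogonal n y"
    using orthogonal_to_subspace_exists_gen by blast
  have nW: "n \<in> W" using n(2) W(1) span_eq_iff by blast
  have nf: "n \<bullet> f' = 0" "n \<bullet> e1 = 0" "n \<bullet> e2 = 0"
    using n(3) span_base[of _ "{f', e1, e2}"] by (auto simp: orthogonal_def)
  define N where "N w = cvec n - (cph U z w \<odot> cvec n) *s cph U z w
    - inverse (c.g w) *s ((c.a w \<odot> cvec n) *s c.A w + (c.A w \<odot> cvec n) *s c.a w)" for w
  have Np: "N (z p) = cvec n"
    unfolding N_def f' A unfolding a by (simp add: nf inner_commute[of _ n])
  have smN: "smooth_on (z ` U) N"
    unfolding N_def[abs_def] using c.g_nz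
    by (intro smooth_on_diff smooth_on_add smooth_on_cscale smooth_on_bdot smooth_on_inverse smooth_on_const
        c.open_D c.smooth_ph c.smooth_a c.smooth_A c.smooth_g)
  define D where "D = z ` U \<inter> N -` (- {0})"
  have oD: "open D"
    unfolding D_def by (rule continuous_open_preimage[OF smooth_on_continuous[OF smN] c.open_D]) auto
  have props: "vcnj (N w) = N w \<and> N w \<in> Wc \<and> N w \<odot> cph U z w = 0 \<and> N w \<odot> c.a w = 0 \<and> N w \<odot> c.A w = 0"
    if w: "w \<in> z ` U" for w
  proof (intro conjI)
    have r: "vcnj (c.A w) = c.a w" "vcnj (c.a w) = c.A w" by (simp_all add: c.A_def)
    have d: "cnj (c.a w \<odot> cvec n) = c.A w \<odot> cvec n" "cnj (c.A w \<odot> cvec n) = c.a w \<odot> cvec n"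
      "cnj (cph U z w \<odot> cvec n) = cph U z w \<odot> cvec n"
      using bdot_vcnj[of "c.a w" "cvec n"] bdot_vcnj[of "c.A w" "cvec n"] bdot_vcnj[of "cph U z w" "cvec n"]
      by (simp_all add: r c.ph_real w)
    show "vcnj (N w) = N w"
      unfolding N_def vcnj_simps r d c.ph_real[OF w] complex_cnj_inverse c.g_real by (simp add: add.commute)
    have aW: "c.a w \<in> Wc" "cph U z w \<in> Wc" by (rule derivatives_Wc[OF U w])+
    then have "c.A w \<in> Wc" unfolding c.A_def by (intro complexification_lin)
    then show "N w \<in> Wc" unfolding N_def using aW nW by (intro complexification_lin)
    note fr = c.frame_xi[OF w] c.ph_orth[OF w] c.aa[OF w] c.AA[OF w] c.ph_unit[OF w] c.g_nz[OF w]
    show "N w \<odot> cph U z w = 0" "N w \<odot> c.a w = 0" "N w \<odot> c.A w = 0"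
      unfolding N_def by (simp_all add: fr bdot_commute[of "cvec n"])
  qed
  have "in_chart U z normal_line w = vec.span {N w}" if w: "w \<in> D" for w
  proof -
    have wU: "w \<in> z ` U" "N w \<noteq> 0" using w by (auto simp: D_def)
    obtain q where q: "q \<in> U" "w = z q" using wU by blast
    have nl: "in_chart U z normal_line w = {x \<in> Wc. x \<odot> cph U z w = 0 \<and> x \<odot> c.a w = 0 \<and> x \<odot> vcnj (c.a w) = 0}"
      unfolding q(2) in_chart_at[OF U q(1)] by (rule normal_line_chart[OF U q(1)])
    obtain r i where ri: "r \<in> W" "i \<in> W" "N w = cvec r + \<i> *s cvec i"
      using Wc_split props[OF wU(1)] by metis
    have "vcnj (N w) = cvec r - \<i> *s cvec i" unfolding ri(3) vcnj_simps by (simp add: vec_eq_iff)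
    then have "cvec r - \<i> *s cvec i = cvec r + \<i> *s cvec i" using props[OF wU(1)] ri(3) by simp
    then have "cvec i = 0" by (simp add: vec_eq_iff)
    then have Nr: "N w = cvec r" using ri(3) by simp
    have r0: "r \<noteq> 0" using wU(2) Nr by auto
    have N1: "cvec r \<odot> cph U z w = 0" "cvec r \<odot> c.a w = 0"
      using props[OF wU(1)] unfolding Nr by simp_all
    show ?thesis
    proof (intro set_eqI iffI)
      fix x assume "x \<in> in_chart U z normal_line w"
      then show "x \<in> vec.span {N w}"
        using Wc_normal_unique[OF U wU(1) ri(1) r0 N1, of x]
        unfolding nl Nr vec.span_singleton by blast
    next
      fix x assume "x \<in> vec.span {N w}"
      then obtain k where "x = k *s N w" unfolding vec.span_singleton by blast
      then show "x \<in> in_chart U z normal_line w"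
        using props[OF wU(1)] unfolding nl c.A_def by (auto intro: complexification_lin)
    qed
  qed
  then have "line_frame U z normal_line p D N"
    using oD smooth_on_subset[OF smN, of D] n(1) Np p by (auto simp: line_frame_def D_def)
  moreover have "vcnj (N w) = N w \<and> N w \<in> Wc \<and> N w \<odot> cph U z w = 0 \<and> N w \<odot> c.a w = 0" if "w \<in> D" for w
    using that props by (auto simp: D_def)
  ultimately show ?thesis using that by blast
qed

lemma xi_in_normal_line:
  assumes U: "(U, z) \<in> \<A>" and p: "p \<in> U"
  shows "xi' U z (z p) \<in> normal_line p"
proof -
  interpret c: minimal_chart "z ` U" "cph U z" by (rule chart[OF U])
  have zp: "z p \<in> z ` U" using p by simp
  have "c.xi (z p) \<in> Wc"
    unfolding c.xi_def using derivatives_Wc[OF U zp] by (intro complexification_lin)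
  then show ?thesis
    unfolding normal_line_chart[OF U p] using c.frame_xi[OF zp] by (simp add: c.A_def)
qed

text \<open>In codimension one \<open>xi\<close> is \<open>k\<close> times a nonzero real vector
  \<open>N\<close>, so \<open>Q\<close> is the square of \<open>k\<close> times the positive number
  \<open>N \<odot> N\<close>.\<close>

lemma Q_eq_0_imp_xi:
  assumes U: "(U, z) \<in> \<A>" and p: "p \<in> U" and Q: "Q' U z (z p) = 0"
  shows "xi' U z (z p) = 0"
proof -
  obtain D N where fr: "line_frame U z normal_line p D N"
    and N: "\<And>w. w \<in> D \<Longrightarrow> vcnj (N w) = N w \<and> N w \<in> Wc \<and> N w \<odot> cph U z w = 0 \<and> N w \<odot> a' U z w = 0"
    using normal_frame[OF U p] by blast
  interpret c: minimal_chart "z ` U" "cph U z" by (rule chart[OF U])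
  have zD: "z p \<in> D" "N (z p) \<noteq> 0" and "in_chart U z normal_line (z p) = vec.span {N (z p)}"
    using fr by (auto simp: line_frame_def)
  then have "normal_line p = vec.span {N (z p)}" using in_chart_at[OF U p] by metis
  then obtain k where k: "c.xi (z p) = k *s N (z p)"
    using xi_in_normal_line[OF U p] unfolding vec.span_singleton by blast
  have "N (z p) \<odot> N (z p) \<noteq> 0" using zD bdot_vcnj_self_eq_0_iff[of "N (z p)"] N by simp
  then have "k = 0" using Q unfolding c.Q_def k by simp
  then show ?thesis using k by simp
qed

definition hopf_sequence where
  "hopf_sequence j p = (if j mod 4 = 0 then line_of (\<phi> p) else if j mod 4 = 1 then vec.span {tangent p}
     else if j mod 4 = (2::nat) then normal_line p else vec.span {vcnj (tangent p)})"

lemma frame_0: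
  assumes U: "(U, z) \<in> \<A>" and p: "p \<in> U" and B: "\<And>q. q \<in> topspace X \<Longrightarrow> B q = line_of (\<phi> q)"
  shows "line_frame U z B p (z ` U) (cph U z)"
proof -
  interpret c: minimal_chart "z ` U" "cph U z" by (rule chart[OF U])
  have "cph U z w \<noteq> 0" if "w \<in> z ` U" for w using c.ph_unit[OF that] by auto
  moreover have "in_chart U z B w = vec.span {cph U z w}" if "w \<in> z ` U" for w
    using that B chart_subset[OF U] by (auto simp: in_chart_at[OF U] line_of_def cph_def cvec_def)
  ultimately show ?thesis
    using c.open_D c.smooth_ph p unfolding line_frame_def by blast
qed

lemma span_tangent:
  assumes U: "(U, z) \<in> \<A>" and p: "p \<in> U"
  shows "vec.span {tangent p} = vec.span {a' U z (z p)}"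
    "vec.span {vcnj (tangent p)} = vec.span {vcnj (a' U z (z p))}"
proof -
  obtain c where c: "c \<noteq> 0" "tangent p = c *s a' U z (z p)" using tangent_chart[OF U p] .
  show "vec.span {tangent p} = vec.span {a' U z (z p)}" unfolding c(2) by (rule vec_span_scale[OF c(1)])
  show "vec.span {vcnj (tangent p)} = vec.span {vcnj (a' U z (z p))}"
    unfolding c(2) vcnj_simps by (rule vec_span_scale) (use c(1) in simp)
qed

lemma frame_1:
  assumes U: "(U, z) \<in> \<A>" and p: "p \<in> U" and D: "open D" "z p \<in> D" "D \<subseteq> z ` U"
    and B: "\<And>q. q \<in> U \<Longrightarrow> z q \<in> D \<Longrightarrow> B q = vec.span {a' U z (z q)}"
  shows "line_frame U z B p D (a' U z)"
proof -
  interpret c: minimal_chart "z ` U" "cph U z" by (rule chart[OF U])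
  have "c.a w \<noteq> 0" if "w \<in> D" for w using c.immersed D(3) that unfolding c.a_def by blast
  moreover have "in_chart U z B w = vec.span {c.a w}" if w: "w \<in> D" for w
  proof -
    obtain q where "q \<in> U" "w = z q" using w D(3) by blast
    then show ?thesis using B w by (simp add: in_chart_at[OF U])
  qed
  ultimately show ?thesis
    using D smooth_on_subset[OF c.smooth_a D(3)] unfolding line_frame_def by blast
qed

lemma frame_3:
  assumes U: "(U, z) \<in> \<A>" and p: "p \<in> U"
  shows "line_frame U z (\<lambda>q. vec.span {vcnj (tangent q)}) p (z ` U) (minimal_chart.A (cph U z))"
proof -
  interpret c: minimal_chart "z ` U" "cph U z" by (rule chart[OF U])
  have "c.A w \<noteq> 0" if "w \<in> z ` U" for w using c.g_nz[OF that] by (auto simp: c.g_def)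
  moreover have "in_chart U z (\<lambda>q. vec.span {vcnj (tangent q)}) w = vec.span {c.A w}" if w: "w \<in> z ` U" for w
    using w span_tangent(2)[OF U] by (auto simp: in_chart_at[OF U] c.A_def)
  ultimately show ?thesis
    using p c.open_D c.smooth_A unfolding line_frame_def by blast
qed

lemma image_0:
  assumes U: "(U, z) \<in> \<A>" and p: "p \<in> U" and B: "\<And>q. q \<in> topspace X \<Longrightarrow> B q = line_of (\<phi> q)"
  shows "A'_image U z B p = vec.span {a' U z (z p)}"
proof -
  interpret c: minimal_chart "z ` U" "cph U z" by (rule chart[OF U])
  have zp: "z p \<in> z ` U" using p by simp
  show ?thesis
    by (rule A'_image_line[OF U p frame_0[OF U p B], where l = 0])
      (use c.frame_xi[OF zp] in \<open>simp_all add: hinner_eq_bdot c.ph_real[OF zp] c.a_def\<close>)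
qed

lemma image_1:
  assumes U: "(U, z) \<in> \<A>" and p: "p \<in> U" and fr: "line_frame U z B p D (a' U z)"
  shows "A'_image U z B p = vec.span {xi' U z (z p)}"
proof -
  interpret c: minimal_chart "z ` U" "cph U z" by (rule chart[OF U])
  have zp: "z p \<in> z ` U" using p by simp
  show ?thesis
  proof (rule A'_image_line[OF U p fr])
    show "dz c.a (z p) = c.mu (z p) *s c.a (z p) + c.xi (z p)"
      using c.b_xi[of "z p"] by (simp add: c.b_def add.commute)
    show "hinner (c.xi (z p)) (c.a (z p)) = 0"
      using c.frame_xi[OF zp] by (simp add: hinner_eq_bdot c.A_def)
  qed
qed

text \<open>Differentiating the orthogonality relations of \<open>N\<close> leaves
  \<open>dz N\<close> with components only along \<open>N\<close> and \<open>A\<close>. The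
  coefficient along \<open>A\<close> is \<open>- (N \<odot> xi) / g\<close>, nonzero because
  \<open>Q\<close> is a multiple of \<open>N \<odot> xi\<close>.\<close>

lemma image_2:
  assumes U: "(U, z) \<in> \<A>" and p: "p \<in> U" and Q: "Q' U z (z p) \<noteq> 0"
  shows "A'_image U z normal_line p = vec.span {vcnj (a' U z (z p))}"
proof -
  obtain D N where fr: "line_frame U z normal_line p D N"
    and N: "\<And>w. w \<in> D \<Longrightarrow> vcnj (N w) = N w \<and> N w \<in> Wc \<and> N w \<odot> cph U z w = 0 \<and> N w \<odot> a' U z w = 0"
    using normal_frame[OF U p] by blast
  interpret c: minimal_chart "z ` U" "cph U z" by (rule chart[OF U])
  have oD: "open D" "z p \<in> D" "D \<subseteq> z ` U" and smN: "smooth_on D N" and N0: "N (z p) \<noteq> 0"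
    and nl: "in_chart U z normal_line (z p) = vec.span {N (z p)}"
    using fr by (auto simp: line_frame_def)
  have nlp: "normal_line p = vec.span {N (z p)}" using nl in_chart_at[OF U p] by metis
  have zp: "z p \<in> z ` U" using p by simp
  have dN: "wder N (z p) (dz N (z p)) (dzb N (z p))"
    by (intro wder_dz smooth_on_differentiable[OF smN oD(2)])
  have NA: "N w \<odot> c.A w = 0" if "w \<in> D" for w
    using bdot_vcnj[of "N w" "c.a w"] N[OF that] by (simp add: c.A_def)
  have d1: "dz N (z p) \<odot> cph U z (z p) = 0"
    using sder_zero_on(1)[OF oD(1,2) _ sder_bdot[OF dN c.wder_ph[OF zp]]] N oD(2) by simp
  have d2: "dz N (z p) \<odot> c.a (z p) = - (N (z p) \<odot> c.xi (z p))"
    using sder_zero_on(1)[OF oD(1,2) _ sder_bdot[OF dN c.wder_a[OF zp]]] N oD(2)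
    by (simp add: c.b_xi eq_neg_iff_add_eq_0)
  have d3: "dz N (z p) \<odot> c.A (z p) = 0"
    using sder_zero_on(1)[OF oD(1,2) NA sder_bdot[OF dN c.wder_A[OF zp]]] N oD(2) by simp
  have d4: "dz N (z p) \<in> Wc"
    unfolding complexification_def
  proof safe
    fix n assume n: "\<forall>y\<in>W. n \<bullet> y = 0"
    have "N w \<odot> cvec n = 0" if "w \<in> D" for w using N[OF that] n by (auto simp: complexification_def)
    from sder_zero_on(1)[OF oD(1,2) this sder_bdot[OF dN wder_const[of "cvec n"]]]
    show "dz N (z p) \<odot> cvec n = 0" by simp
  qed
  define nu where "nu = - (N (z p) \<odot> c.xi (z p)) / c.g (z p)"
  have aWc: "c.A (z p) \<in> Wc" unfolding c.A_def by (intro complexification_lin derivatives_Wc(2)[OF U zp])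
  have "dz N (z p) - nu *s c.A (z p) \<in> normal_line p"
    unfolding normal_line_chart[OF U p] c.A_def[symmetric]
    using d1 d2 d3 d4 aWc c.g_nz[OF zp] c.frame_xi[OF zp] c.AA[OF zp]
    by (auto simp: nu_def intro!: complexification_lin)
  then obtain l where l: "dz N (z p) - nu *s c.A (z p) = l *s N (z p)"
    unfolding nlp vec.span_singleton by blast
  have nu0: "nu \<noteq> 0"
  proof -
    obtain k where k: "c.xi (z p) = k *s N (z p)"
      using xi_in_normal_line[OF U p] unfolding nlp vec.span_singleton by blast
    then have "c.Q (z p) = k * (N (z p) \<odot> c.xi (z p))" unfolding c.Q_def by (metis bdot_simps(7))
    then show ?thesis using Q c.g_nz[OF zp] by (auto simp: nu_def)
  qed
  have "A'_image U z normal_line p = vec.span {nu *s c.A (z p)}"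
  proof (rule A'_image_line[OF U p fr])
    show "dz N (z p) = l *s N (z p) + nu *s c.A (z p)" using l by (simp add: algebra_simps)
    show "hinner (nu *s c.A (z p)) (N (z p)) = 0"
      using N[OF oD(2)] NA[OF oD(2)] by (simp add: hinner_eq_bdot bdot_commute)
  qed
  then show ?thesis unfolding vec_span_scale[OF nu0] by (simp add: c.A_def)
qed

lemma image_3:
  assumes U: "(U, z) \<in> \<A>" and p: "p \<in> U"
  shows "A'_image U z (\<lambda>q. vec.span {vcnj (tangent q)}) p = line_of (\<phi> p)"
proof -
  interpret c: minimal_chart "z ` U" "cph U z" by (rule chart[OF U])
  have zp: "z p \<in> z ` U" using p by simp
  have "A'_image U z (\<lambda>q. vec.span {vcnj (tangent q)}) p = vec.span {(- c.g (z p)) *s cph U z (z p)}"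
    by (rule A'_image_line[OF U p frame_3[OF U p], where l = 0])
      (use wder_imp_dz(1)[OF c.wder_A[OF zp]] c.ph_orth[OF zp] in \<open>simp_all add: hinner_eq_bdot c.A_def\<close>)
  also have "\<dots> = vec.span {cph U z (z p)}"
    by (rule vec_span_scale) (use c.g_nz[OF zp] in simp)
  finally show ?thesis using p by (simp add: cph_def line_of_def in_chart_at[OF U] cvec_def)
qed

text \<open>Zeros of \<open>Q\<close> are excluded for the two steps into and out of the normal
  line: there \<open>xi\<close> vanishes and the pointwise image degenerates.\<close>

lemma hopf_sequence_Suc:
  assumes U: "(U, z) \<in> \<A>" and p: "p \<in> U" and Q: "Q' U z (z p) \<noteq> 0"
  shows "A'_image U z (hopf_sequence j) p = hopf_sequence (Suc j) p"
proof -
  interpret c: minimal_chart "z ` U" "cph U z" by (rule chart[OF U])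
  have zp: "z p \<in> z ` U" using p by simp
  consider "j mod 4 = 0" | "j mod 4 = 1" | "j mod 4 = 2" | "j mod 4 = 3" by linarith
  then show ?thesis
  proof cases
    case 1
    then have "hopf_sequence j = (\<lambda>p. line_of (\<phi> p))" "hopf_sequence (Suc j) p = vec.span {tangent p}"
      by (auto simp: hopf_sequence_def fun_eq_iff mod_Suc)
    then show ?thesis using image_0[OF U p] span_tangent[OF U p] by simp
  next
    case 2
    then have h: "hopf_sequence j = (\<lambda>p. vec.span {tangent p})" "hopf_sequence (Suc j) p = normal_line p"
      by (auto simp: hopf_sequence_def fun_eq_iff mod_Suc)
    have "A'_image U z (\<lambda>p. vec.span {tangent p}) p = vec.span {c.xi (z p)}"
      by (rule image_1[OF U p frame_1[OF U p c.open_D zp]]) (use span_tangent[OF U] in auto)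
    also have "\<dots> = normal_line p"
    proof -
      obtain D N where fr: "line_frame U z normal_line p D N"
        using normal_frame[OF U p] by blast
      then have "in_chart U z normal_line (z p) = vec.span {N (z p)}" by (auto simp: line_frame_def)
      then have nlp: "normal_line p = vec.span {N (z p)}" using in_chart_at[OF U p] by metis
      obtain k where k: "c.xi (z p) = k *s N (z p)"
        using xi_in_normal_line[OF U p] unfolding nlp vec.span_singleton by blast
      have "k \<noteq> 0" using Q unfolding c.Q_def k by auto
      then show ?thesis unfolding nlp k by (rule vec_span_scale)
    qed
    finally show ?thesis using h by simp
  next
    case 3
    then have "hopf_sequence j = normal_line" "hopf_sequence (Suc j) p = vec.span {vcnj (tangent p)}"
      by (auto simp: hopf_sequence_def fun_eq_iff mod_Suc)
    then show ?thesis using image_2[OF U p Q] span_tangent[OF U p] by simp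
  next
    case 4
    then have "hopf_sequence j = (\<lambda>p. vec.span {vcnj (tangent p)})" "hopf_sequence (Suc j) p = line_of (\<phi> p)"
      by (auto simp: hopf_sequence_def fun_eq_iff mod_Suc)
    then show ?thesis using image_3[OF U p] by simp
  qed
qed

lemma smooth_hopf_sequence: "smooth_subbundle \<A> 1 (hopf_sequence j)"
proof (rule smooth_subbundle_line)
  fix U z p assume U: "(U, z) \<in> \<A>" and p: "p \<in> U"
  interpret c: minimal_chart "z ` U" "cph U z" by (rule chart[OF U])
  have zp: "z p \<in> z ` U" using p by simp
  consider "j mod 4 = 0" | "j mod 4 = 1" | "j mod 4 = 2" | "j mod 4 = 3" by linarith
  then show "\<exists>D s. line_frame U z (hopf_sequence j) p D s"
  proof cases
    case 1
    then have "hopf_sequence j = (\<lambda>p. line_of (\<phi> p))" by (auto simp: hopf_sequence_def fun_eq_iff)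
    then show ?thesis using frame_0[OF U p] by metis
  next
    case 2
    then have "hopf_sequence j = (\<lambda>p. vec.span {tangent p})" by (auto simp: hopf_sequence_def fun_eq_iff)
    moreover have "line_frame U z (\<lambda>p. vec.span {tangent p}) p (z ` U) (a' U z)"
      by (rule frame_1[OF U p c.open_D zp]) (use span_tangent[OF U] in auto)
    ultimately show ?thesis by metis
  next
    case 3
    then have "hopf_sequence j = normal_line" by (auto simp: hopf_sequence_def fun_eq_iff)
    then show ?thesis using normal_frame[OF U p] by metis
  next
    case 4
    then have "hopf_sequence j = (\<lambda>p. vec.span {vcnj (tangent p)})" by (auto simp: hopf_sequence_def fun_eq_iff)
    then show ?thesis using frame_3[OF U p] by metis
  qed
qed

text \<open>The three lines after the first are orthogonal to the position vector, and by
  periodicity the fourth term is again the position line, so the order is exactly 3.\<close>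

lemma hopf_isotropy:
  assumes ex: "(U0, z0) \<in> \<A>" "p0 \<in> U0" "Q' U0 z0 (z0 p0) \<noteq> 0"
  shows "isotropy_order X \<A> \<phi> 3"
  unfolding isotropy_order_def
proof (intro conjI exI[of _ hopf_sequence])
  let ?Z = "{p \<in> topspace X. \<exists>(U, z)\<in>\<A>. p \<in> U \<and> Q' U z (z p) = 0}"
  have "image_bundle X \<A> (hopf_sequence j) (hopf_sequence (Suc j))" for j
    unfolding image_bundle_def
  proof (intro conjI exI[of _ ?Z])
    show "\<exists>k. smooth_subbundle \<A> k (hopf_sequence (Suc j))" using smooth_hopf_sequence by blast
    show "?Z \<subseteq> topspace X" by blast
    show "X derived_set_of ?Z = {}" by (rule Q_zeros_isolated[OF ex])
    have "hopf_sequence (Suc j) p = A'_image U z (hopf_sequence j) p"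
      if U: "(U, z) \<in> \<A>" and p: "p \<in> U - ?Z" for U z p
    proof -
      have "p \<in> topspace X" using p chart_subset[OF U] by blast
      then have "Q' U z (z p) \<noteq> 0" using p U by blast
      then show ?thesis using hopf_sequence_Suc[OF U] p by simp
    qed
    then show "\<forall>(U, z)\<in>\<A>. \<forall>p\<in>U - ?Z. hopf_sequence (Suc j) p = A'_image U z (hopf_sequence j) p"
      by blast
  qed
  then show "harmonic_sequence X \<A> \<phi> hopf_sequence"
    unfolding harmonic_sequence_def by (auto simp: hopf_sequence_def)
  have line: "line_of (\<phi> p) = vec.span {cvec (\<phi> p)}" for p by (simp add: line_of_def cvec_def)
  have h: "hopf_sequence 0 p = vec.span {cvec (\<phi> p)}" "hopf_sequence (Suc 0) p = vec.span {tangent p}"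
    "hopf_sequence 2 p = normal_line p" "hopf_sequence 3 p = vec.span {vcnj (tangent p)}"
    "hopf_sequence 4 p = vec.span {cvec (\<phi> p)}" for p
    by (simp_all add: hopf_sequence_def line)
  have t: "cvec (\<phi> p) \<odot> tangent p = 0" "cvec (\<phi> p) \<odot> vcnj (tangent p) = 0" if p: "p \<in> topspace X" for p
  proof -
    obtain U z where U: "(U, z) \<in> \<A>" "p \<in> U" using cover[OF p] by blast
    interpret c: minimal_chart "z ` U" "cph U z" by (rule chart[OF U(1)])
    have zp: "z p \<in> z ` U" using U by simp
    obtain k where "tangent p = k *s c.a (z p)" using tangent_chart[OF U] by blast
    moreover have "cph U z (z p) = cvec (\<phi> p)" using U by (simp add: cph_def in_chart_at[OF U(1)])
    ultimately show "cvec (\<phi> p) \<odot> tangent p = 0" "cvec (\<phi> p) \<odot> vcnj (tangent p) = 0"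
      using c.ph_orth[OF zp] by (simp_all add: c.A_def)
  qed
  show "\<forall>i. 0 < i \<and> i \<le> 3 \<longrightarrow> bundle_perp X (hopf_sequence 0) (hopf_sequence i)"
  proof safe
    fix i :: nat assume "0 < i" "i \<le> 3"
    then consider "i = Suc 0" | "i = 2" | "i = 3" by linarith
    then show "bundle_perp X (hopf_sequence 0) (hopf_sequence i)"
    proof cases
      case 1
      then show ?thesis using t by (auto simp: bundle_perp_def h vec.span_singleton hinner_eq_bdot)
    next
      case 2
      have "cvec (\<phi> p) \<odot> vcnj x = 0" if "x \<in> normal_line p" for x p
      proof -
        have "x \<odot> cvec (\<phi> p) = 0" using that by (simp add: normal_line_def)
        then show ?thesis using bdot_vcnj[of x "cvec (\<phi> p)"] by (simp add: bdot_commute)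
      qed
      then show ?thesis using 2 by (auto simp: bundle_perp_def h vec.span_singleton hinner_eq_bdot)
    next
      case 3
      then show ?thesis using t by (auto simp: bundle_perp_def h vec.span_singleton hinner_eq_bdot)
    qed
  qed
  show "\<not> bundle_perp X (hopf_sequence 0) (hopf_sequence (3 + 1))"
  proof
    obtain p where p: "p \<in> topspace X" by (rule ex_point)
    assume "bundle_perp X (hopf_sequence 0) (hopf_sequence (3 + 1))"
    moreover have "cvec (\<phi> p) \<in> vec.span {cvec (\<phi> p)}" by (rule vec.span_base) simp
    ultimately have "hinner (cvec (\<phi> p)) (cvec (\<phi> p)) = 0"
      using p h unfolding bundle_perp_def by simp
    then have "\<phi> p = 0" by simp
    then show False using unit[OF p] by simp
  qed
qed simp

end

section \<open>The coassociative form\<close>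

text \<open>The metric terms measure the failure of the cross product pairing to be alternating;
  after subtracting them the 4-linear form is totally skew, as \<open>psi_skew\<close>
  shows.\<close>

definition psi :: "complex^7 \<Rightarrow> complex^7 \<Rightarrow> complex^7 \<Rightarrow> complex^7 \<Rightarrow> complex" where
  "psi x y u v = (x \<otimes> y) \<odot> (u \<otimes> v) - (x \<odot> u) * (y \<odot> v) + (x \<odot> v) * (y \<odot> u)"

lemma psi_lin:
  "psi (x + x') y u v = psi x y u v + psi x' y u v" "psi x (y + y') u v = psi x y u v + psi x y' u v"
  "psi x y (u + u') v = psi x y u v + psi x y u' v" "psi x y u (v + v') = psi x y u v + psi x y u v'"
  "psi (c *s x) y u v = c * psi x y u v" "psi x (c *s y) u v = c * psi x y u v"
  "psi x y (c *s u) v = c * psi x y u v" "psi x y u (c *s v) = c * psi x y u v"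
  by (simp_all add: psi_def algebra_simps)

lemma psi_skew: "psi y x u v = - psi x y u v" "psi x u y v = - psi x y u v" "psi x y v u = - psi x y u v"
proof -
  show "psi y x u v = - psi x y u v"
    unfolding psi_def using ccross_antisym[of y x] by simp
  show "psi x y v u = - psi x y u v"
    unfolding psi_def using ccross_antisym[of v u] by simp
  have "(x \<otimes> y) \<odot> (u \<otimes> v) + (x \<otimes> u) \<odot> (y \<otimes> v)
      = - ((x \<otimes> y) \<odot> (v \<otimes> u) + (x \<otimes> u) \<odot> (v \<otimes> y))"
    using ccross_antisym[of v u] ccross_antisym[of v y] by simp
  also have "\<dots> = - (2 * (x \<odot> v) * (y \<odot> u) - (x \<odot> y) * (v \<odot> u) - (x \<odot> u) * (v \<odot> y))"
    unfolding bdot_ccross_ccross_swap ..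
  finally show "psi x u y v = - psi x y u v"
    unfolding psi_def by (simp add: bdot_commute[of v] bdot_commute[of u y] algebra_simps)
qed

lemma psi_same [simp]: "psi x x u v = 0" "psi x y y v = 0" "psi x y u u = 0" "psi x y x v = 0"
  "psi x y u y = 0" "psi x y u x = 0"
proof -
  show 1: "psi x x u v = 0" "psi x y y v = 0" "psi x y u u = 0" for x y u v
    using psi_skew(1)[of x x u v] psi_skew(2)[of x y y v] psi_skew(3)[of x y u u] by simp_all
  show 2: "psi x y x v = 0" "psi x y u y = 0" for x y u v
    using psi_skew(2)[of x x y v] psi_skew(3)[of x y u y] 1 psi_skew(2)[of x u y y] by simp_all
  show "psi x y u x = 0"
    using psi_skew(3)[of x y x u] 2 by simp
qed

lemma psi_zero_on_basis:
  assumes p: "psi w1 w2 w3 w4 = 0"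
    and xs: "x \<in> {w1, w2, w3, w4}" "y \<in> {w1, w2, w3, w4}" "u \<in> {w1, w2, w3, w4}" "v \<in> {w1, w2, w3, w4}"
  shows "psi x y u v = 0"
proof -
  have s1: "psi y x u v = 0" and s2: "psi x u y v = 0" and s3: "psi x y v u = 0" if "psi x y u v = 0" for x y u v
    using that psi_skew by (metis neg_equal_0_iff_equal)+
  \<comment> \<open>One reduced word in adjacent transpositions for each of the 24 orderings of the
    four vectors; tuples with a repetition are covered by \<open>psi_same\<close>.\<close>
  note ps = p p[THEN s1] p[THEN s2] p[THEN s3]
      p[THEN s1, THEN s2] p[THEN s1, THEN s3] p[THEN s2, THEN s1] p[THEN s2, THEN s3]
      p[THEN s3, THEN s2] p[THEN s1, THEN s2, THEN s1] p[THEN s1, THEN s2, THEN s3] p[THEN s1, THEN s3, THEN s2]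
      p[THEN s2, THEN s1, THEN s3] p[THEN s2, THEN s3, THEN s2] p[THEN s3, THEN s2, THEN s1] p[THEN s1, THEN s2, THEN s1, THEN s3]
      p[THEN s1, THEN s2, THEN s3, THEN s2] p[THEN s1, THEN s3, THEN s2, THEN s1] p[THEN s2, THEN s1, THEN s3, THEN s2] p[THEN s2, THEN s3, THEN s2, THEN s1]
      p[THEN s1, THEN s2, THEN s1, THEN s3, THEN s2] p[THEN s1, THEN s2, THEN s3, THEN s2, THEN s1] p[THEN s2, THEN s1, THEN s3, THEN s2, THEN s1] p[THEN s1, THEN s2, THEN s1, THEN s3, THEN s2, THEN s1]
  have "\<forall>x\<in>{w1, w2, w3, w4}. \<forall>y\<in>{w1, w2, w3, w4}. \<forall>u\<in>{w1, w2, w3, w4}. \<forall>v\<in>{w1, w2, w3, w4}. psi x y u v = 0"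
    by (simp add: ps)
  then show ?thesis using xs by blast
qed

context hopf_surface
begin

text \<open>On bases of the two planes of a compatible splitting the metric terms vanish by
  orthogonality and the cross product term by compatibility. An alternating 4-form vanishing on a
  spanning quadruple vanishes on the whole 4-space.\<close>

lemma psi_zero:
  assumes W': "admits_cross_compatible W" and xs: "x \<in> Wc" "y \<in> Wc" "u \<in> Wc" "v \<in> Wc"
  shows "psi x y u v = 0"
proof -
  obtain W1 W2 where c: "subspace W1" "subspace W2" "dim W1 = 2" "dim W2 = 2"
    and o: "\<And>a b. a \<in> W1 \<Longrightarrow> b \<in> W2 \<Longrightarrow> orthogonal a b" and WW: "W = {a + b | a b. a \<in> W1 \<and> b \<in> W2}"
    and cr: "\<And>u v. u \<in> cross_span W1 W1 \<Longrightarrow> v \<in> cross_span W2 W2 \<Longrightarrow> orthogonal u v"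
    using W' unfolding admits_cross_compatible_def cross_compatible_def by blast
  have basis: "\<exists>p q. V = span {p, q}" if V: "subspace V" "dim V = 2" for V :: "(real^7) set"
  proof -
    obtain B where B: "B \<subseteq> V" "independent B" "V \<subseteq> span B" "card B = dim V" using basis_exists by blast
    then obtain p q where "B = {p, q}" using V(2) by (metis card_2_iff)
    moreover have "span B \<subseteq> V" using B(1) V(1) by (rule span_minimal)
    ultimately show ?thesis using B(3) by blast
  qed
  obtain w1 w2 where w12: "W1 = span {w1, w2}" using basis c by blast
  obtain w3 w4 where w34: "W2 = span {w3, w4}" using basis c by blast
  have in1: "w1 \<in> W1" "w2 \<in> W1" unfolding w12 by (auto intro: span_base)
  have in2: "w3 \<in> W2" "w4 \<in> W2" unfolding w34 by (auto intro: span_base)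
  have "cross7 w1 w2 \<in> cross_span W1 W1" "cross7 w3 w4 \<in> cross_span W2 W2"
    unfolding cross_span_def using in1 in2 by (auto intro!: span_base)
  then have "cross7 w1 w2 \<bullet> cross7 w3 w4 = 0" using cr by (simp add: orthogonal_def)
  moreover have "w1 \<bullet> w3 = 0" "w1 \<bullet> w4 = 0" using o in1 in2 by (auto simp: orthogonal_def)
  ultimately have p: "psi (cvec w1) (cvec w2) (cvec w3) (cvec w4) = 0" by (simp add: psi_def)
  let ?B = "{cvec w1, cvec w2, cvec w3, cvec w4}"
  have real: "\<exists>k1 k2 k3 k4. cvec w = k1 *s cvec w1 + k2 *s cvec w2 + k3 *s cvec w3 + k4 *s cvec w4" if "w \<in> W" for w
  proof -
    have "w \<in> span {w1, w2, w3, w4}"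
      using that span_sum_pairs[of w1 w2 w3 w4] unfolding WW w12 w34 by simp
    then obtain k1 where "w - k1 *\<^sub>R w1 \<in> span {w2, w3, w4}" unfolding span_breakdown_eq by blast
    then obtain k2 where "w - k1 *\<^sub>R w1 - k2 *\<^sub>R w2 \<in> span {w3, w4}" unfolding span_breakdown_eq by blast
    then obtain k3 where "w - k1 *\<^sub>R w1 - k2 *\<^sub>R w2 - k3 *\<^sub>R w3 \<in> span {w4}" unfolding span_breakdown_eq by blast
    then obtain k4 where "w - k1 *\<^sub>R w1 - k2 *\<^sub>R w2 - k3 *\<^sub>R w3 = k4 *\<^sub>R w4" unfolding span_singleton by blast
    then have w: "w = k1 *\<^sub>R w1 + k2 *\<^sub>R w2 + k3 *\<^sub>R w3 + k4 *\<^sub>R w4" by (simp add: algebra_simps)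
    have "cvec w = of_real k1 *s cvec w1 + of_real k2 *s cvec w2 + of_real k3 *s cvec w3 + of_real k4 *s cvec w4"
      unfolding w by simp
    then show ?thesis by blast
  qed
  have dec: "\<exists>k1 k2 k3 k4. x = k1 *s cvec w1 + k2 *s cvec w2 + k3 *s cvec w3 + k4 *s cvec w4" if x: "x \<in> Wc" for x
  proof -
    obtain r i where ri: "r \<in> W" "i \<in> W" "x = cvec r + \<i> *s cvec i" using Wc_split[OF x] by blast
    obtain k1 k2 k3 k4 where r: "cvec r = k1 *s cvec w1 + k2 *s cvec w2 + k3 *s cvec w3 + k4 *s cvec w4"
      using real[OF ri(1)] by blast
    obtain l1 l2 l3 l4 where i: "cvec i = l1 *s cvec w1 + l2 *s cvec w2 + l3 *s cvec w3 + l4 *s cvec w4"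
      using real[OF ri(2)] by blast
    have "x = (k1 + \<i> * l1) *s cvec w1 + (k2 + \<i> * l2) *s cvec w2 + (k3 + \<i> * l3) *s cvec w3 + (k4 + \<i> * l4) *s cvec w4"
      unfolding ri(3) r i by (simp add: vec_eq_iff algebra_simps)
    then show ?thesis by blast
  qed
  have B: "psi a b c d = 0" if "a \<in> ?B" "b \<in> ?B" "c \<in> ?B" "d \<in> ?B" for a b c d
    by (rule psi_zero_on_basis[OF p that])
  have i: "cvec w1 \<in> ?B" "cvec w2 \<in> ?B" "cvec w3 \<in> ?B" "cvec w4 \<in> ?B" by simp_all
  have 1: "psi a b c v = 0" if "a \<in> ?B" "b \<in> ?B" "c \<in> ?B" for a b c
  proof -
    from dec[OF xs(4)] obtain k1 k2 k3 k4 where v: "v = k1 *s cvec w1 + k2 *s cvec w2 + k3 *s cvec w3 + k4 *s cvec w4" by blast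
    show ?thesis unfolding v psi_lin B[OF that i(1)] B[OF that i(2)] B[OF that i(3)] B[OF that i(4)] by simp
  qed
  have 2: "psi a b u v = 0" if "a \<in> ?B" "b \<in> ?B" for a b
  proof -
    from dec[OF xs(3)] obtain k1 k2 k3 k4 where u: "u = k1 *s cvec w1 + k2 *s cvec w2 + k3 *s cvec w3 + k4 *s cvec w4" by blast
    show ?thesis unfolding u psi_lin 1[OF that i(1)] 1[OF that i(2)] 1[OF that i(3)] 1[OF that i(4)] by simp
  qed
  have 3: "psi a y u v = 0" if "a \<in> ?B" for a
  proof -
    from dec[OF xs(2)] obtain k1 k2 k3 k4 where y: "y = k1 *s cvec w1 + k2 *s cvec w2 + k3 *s cvec w3 + k4 *s cvec w4" by blast
    show ?thesis unfolding y psi_lin 2[OF that i(1)] 2[OF that i(2)] 2[OF that i(3)] 2[OF that i(4)] by simp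
  qed
  from dec[OF xs(1)] obtain k1 k2 k3 k4 where x: "x = k1 *s cvec w1 + k2 *s cvec w2 + k3 *s cvec w3 + k4 *s cvec w4" by blast
  show ?thesis unfolding x psi_lin 3[OF i(1)] 3[OF i(2)] 3[OF i(3)] 3[OF i(4)] by simp
qed

text \<open>All of \<open>ph\<close>, \<open>xi\<close>, \<open>a\<close>, \<open>A\<close> lie in
  the complexified 4-space, and \<open>ph\<close> is orthogonal to \<open>a\<close> and
  \<open>A\<close>; so \<open>psi\<close> of these four vectors is the pseudo-umbilic expression
  itself.\<close>

lemma compatible_imp_pseudo_umbilic:
  assumes W': "admits_cross_compatible W" and U: "(U, z) \<in> \<A>"
  shows "minimal_chart.pseudo_umbilic (z ` U) (cph U z)"
proof -
  interpret c: minimal_chart "z ` U" "cph U z" by (rule chart[OF U])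
  show ?thesis
    unfolding c.pseudo_umbilic_def
  proof
    fix w assume w: "w \<in> z ` U"
    note d = derivatives_Wc[OF U w]
    have x: "c.xi w \<in> Wc" unfolding c.xi_def using d by (intro complexification_lin)
    have A: "c.A w \<in> Wc" unfolding c.A_def using d by (intro complexification_lin)
    have "psi (cph U z w) (c.xi w) (c.a w) (c.A w) = 0" by (rule psi_zero[OF W' d(1) x d(2) A])
    then show "(cph U z w \<otimes> c.xi w) \<odot> c.H w = 0"
      using c.ph_orth[OF w] by (simp add: psi_def c.H_def)
  qed
qed

end

section \<open>Totally geodesic surfaces\<close>

context rsurface
begin

text \<open>Otherwise every point would be isolated, and a chart would map an isolated point to an
  open singleton of the plane.\<close>

lemma no_isolated_points: "X derived_set_of Z = {} \<Longrightarrow> Z \<subseteq> topspace X \<Longrightarrow> \<exists>p\<in>topspace X. p \<notin> Z"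
proof (rule ccontr)
  assume d: "X derived_set_of Z = {}" and "Z \<subseteq> topspace X" "\<not> (\<exists>p\<in>topspace X. p \<notin> Z)"
  then have Z: "Z = topspace X" by blast
  obtain p where p: "p \<in> topspace X" by (rule ex_point)
  then obtain U z where U: "(U, z) \<in> \<A>" "p \<in> U" using cover by blast
  have "p \<notin> X derived_set_of Z" using d by simp
  then obtain T where T: "p \<in> T" "openin X T" "\<And>q. q \<in> T \<Longrightarrow> q \<in> Z \<Longrightarrow> q = p"
    using p unfolding derived_set_of_def by blast
  have "T = {p}" using T openin_subset[OF T(2)] Z by blast
  then have "T \<inter> U = {p}" using U(2) by blast
  then have "open {z p}" using chart_image_open[OF U(1) T(2)] by simp
  then show False using not_open_singleton by blast
qed

text \<open>The rank \<open>k\<close> is the same at all points, and a zero fibre forces it to be 0,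
  since an independent family cannot contain the zero vector.\<close>

lemma smooth_subbundle_zero:
  fixes B :: "'a \<Rightarrow> (complex^'n) set"
  assumes B: "smooth_subbundle \<A> k B" and p: "p \<in> topspace X" "B p = {0}" and q: "q \<in> topspace X"
  shows "B q = {0}"
proof -
  have loc: "\<exists>s. inj_on s {..<k} \<and> vec.independent (s ` {..<k}) \<and> B q = vec.span (s ` {..<k})"
    if q: "q \<in> topspace X" for q
  proof -
    obtain U z where U: "(U, z) \<in> \<A>" "q \<in> U" using cover[OF q] by blast
    from bspec[OF bspec[OF B[unfolded smooth_subbundle_def] U(1), unfolded prod.case] U(2)]
    obtain D s where D: "z q \<in> D" and s: "\<forall>w\<in>D. inj_on (\<lambda>i. s i w) {..<k} \<and>
        vec.independent ((\<lambda>i. s i w) ` {..<k}) \<and> in_chart U z B w = vec.span ((\<lambda>i. s i w) ` {..<k})"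
      by (elim exE conjE)
    show ?thesis using bspec[OF s D] unfolding in_chart_at[OF U] by (intro exI)
  qed
  obtain s where s: "vec.independent (s ` {..<k})" "B p = vec.span (s ` {..<k})" using loc[OF p(1)] by blast
  have "k = 0"
  proof (rule ccontr)
    assume "k \<noteq> 0"
    then have s0: "s 0 \<in> s ` {..<k}" by simp
    then have "s 0 \<in> B p" unfolding s(2) by (rule vec.span_base)
    then have "s 0 = 0" using p(2) by simp
    then show False using s(1) s0 vec.dependent_zero by metis
  qed
  then show ?thesis using loc[OF q] by auto
qed

lemma image_bundle_zero:
  fixes B C :: "'a \<Rightarrow> (complex^'n) set"
  assumes B: "\<And>p. p \<in> topspace X \<Longrightarrow> B p = {0}" and C: "image_bundle X \<A> B C" and q: "q \<in> topspace X"
  shows "C q = {0}"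
proof -
  obtain k Z where k: "smooth_subbundle \<A> k C" and Z: "Z \<subseteq> topspace X" "X derived_set_of Z = {}"
    and im: "\<And>U z p. (U, z) \<in> \<A> \<Longrightarrow> p \<in> U - Z \<Longrightarrow> C p = A'_image U z B p"
    using C unfolding image_bundle_def by blast
  obtain p where p: "p \<in> topspace X" "p \<notin> Z" using no_isolated_points[OF Z(2,1)] by blast
  then obtain U z where U: "(U, z) \<in> \<A>" "p \<in> U" using cover by blast
  have z: "z p \<in> z ` U" using U by simp
  have Bw: "in_chart U z B w = {0}" if "w \<in> z ` U" for w
    using that B chart_subset[OF U(1)] by (auto simp: in_chart_at[OF U(1)])
  have h: "herm_perp_part {0} v = v" for v :: "complex^'n"
    unfolding herm_perp_part_def by (rule the_equality) (auto simp: hinner_def)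
  have dz0: "dz v (z p) = 0" if D: "z p \<in> D" "local_section U z B D v" for v D
  proof -
    have o: "open D" "D \<subseteq> z ` U" and m: "\<forall>w\<in>D. v w \<in> in_chart U z B w"
      using D(2) by (simp_all add: local_section_def)
    have v: "0 = v w" if w: "w \<in> D" for w
      using bspec[OF m w] Bw[OF subsetD[OF o(2) w]] by simp
    have "wder v (z p) 0 0" by (rule wder_cong_open[OF o(1) D(1) v wder_const])
    then show ?thesis by (rule wder_imp_dz)
  qed
  have ls: "local_section U z B (z ` U) (\<lambda>_. 0)"
    unfolding local_section_def using chart_open_image[OF U(1)] Bw by (simp add: smooth_on_const)
  have "A'_image U z B p = {0}"
  proof (intro set_eqI iffI)
    fix x assume "x \<in> A'_image U z B p"
    then obtain v D where "x = dz v (z p)" "z p \<in> D" "local_section U z B D v"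
      unfolding A'_image_def B[OF p(1)] h by (elim CollectE exE conjE)
    then show "x \<in> {0}" using dz0 by simp
  next
    fix x :: "complex^'n" assume "x \<in> {0}"
    then have "x = dz (\<lambda>_. 0) (z p)" using dz0[OF z ls] by simp
    then show "x \<in> A'_image U z B p"
      unfolding A'_image_def B[OF p(1)] h using z ls by (intro CollectI exI conjI)
  qed
  then have "C p = {0}" using im[OF U(1), of p] U(2) p(2) by simp
  then show ?thesis by (rule smooth_subbundle_zero[OF k p(1) _ q])
qed

end

context hopf_surface
begin

text \<open>If \<open>Q\<close> vanished identically, so would \<open>xi\<close>, and the second
  bundle of any harmonic sequence would be zero at an unexceptional point, hence everywhere by
  constancy of rank. The third and fourth bundles would then vanish too, making the fourth
  orthogonal to the position line, against order 3.\<close>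

lemma isotropy_imp_nonflat:
  assumes iso: "isotropy_order X \<A> \<phi> 3"
  shows "\<exists>U z p. (U, z) \<in> \<A> \<and> p \<in> U \<and> Q' U z (z p) \<noteq> 0"
proof (rule ccontr)
  assume "\<not> ?thesis"
  then have xi: "xi' U z (z p) = 0" if "(U, z) \<in> \<A>" "p \<in> U" for U z p
    using Q_eq_0_imp_xi that by blast
  obtain \<Phi> where h: "harmonic_sequence X \<A> \<phi> \<Phi>" and np: "\<not> bundle_perp X (\<Phi> 0) (\<Phi> 4)"
    using iso unfolding isotropy_order_def by auto
  have \<Phi>0: "\<And>p. p \<in> topspace X \<Longrightarrow> \<Phi> 0 p = line_of (\<phi> p)"
    and ib: "\<And>j. image_bundle X \<A> (\<Phi> j) (\<Phi> (Suc j))"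
    using h unfolding harmonic_sequence_def by blast+
  obtain Z1 where Z1: "Z1 \<subseteq> topspace X" "X derived_set_of Z1 = {}"
    and im1: "\<And>U z p. (U, z) \<in> \<A> \<Longrightarrow> p \<in> U - Z1 \<Longrightarrow> \<Phi> (Suc 0) p = A'_image U z (\<Phi> 0) p"
    using ib[of 0] unfolding image_bundle_def by blast
  obtain k Z2 where k: "smooth_subbundle \<A> k (\<Phi> (Suc (Suc 0)))" and Z2: "Z2 \<subseteq> topspace X" "X derived_set_of Z2 = {}"
    and im2: "\<And>U z p. (U, z) \<in> \<A> \<Longrightarrow> p \<in> U - Z2 \<Longrightarrow> \<Phi> (Suc (Suc 0)) p = A'_image U z (\<Phi> (Suc 0)) p"
    using ib[of "Suc 0"] unfolding image_bundle_def by blast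
  have "X derived_set_of (Z1 \<union> Z2) = {}" using Z1 Z2 by (simp add: derived_set_of_Un)
  then obtain p where p: "p \<in> topspace X" "p \<notin> Z1 \<union> Z2" using no_isolated_points Z1(1) Z2(1) by (metis Un_least)
  obtain U z where U: "(U, z) \<in> \<A>" "p \<in> U" using cover[OF p(1)] by blast
  \<comment> \<open>A set without accumulation points is closed. This gives an open neighbourhood of
    \<open>p\<close> on which the first bundle is spanned by \<open>a\<close>, as required before
    applying the next step of the sequence.\<close>
  have "closedin X Z1" using Z1 by (simp add: closedin_contains_derived_set)
  then have "openin X (topspace X - Z1)" by (simp add: closedin_def)
  from chart_image_open[OF U(1) this] have oD: "open (z ` ((topspace X - Z1) \<inter> U))" .
  have fr: "line_frame U z (\<Phi> (Suc 0)) p (z ` ((topspace X - Z1) \<inter> U)) (a' U z)"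
  proof (rule frame_1[OF U oD])
    show "z p \<in> z ` ((topspace X - Z1) \<inter> U)" using p U by blast
    show "z ` ((topspace X - Z1) \<inter> U) \<subseteq> z ` U" by blast
    fix q assume q: "q \<in> U" "z q \<in> z ` ((topspace X - Z1) \<inter> U)"
    then have "q \<in> U - Z1" using chart_inj[OF U(1)] by (auto dest: inj_onD)
    then have "\<Phi> (Suc 0) q = A'_image U z (\<Phi> 0) q" by (rule im1[OF U(1)])
    also have "\<dots> = vec.span {a' U z (z q)}" by (rule image_0[OF U(1) q(1) \<Phi>0])
    finally show "\<Phi> (Suc 0) q = vec.span {a' U z (z q)}" .
  qed
  have "\<Phi> (Suc (Suc 0)) p = vec.span {xi' U z (z p)}"
    using im2[OF U(1), of p] image_1[OF U fr] U(2) p(2) by simp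
  then have "\<Phi> (Suc (Suc 0)) p = {0}" using xi[OF U] by simp
  then have 2: "\<Phi> (Suc (Suc 0)) q = {0}" if "q \<in> topspace X" for q
    using smooth_subbundle_zero[OF k p(1) _ that] by blast
  have 3: "\<Phi> (Suc (Suc (Suc 0))) q = {0}" if "q \<in> topspace X" for q
    by (rule image_bundle_zero[OF 2 ib that])
  have "\<Phi> (Suc (Suc (Suc (Suc 0)))) q = {0}" if "q \<in> topspace X" for q
    by (rule image_bundle_zero[OF 3 ib that])
  then have "bundle_perp X (\<Phi> 0) (\<Phi> 4)"
    unfolding bundle_perp_def by (simp add: hinner_def numeral_eq_Suc)
  then show False using np by simp
qed

end

theorem theorem4:
  fixes X :: "'a topology" and A :: "'a atlas" and \<phi> F :: "'a \<Rightarrow> real^7"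
  assumes "riemann_surface X A"
    and "conformal_immersion A \<phi>"
    and "harmonic_into_sphere X A \<phi>"
    and "is_cross_primitive A \<phi> F"
  shows "(pseudo_umbilical A F \<and> \<not> parallel_mean_curvature A F \<longrightarrow>
            (\<exists>W. subspace W \<and> dim W = 5 \<and> full_in X \<phi> W \<and> superminimal X A \<phi>)
          \<or> (\<exists>W. subspace W \<and> dim W = 5 \<and> full_in X \<phi> W \<and> isotropy_order X A \<phi> 3)
          \<or> (\<exists>W. subspace W \<and> dim W = 4 \<and> admits_cross_compatible W \<and> superconformal_in X A \<phi> W))
       \<and> ((\<exists>W. subspace W \<and> dim W = 4 \<and> admits_cross_compatible W \<and> superconformal_in X A \<phi> W) \<longrightarrow>
            pseudo_umbilical A F \<and> \<not> parallel_mean_curvature A F)"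
proof -
  interpret primitive_surface X A \<phi> F
    by unfold_locales (use assms in auto)
  show ?thesis
  proof (intro conjI impI)
    assume "pseudo_umbilical A F \<and> \<not> parallel_mean_curvature A F"
    then obtain W U z p where hW: "subspace W" "dim W = 4" "admits_cross_compatible W" "\<phi> ` topspace X \<subseteq> W"
      and ex: "(U, z) \<in> A" "p \<in> U" "Q' U z (z p) \<noteq> 0"
      using nonparallel_imp by blast
    interpret hopf_surface X A \<phi> W
      by unfold_locales (use hW in auto)
    have "isotropy_order X A \<phi> 3" by (rule hopf_isotropy[OF ex])
    then have "superconformal_in X A \<phi> W"
      unfolding superconformal_in_def using hW unit by (auto simp: norm_eq_1 image_subset_iff)
    then show "(\<exists>W. subspace W \<and> dim W = 5 \<and> full_in X \<phi> W \<and> superminimal X A \<phi>)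
          \<or> (\<exists>W. subspace W \<and> dim W = 5 \<and> full_in X \<phi> W \<and> isotropy_order X A \<phi> 3)
          \<or> (\<exists>W. subspace W \<and> dim W = 4 \<and> admits_cross_compatible W \<and> superconformal_in X A \<phi> W)"
      using hW \<open>superconformal_in X A \<phi> W\<close> by blast
  next
    assume "\<exists>W. subspace W \<and> dim W = 4 \<and> admits_cross_compatible W \<and> superconformal_in X A \<phi> W"
    then obtain W where hW: "subspace W" "dim W = 4" "admits_cross_compatible W" "superconformal_in X A \<phi> W" by blast
    then have iso: "isotropy_order X A \<phi> 3" and sub: "\<phi> ` topspace X \<subseteq> W"
      unfolding superconformal_in_def by auto
    interpret hopf_surface X A \<phi> W
      by unfold_locales (use hW sub in auto)
    have P: "pseudo_umbilical A F"
      unfolding pseudo_umbilical_iff using compatible_imp_pseudo_umbilic[OF hW(3)] by blast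
    obtain U z p where ex: "(U, z) \<in> A" "p \<in> U" "Q' U z (z p) \<noteq> 0"
      using isotropy_imp_nonflat[OF iso] by blast
    interpret c: minimal_chart "z ` U" "cph U z" by (rule chart[OF ex(1)])
    \<comment> \<open>Once pseudo-umbilicity is known, nonvanishing of this product at a single
      point refutes parallelism by \<open>parallel_iff\<close>.\<close>
    have "c.xi (z p) \<otimes> c.A (z p) \<noteq> 0"
      using c.xi_cross_eq_0_imp[of "z p"] ex by blast
    then show "pseudo_umbilical A F" "\<not> parallel_mean_curvature A F"
      using P ex unfolding parallel_iff[OF P] by blast+
  qed
qed

end
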